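(* Let $\mathcal V$ be a category with finite limits and let $\phi\colon(X_j)_{j\in J}\to Y$ be a cover in the free coproduct completion $\mathsf{Fam}(\mathcal V)$, i.e. a morphism whose codomain is a single object $Y$ of $\mathcal V$ (a one-member family). The following are equivalent: (i) $\phi$ is an effective descent morphism (in $\mathsf{Fam}(\mathcal V)$); (ii) we have an equivalence of categories $\mathcal V/Y\simeq\mathsf{Desc}_{\mathsf{conn}}(\phi)$.
   Context: Free coproduct completion: $\mathsf{Fam}(\mathcal V)$ has as objects set-indexed families $(X_j)_{j\in J}$ of objects of $\mathcal V$; a morphism $(X_j)_{j\in J}\to(Y_k)_{k\in K}$ is a function $f\colon J\to K$ together with morphisms $\phi_j\colon X_j\to Y_{f(j)}$ in $\mathcal V$. An object of $\mathcal V$ is identified with a one-member family. $\mathcal V/Y$ denotes the slice category of $\mathcal V$ over $Y$. Descent: for a category $\mathcal A$ with pullbacks and a morphism $p\colon e\to b$, let $p^*\colon\mathcal A/b\to\mathcal A/e$ be the pullback functor, $p_!\dashv p^*$ its left adjoint, $T^p$ the induced monad, $\mathsf{Desc}(p)$ the category of descent data for $p$ (equivalently, the category of Eilenberg–Moore algebras of $T^p$), and $\mathcal K^p\colon\mathcal A/b\to\mathsf{Desc}(p)$ the comparison functor. The morphism $p$ is an effective descent morphism if $\mathcal K^p$ is an equivalence. Connected objects: an object $a$ of a category $\mathcal A$ with coproducts is connected if $\mathcal A(a,-)\colon\mathcal A\to\mathsf{Set}$ preserves coproducts. $\mathsf{Desc}_{\mathsf{conn}}(\phi)$ is the full subcategory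 of $\mathsf{Desc}(\phi)$ consisting of the connected objects, where $\mathsf{Desc}(\phi)$ is formed in $\mathcal A=\mathsf{Fam}(\mathcal V)$.
   Formalization: In (ii) the equivalence is the one given by the canonical comparison functor from V/Y to Desc_conn(φ), not an arbitrary equivalence; with an arbitrary one the claim fails, e.g. for V the poset [0,1] and φ: 1/2 → 1. *)

theory Defs
  imports "HOL-Library.FuncSet"
begin

section \<open>Categories, functors, equivalences\<close>

record ('o, 'a) cat =
  Obj :: "'o set"
  Arr :: "'a set"
  Dom :: "'a \<Rightarrow> 'o"
  Cod :: "'a \<Rightarrow> 'o"
  Idn :: "'o \<Rightarrow> 'a"
  Cmp :: "'a \<Rightarrow> 'a \<Rightarrow> 'a"  (infixr "\<cdot>\<index>" 70)

definition Hom :: "('o, 'a) cat \<Rightarrow> 'o \<Rightarrow> 'o \<Rightarrow> 'a set" where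
  "Hom C a b = {f \<in> Arr C. Dom C f = a \<and> Cod C f = b}"

locale category =
  fixes C :: "('o, 'a) cat" (structure)
  assumes Dom_in_Obj: "f \<in> Arr C \<Longrightarrow> Dom C f \<in> Obj C"
    and Cod_in_Obj: "f \<in> Arr C \<Longrightarrow> Cod C f \<in> Obj C"
    and Idn_in_Hom: "a \<in> Obj C \<Longrightarrow> Idn C a \<in> Hom C a a"
    and Cmp_in_Hom: "f \<in> Hom C a b \<Longrightarrow> g \<in> Hom C b c \<Longrightarrow> g \<cdot> f \<in> Hom C a c"
    and Cmp_Idn_left: "f \<in> Hom C a b \<Longrightarrow> Idn C b \<cdot> f = f"
    and Cmp_Idn_right: "f \<in> Hom C a b \<Longrightarrow> f \<cdot> Idn C a = f"
    and Cmp_assoc: "f \<in> Hom C a b \<Longrightarrow> g \<in> Hom C b c \<Longrightarrow> h \<in> Hom C c d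
                      \<Longrightarrow> h \<cdot> (g \<cdot> f) = (h \<cdot> g) \<cdot> f"

record ('o, 'a, 'p, 'b) fctr =
  omap :: "'o \<Rightarrow> 'p"
  amap :: "'a \<Rightarrow> 'b"

locale is_functor = C: category C + D: category D
  for C :: "('o, 'a) cat" and D :: "('p, 'b) cat" and F :: "('o, 'a, 'p, 'b) fctr" +
  assumes omap_in_Obj: "a \<in> Obj C \<Longrightarrow> omap F a \<in> Obj D"
    and amap_in_Hom: "f \<in> Hom C a b \<Longrightarrow> amap F f \<in> Hom D (omap F a) (omap F b)"
    and amap_Idn: "a \<in> Obj C \<Longrightarrow> amap F (Idn C a) = Idn D (omap F a)"
    and amap_Cmp: "f \<in> Hom C a b \<Longrightarrow> g \<in> Hom C b c
                     \<Longrightarrow> amap F (g \<cdot>\<^bsub>C\<^esub> f) = amap F g \<cdot>\<^bsub>D\<^esub> amap F f"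

definition id_functor :: "('o, 'a, 'o, 'a) fctr" where
  "id_functor = \<lparr>omap = \<lambda>x. x, amap = \<lambda>f. f\<rparr>"

definition comp_functor ::
  "('p, 'b, 'q, 'c) fctr \<Rightarrow> ('o, 'a, 'p, 'b) fctr \<Rightarrow> ('o, 'a, 'q, 'c) fctr" (infixr "\<circ>\<^sub>F" 70) where
  "G \<circ>\<^sub>F F = \<lparr>omap = \<lambda>x. omap G (omap F x), amap = \<lambda>f. amap G (amap F f)\<rparr>"

definition is_iso :: "('o, 'a) cat \<Rightarrow> 'a \<Rightarrow> bool" where
  "is_iso C f \<longleftrightarrow> f \<in> Arr C \<and>
     (\<exists>g \<in> Hom C (Cod C f) (Dom C f).
        g \<cdot>\<^bsub>C\<^esub> f = Idn C (Dom C f) \<and> f \<cdot>\<^bsub>C\<^esub> g = Idn C (Cod C f))"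

definition natural_iso ::
  "('o, 'a) cat \<Rightarrow> ('p, 'b) cat \<Rightarrow> ('o, 'a, 'p, 'b) fctr \<Rightarrow> ('o, 'a, 'p, 'b) fctr
     \<Rightarrow> ('o \<Rightarrow> 'b) \<Rightarrow> bool" where
  "natural_iso C D F G \<tau> \<longleftrightarrow>
     (\<forall>a \<in> Obj C. \<tau> a \<in> Hom D (omap F a) (omap G a) \<and> is_iso D (\<tau> a)) \<and>
     (\<forall>f \<in> Arr C. amap G f \<cdot>\<^bsub>D\<^esub> \<tau> (Dom C f) = \<tau> (Cod C f) \<cdot>\<^bsub>D\<^esub> amap F f)"

definition is_equivalence ::
  "('o, 'a) cat \<Rightarrow> ('p, 'b) cat \<Rightarrow> ('o, 'a, 'p, 'b) fctr \<Rightarrow> bool" where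
  "is_equivalence C D F \<longleftrightarrow> is_functor C D F \<and>
     (\<exists>G. is_functor D C G \<and>
        (\<exists>\<eta>. natural_iso C C id_functor (G \<circ>\<^sub>F F) \<eta>) \<and>
        (\<exists>\<epsilon>. natural_iso D D (F \<circ>\<^sub>F G) id_functor \<epsilon>))"

definition full_subcategory :: "('o, 'a) cat \<Rightarrow> ('o \<Rightarrow> bool) \<Rightarrow> ('o, 'a) cat" where
  "full_subcategory C P =
     C\<lparr>Obj := {a \<in> Obj C. P a}, Arr := {f \<in> Arr C. P (Dom C f) \<and> P (Cod C f)}\<rparr>"


section \<open>Limits, pullbacks, coproducts\<close>

definition is_cone ::
  "('j, 'k) cat \<Rightarrow> ('o, 'a) cat \<Rightarrow> ('j, 'k, 'o, 'a) fctr \<Rightarrow> 'o \<Rightarrow> ('j \<Rightarrow> 'a) \<Rightarrow> bool" where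
  "is_cone J C D l \<pi> \<longleftrightarrow> l \<in> Obj C \<and>
     (\<forall>j \<in> Obj J. \<pi> j \<in> Hom C l (omap D j)) \<and>
     (\<forall>k \<in> Arr J. amap D k \<cdot>\<^bsub>C\<^esub> \<pi> (Dom J k) = \<pi> (Cod J k))"

definition is_limit ::
  "('j, 'k) cat \<Rightarrow> ('o, 'a) cat \<Rightarrow> ('j, 'k, 'o, 'a) fctr \<Rightarrow> 'o \<Rightarrow> ('j \<Rightarrow> 'a) \<Rightarrow> bool" where
  "is_limit J C D l \<pi> \<longleftrightarrow> is_cone J C D l \<pi> \<and>
     (\<forall>x \<xi>. is_cone J C D x \<xi> \<longrightarrow>
        (\<exists>!u. u \<in> Hom C x l \<and> (\<forall>j \<in> Obj J. \<pi> j \<cdot>\<^bsub>C\<^esub> u = \<xi> j)))"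

text \<open>Every finite category is isomorphic to one whose objects and arrows are natural numbers.\<close>

definition has_finite_limits :: "('o, 'a) cat \<Rightarrow> bool" where
  "has_finite_limits C \<longleftrightarrow>
     (\<forall>(J :: (nat, nat) cat) D. finite (Obj J) \<and> finite (Arr J) \<and> is_functor J C D \<longrightarrow>
        (\<exists>l \<pi>. is_limit J C D l \<pi>))"

definition is_pullback :: "('o, 'a) cat \<Rightarrow> 'a \<Rightarrow> 'a \<Rightarrow> 'a \<Rightarrow> 'a \<Rightarrow> bool" where
  "is_pullback C f g p q \<longleftrightarrow>
     f \<in> Arr C \<and> g \<in> Arr C \<and> p \<in> Arr C \<and> q \<in> Arr C \<and>
     Cod C f = Cod C g \<and> Cod C p = Dom C f \<and> Cod C q = Dom C g \<and> Dom C p = Dom C q \<and>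
     f \<cdot>\<^bsub>C\<^esub> p = g \<cdot>\<^bsub>C\<^esub> q \<and>
     (\<forall>x. \<forall>s \<in> Hom C x (Dom C f). \<forall>t \<in> Hom C x (Dom C g). f \<cdot>\<^bsub>C\<^esub> s = g \<cdot>\<^bsub>C\<^esub> t \<longrightarrow>
        (\<exists>!u. u \<in> Hom C x (Dom C p) \<and> p \<cdot>\<^bsub>C\<^esub> u = s \<and> q \<cdot>\<^bsub>C\<^esub> u = t))"

text \<open>A fixed choice of pullbacks: \<open>pb1\<close> and \<open>pb2\<close> are the projections of the chosen
  pullback of \<open>f\<close> and \<open>g\<close>, whenever one exists.\<close>

definition pb :: "('o, 'a) cat \<Rightarrow> 'a \<Rightarrow> 'a \<Rightarrow> 'a \<times> 'a" where
  "pb C f g = (SOME pq. is_pullback C f g (fst pq) (snd pq))"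

definition pb1 :: "('o, 'a) cat \<Rightarrow> 'a \<Rightarrow> 'a \<Rightarrow> 'a" where
  "pb1 C f g = fst (pb C f g)"

definition pb2 :: "('o, 'a) cat \<Rightarrow> 'a \<Rightarrow> 'a \<Rightarrow> 'a" where
  "pb2 C f g = snd (pb C f g)"

definition pb_lift :: "('o, 'a) cat \<Rightarrow> 'a \<Rightarrow> 'a \<Rightarrow> 'a \<Rightarrow> 'a \<Rightarrow> 'a" where
  "pb_lift C f g s t =
     (THE u. u \<in> Hom C (Dom C s) (Dom C (pb1 C f g)) \<and>
             pb1 C f g \<cdot>\<^bsub>C\<^esub> u = s \<and> pb2 C f g \<cdot>\<^bsub>C\<^esub> u = t)"

definition is_coproduct ::
  "('o, 'a) cat \<Rightarrow> 'i set \<Rightarrow> ('i \<Rightarrow> 'o) \<Rightarrow> 'o \<Rightarrow> ('i \<Rightarrow> 'a) \<Rightarrow> bool" where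
  "is_coproduct C I b c \<iota> \<longleftrightarrow> c \<in> Obj C \<and>
     (\<forall>i \<in> I. b i \<in> Obj C \<and> \<iota> i \<in> Hom C (b i) c) \<and>
     (\<forall>x \<in> Obj C. \<forall>\<xi>. (\<forall>i \<in> I. \<xi> i \<in> Hom C (b i) x) \<longrightarrow>
        (\<exists>!u. u \<in> Hom C c x \<and> (\<forall>i \<in> I. u \<cdot>\<^bsub>C\<^esub> \<iota> i = \<xi> i)))"


section \<open>Sets of indices and connected objects\<close>

text \<open>No single type has all sets as subsets, so ``set'' is understood relative to a universe:
  a collection \<open>U\<close> of subsets of a type \<open>'i\<close> that contains the singletons and an infinite set
  and is closed under subsets, images and \<open>U\<close>-indexed disjoint unions.  Examples are all subsets
  of an infinite type and the sets of size below an uncountable regular cardinal.\<close>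

locale universe =
  fixes U :: "'i set set"
  assumes singleton_in: "{i} \<in> U"
    and infinite_in: "\<exists>S \<in> U. infinite S"
    and subset_in: "J \<in> U \<Longrightarrow> K \<subseteq> J \<Longrightarrow> K \<in> U"
    and image_in: "J \<in> U \<Longrightarrow> f ` J \<in> U"
    and Sigma_in: "J \<in> U \<Longrightarrow> (\<And>j. j \<in> J \<Longrightarrow> L j \<in> U) \<Longrightarrow>
                     \<exists>S \<in> U. \<exists>h. bij_betw h (Sigma J L) S"

text \<open>\<open>C(a, -)\<close> preserves coproducts when it sends every coproduct cocone
  to a coproduct cocone of sets, i.e. when the canonical map from the disjoint union of the
  sets \<open>C(a, b\<^sub>i)\<close> to \<open>C(a, c)\<close> is bijective.\<close>

definition connected_object :: "'i set set \<Rightarrow> ('o, 'a) cat \<Rightarrow> 'o \<Rightarrow> bool" where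
  "connected_object U C a \<longleftrightarrow> a \<in> Obj C \<and>
     (\<forall>I \<in> U. \<forall>b c \<iota>. is_coproduct C I b c \<iota> \<longrightarrow>
        bij_betw (\<lambda>(i, g). \<iota> i \<cdot>\<^bsub>C\<^esub> g) (SIGMA i:I. Hom C a (b i)) (Hom C a c))"


section \<open>Slices, monads and descent\<close>

text \<open>Category of objects of \<open>C\<close> with extra structure: \<open>S\<close> is the set of structured objects,
  \<open>u\<close> the underlying object, and \<open>R x h y\<close> says that \<open>h\<close> is compatible with the structures.
  Arrows record their endpoints.\<close>

definition structured ::
  "('o, 'a) cat \<Rightarrow> 's set \<Rightarrow> ('s \<Rightarrow> 'o) \<Rightarrow> ('s \<Rightarrow> 'a \<Rightarrow> 's \<Rightarrow> bool) \<Rightarrow> ('s, 's \<times> 'a \<times> 's) cat" where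
  "structured C S u R =
     \<lparr>Obj = S,
      Arr = {(x, h, y). x \<in> S \<and> y \<in> S \<and> h \<in> Hom C (u x) (u y) \<and> R x h y},
      Dom = (\<lambda>(x, h, y). x),
      Cod = (\<lambda>(x, h, y). y),
      Idn = (\<lambda>x. (x, Idn C (u x), x)),
      Cmp = (\<lambda>(y', k, z) (x, h, y). (x, k \<cdot>\<^bsub>C\<^esub> h, z))\<rparr>"

definition slice :: "('o, 'a) cat \<Rightarrow> 'o \<Rightarrow> ('a, 'a \<times> 'a \<times> 'a) cat" where
  "slice C b = structured C {f \<in> Arr C. Cod C f = b} (Dom C) (\<lambda>f h g. g \<cdot>\<^bsub>C\<^esub> h = f)"

definition slice_functor ::
  "('o, 'a, 'p, 'b) fctr \<Rightarrow> ('a, 'a \<times> 'a \<times> 'a, 'b, 'b \<times> 'b \<times> 'b) fctr" where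
  "slice_functor F =
     \<lparr>omap = amap F, amap = \<lambda>(f, h, g). (amap F f, amap F h, amap F g)\<rparr>"

definition em_category ::
  "('o, 'a) cat \<Rightarrow> ('o, 'a, 'o, 'a) fctr \<Rightarrow> ('o \<Rightarrow> 'a) \<Rightarrow> ('o \<Rightarrow> 'a)
     \<Rightarrow> ('o \<times> 'a, ('o \<times> 'a) \<times> 'a \<times> ('o \<times> 'a)) cat" where
  "em_category C T \<eta> \<mu> =
     structured C
       {(a, \<alpha>). a \<in> Obj C \<and> \<alpha> \<in> Hom C (omap T a) a \<and>
                \<alpha> \<cdot>\<^bsub>C\<^esub> \<eta> a = Idn C a \<and> \<alpha> \<cdot>\<^bsub>C\<^esub> amap T \<alpha> = \<alpha> \<cdot>\<^bsub>C\<^esub> \<mu> a}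
       fst
       (\<lambda>(a, \<alpha>) h (b, \<beta>). h \<cdot>\<^bsub>C\<^esub> \<alpha> = \<beta> \<cdot>\<^bsub>C\<^esub> amap T h)"

text \<open>Comparison functor for an adjunction with right adjoint \<open>R\<close>, defined on \<open>B\<close>,
  and counit \<open>\<epsilon>\<close>.\<close>

definition em_comparison ::
  "('p, 'b) cat \<Rightarrow> ('p, 'b, 'o, 'a) fctr \<Rightarrow> ('p \<Rightarrow> 'b)
     \<Rightarrow> ('p, 'b, 'o \<times> 'a, ('o \<times> 'a) \<times> 'a \<times> ('o \<times> 'a)) fctr" where
  "em_comparison B R \<epsilon> =
     (let k = (\<lambda>x. (omap R x, amap R (\<epsilon> x)))
      in \<lparr>omap = k, amap = \<lambda>f. (k (Dom B f), amap R f, k (Cod B f))\<rparr>)"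

text \<open>For \<open>p : e \<rightarrow> b\<close>: the functors \<open>p\<^sub>! : A/e \<rightarrow> A/b\<close> and \<open>p\<^sup>* : A/b \<rightarrow> A/e\<close>
  with the unit and counit of the adjunction \<open>p\<^sub>! \<stileturn> p\<^sup>*\<close>.\<close>

definition push ::
  "('o, 'a) cat \<Rightarrow> 'a \<Rightarrow> ('a, 'a \<times> 'a \<times> 'a, 'a, 'a \<times> 'a \<times> 'a) fctr" where
  "push A p =
     \<lparr>omap = \<lambda>f. p \<cdot>\<^bsub>A\<^esub> f, amap = \<lambda>(f, h, f'). (p \<cdot>\<^bsub>A\<^esub> f, h, p \<cdot>\<^bsub>A\<^esub> f')\<rparr>"

definition pull ::
  "('o, 'a) cat \<Rightarrow> 'a \<Rightarrow> ('a, 'a \<times> 'a \<times> 'a, 'a, 'a \<times> 'a \<times> 'a) fctr" where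
  "pull A p =
     \<lparr>omap = \<lambda>g. pb2 A g p,
      amap = \<lambda>(g, h, g'). (pb2 A g p, pb_lift A g' p (h \<cdot>\<^bsub>A\<^esub> pb1 A g p) (pb2 A g p), pb2 A g' p)\<rparr>"

definition pp_unit :: "('o, 'a) cat \<Rightarrow> 'a \<Rightarrow> 'a \<Rightarrow> 'a \<times> 'a \<times> 'a" where
  "pp_unit A p f =
     (f, pb_lift A (p \<cdot>\<^bsub>A\<^esub> f) p (Idn A (Dom A f)) f, pb2 A (p \<cdot>\<^bsub>A\<^esub> f) p)"

definition pp_counit :: "('o, 'a) cat \<Rightarrow> 'a \<Rightarrow> 'a \<Rightarrow> 'a \<times> 'a \<times> 'a" where
  "pp_counit A p g = (p \<cdot>\<^bsub>A\<^esub> pb2 A g p, pb1 A g p, g)"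

definition Desc ::
  "('o, 'a) cat \<Rightarrow> 'a
     \<Rightarrow> ('a \<times> 'a \<times> 'a \<times> 'a,
         ('a \<times> 'a \<times> 'a \<times> 'a) \<times> ('a \<times> 'a \<times> 'a) \<times> ('a \<times> 'a \<times> 'a \<times> 'a)) cat" where
  "Desc A p =
     em_category (slice A (Dom A p)) (pull A p \<circ>\<^sub>F push A p) (pp_unit A p)
       (\<lambda>f. amap (pull A p) (pp_counit A p (omap (push A p) f)))"

definition comparison ::
  "('o, 'a) cat \<Rightarrow> 'a
     \<Rightarrow> ('a, 'a \<times> 'a \<times> 'a, 'a \<times> 'a \<times> 'a \<times> 'a,
         ('a \<times> 'a \<times> 'a \<times> 'a) \<times> ('a \<times> 'a \<times> 'a) \<times> ('a \<times> 'a \<times> 'a \<times> 'a)) fctr" where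
  "comparison A p = em_comparison (slice A (Cod A p)) (pull A p) (pp_counit A p)"

definition effective_descent :: "('o, 'a) cat \<Rightarrow> 'a \<Rightarrow> bool" where
  "effective_descent A p \<longleftrightarrow>
     p \<in> Arr A \<and> is_equivalence (slice A (Cod A p)) (Desc A p) (comparison A p)"

definition Desc_conn ::
  "'i set set \<Rightarrow> ('o, 'a) cat \<Rightarrow> 'a
     \<Rightarrow> ('a \<times> 'a \<times> 'a \<times> 'a,
         ('a \<times> 'a \<times> 'a \<times> 'a) \<times> ('a \<times> 'a \<times> 'a) \<times> ('a \<times> 'a \<times> 'a \<times> 'a)) cat" where
  "Desc_conn U A p = full_subcategory (Desc A p) (connected_object U (Desc A p))"


section \<open>Free coproduct completion\<close>

type_synonym ('i, 'o) fam = "'i set \<times> ('i \<Rightarrow> 'o)"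
type_synonym ('i, 'o, 'a) fam_arr = "('i, 'o) fam \<times> (('i \<Rightarrow> 'i) \<times> ('i \<Rightarrow> 'a)) \<times> ('i, 'o) fam"

text \<open>Extensional functions make families and arrows independent of values
  outside the index set.\<close>

definition Fam :: "'i set set \<Rightarrow> ('o, 'a) cat \<Rightarrow> (('i, 'o) fam, ('i, 'o, 'a) fam_arr) cat" where
  "Fam U V =
     \<lparr>Obj = (SIGMA J:U. J \<rightarrow>\<^sub>E Obj V),
      Arr = {((J, X), (f, \<phi>), (K, Y)).
               J \<in> U \<and> X \<in> J \<rightarrow>\<^sub>E Obj V \<and> K \<in> U \<and> Y \<in> K \<rightarrow>\<^sub>E Obj V \<and>
               f \<in> J \<rightarrow>\<^sub>E K \<and> \<phi> \<in> (\<Pi>\<^sub>E j\<in>J. Hom V (X j) (Y (f j)))},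
      Dom = (\<lambda>(X, h, Y). X),
      Cod = (\<lambda>(X, h, Y). Y),
      Idn = (\<lambda>(J, X). ((J, X), (\<lambda>j\<in>J. j, \<lambda>j\<in>J. Idn V (X j)), (J, X))),
      Cmp = (\<lambda>(Y', (g, \<psi>), Z) ((J, X), (f, \<phi>), Y).
               ((J, X), (\<lambda>j\<in>J. g (f j), \<lambda>j\<in>J. \<psi> (f j) \<cdot>\<^bsub>V\<^esub> \<phi> j), Z))\<rparr>"

definition single :: "'i \<Rightarrow> 'o \<Rightarrow> ('i, 'o) fam" where
  "single i0 x = ({i0}, \<lambda>i\<in>{i0}. x)"

definition single_functor ::
  "'i \<Rightarrow> ('o, 'a) cat \<Rightarrow> ('o, 'a, ('i, 'o) fam, ('i, 'o, 'a) fam_arr) fctr" where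
  "single_functor i0 V =
     \<lparr>omap = single i0,
      amap = \<lambda>f. (single i0 (Dom V f), (\<lambda>i\<in>{i0}. i0, \<lambda>i\<in>{i0}. f), single i0 (Cod V f))\<rparr>"

text \<open>The composite of \<open>V/Y \<rightarrow> Fam(V)/Y\<close> with the comparison functor of \<open>\<phi>\<close>.  An abstract
  equivalence between \<open>V/Y\<close> and the connected descent data would be too weak: in the poset
  \<open>[0, 1]\<close>, the arrow from \<open>1/2\<close> to \<open>1\<close> has descent category \<open>[0, 1/2] \<cong> [0, 1]\<close>,
  but is not of effective descent.\<close>

definition single_comparison ::
  "'i set set \<Rightarrow> 'i \<Rightarrow> ('o, 'a) cat \<Rightarrow> ('i, 'o, 'a) fam_arr \<Rightarrow> _" where
  "single_comparison U i0 V \<phi> =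
     comparison (Fam U V) \<phi> \<circ>\<^sub>F slice_functor (single_functor i0 V)"

end

theory Submission
  imports Defs
begin

text \<open>Call a category familial if it has coproducts and every object is a coproduct of connected
  objects.  \<open>Fam(V)\<close> is familial, and so are its slices.  Pulling back preserves coproducts, so the
  descent monad does, and \<open>Desc(\<phi>)\<close> is familial as well: coproducts of algebras are formed on the
  underlying objects, and an algebra falls into summands on which its action is connected.  The
  comparison functor \<open>K : Fam(V)/Y \<rightarrow> Desc(\<phi>)\<close> preserves coproducts.

  If \<open>K\<close> is an equivalence, it matches the connected objects on both sides, and the connected
  objects of \<open>Fam(V)/Y\<close> are those of \<open>V/Y\<close>.  Conversely, a coproduct-preserving functor between
  familial categories that restricts to an equivalence on connected objects is an equivalence,
  because maps between coproducts of connected objects are families of maps between the summands.\<close>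

section \<open>Fully faithful functors and equivalences\<close>

text \<open>Maps out of connected objects do the work. Where these objects decompose everything, a
  cocone is a coproduct as soon as every map from a connected object to its vertex factors through
  exactly one leg; this is how pullback is shown to preserve coproducts. The obstacle in
  \<open>Desc(\<phi>)\<close> is that a connected algebra may have a disconnected underlying object,
  whose pieces are tied together only by the action. A class of linked pieces is connected because
  the summand hit by a homomorphism does not change along a link. Coproduct injections are monic, so
  algebra laws and homomorphism laws can be cancelled down to the classes. Index sets must stay in
  \<open>U\<close>: classes are indexed by chosen representatives, and disjoint unions and fibre
  products of index sets occur through bijective copies inside \<open>'i\<close>. An equivalence is
  treated as a fully faithful and essentially surjective functor. For the converse direction, the
  generating connected objects are those that literally come from \<open>V/Y\<close>, so that
  fullness and faithfulness can be read off from the composite functor on \<open>V/Y\<close> without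
  transport along isomorphisms.\<close>

context category
begin

lemma Hom_iff: "f \<in> Hom C a b \<longleftrightarrow> f \<in> Arr C \<and> Dom C f = a \<and> Cod C f = b"
  by (simp add: Hom_def)

lemma Hom_Dom_Obj: "f \<in> Hom C a b \<Longrightarrow> a \<in> Obj C"
  using Dom_in_Obj by (auto simp: Hom_iff)

lemma Hom_Cod_Obj: "f \<in> Hom C a b \<Longrightarrow> b \<in> Obj C"
  using Cod_in_Obj by (auto simp: Hom_iff)

lemma Arr_Hom: "f \<in> Arr C \<Longrightarrow> f \<in> Hom C (Dom C f) (Cod C f)"
  by (simp add: Hom_iff)

lemma Cmp_Arr [simp]:
  assumes "f \<in> Arr C" "g \<in> Arr C" "Cod C f = Dom C g"
  shows "g \<cdot> f \<in> Arr C" "Dom C (g \<cdot> f) = Dom C f" "Cod C (g \<cdot> f) = Cod C g"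
  using Cmp_in_Hom[of f "Dom C f" "Cod C f" g "Cod C g"] assms by (auto simp: Hom_iff)

lemma Idn_Arr [simp]:
  assumes "a \<in> Obj C"
  shows "Idn C a \<in> Arr C" "Dom C (Idn C a) = a" "Cod C (Idn C a) = a"
  using Idn_in_Hom[OF assms] by (auto simp: Hom_iff)

lemma Cmp_Idn [simp]:
  assumes "f \<in> Arr C"
  shows "Cod C f = b \<Longrightarrow> Idn C b \<cdot> f = f" "Dom C f = a \<Longrightarrow> f \<cdot> Idn C a = f"
  using Cmp_Idn_left Cmp_Idn_right assms by (auto simp: Hom_iff)

lemma Cmp_assoc' [simp]:
  assumes "f \<in> Arr C" "g \<in> Arr C" "h \<in> Arr C" "Cod C f = Dom C g" "Cod C g = Dom C h"
  shows "(h \<cdot> g) \<cdot> f = h \<cdot> (g \<cdot> f)"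
  using Cmp_assoc[of f "Dom C f" "Cod C f" g "Cod C g" h "Cod C h"] assms
  by (auto simp: Hom_iff)

text \<open>The simp rule \<open>Cmp_assoc'\<close> nests composites to the right, so an equation
  \<open>p \<cdot> q = r\<close> no longer matches once \<open>q\<close> is followed by a further
  factor \<open>x\<close>. This is the form that still applies there.\<close>

lemma Cmp_reduce:
  assumes "p \<cdot> q = r" "q \<in> Arr C" "p \<in> Arr C" "Cod C q = Dom C p" "x \<in> Arr C" "Cod C x = Dom C q"
  shows "p \<cdot> (q \<cdot> x) = r \<cdot> x"
  using assms Cmp_assoc' by metis

lemma iso_HomE:
  assumes "is_iso C f" "f \<in> Hom C a b"
  obtains g where "g \<in> Hom C b a" "g \<cdot> f = Idn C a" "f \<cdot> g = Idn C b"
  using assms by (auto simp: is_iso_def Hom_iff)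

lemma isoI:
  assumes "f \<in> Hom C a b" "g \<in> Hom C b a" "g \<cdot> f = Idn C a" "f \<cdot> g = Idn C b"
  shows "is_iso C f"
  using assms by (auto simp: is_iso_def Hom_iff)

end

definition isomorphic :: "('o, 'a) cat \<Rightarrow> 'o \<Rightarrow> 'o \<Rightarrow> bool" where
  "isomorphic C a b \<longleftrightarrow> (\<exists>f \<in> Hom C a b. \<exists>g \<in> Hom C b a.
      g \<cdot>\<^bsub>C\<^esub> f = Idn C a \<and> f \<cdot>\<^bsub>C\<^esub> g = Idn C b)"

definition fully_faithful ::
  "('o, 'a) cat \<Rightarrow> ('p, 'b) cat \<Rightarrow> ('o, 'a, 'p, 'b) fctr \<Rightarrow> bool" where
  "fully_faithful C D F \<longleftrightarrow>
     (\<forall>a \<in> Obj C. \<forall>b \<in> Obj C. bij_betw (amap F) (Hom C a b) (Hom D (omap F a) (omap F b)))"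

definition ess_surj ::
  "('o, 'a) cat \<Rightarrow> ('p, 'b) cat \<Rightarrow> ('o, 'a, 'p, 'b) fctr \<Rightarrow> bool" where
  "ess_surj C D F \<longleftrightarrow> (\<forall>d \<in> Obj D. \<exists>c \<in> Obj C. isomorphic D (omap F c) d)"

lemma fully_faithful_full:
  assumes "fully_faithful C D F" "a \<in> Obj C" "b \<in> Obj C" "h \<in> Hom D (omap F a) (omap F b)"
  obtains f where "f \<in> Hom C a b" "amap F f = h"
proof -
  have "amap F ` Hom C a b = Hom D (omap F a) (omap F b)"
    using assms(1-3) by (simp add: fully_faithful_def bij_betw_def)
  with assms(4) have "h \<in> amap F ` Hom C a b" by simp
  then show ?thesis using that by (elim imageE) simp
qed

lemma fully_faithful_faithful:
  assumes "fully_faithful C D F" "a \<in> Obj C" "b \<in> Obj C" "f \<in> Hom C a b" "g \<in> Hom C a b"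
    "amap F f = amap F g"
  shows "f = g"
proof -
  have "inj_on (amap F) (Hom C a b)"
    using assms(1-3) by (simp add: fully_faithful_def bij_betw_def)
  then show ?thesis using assms(4-6) by (simp add: inj_on_def)
qed

lemma isomorphic_sym: "isomorphic C a b \<Longrightarrow> isomorphic C b a"
  unfolding isomorphic_def by blast

lemma (in category) isomorphic_trans:
  assumes "isomorphic C a b" "isomorphic C b c"
  shows "isomorphic C a c"
proof -
  obtain f g where fg: "f \<in> Hom C a b" "g \<in> Hom C b a" "g \<cdot> f = Idn C a" "f \<cdot> g = Idn C b"
    using assms(1) by (auto simp: isomorphic_def)
  obtain h k where hk: "h \<in> Hom C b c" "k \<in> Hom C c b" "k \<cdot> h = Idn C b" "h \<cdot> k = Idn C c"
    using assms(2) by (auto simp: isomorphic_def)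
  have "k \<cdot> (h \<cdot> f) = f" "f \<cdot> (g \<cdot> k) = k"
    using fg hk by (simp_all add: Hom_iff Cmp_reduce[OF hk(3)] Cmp_reduce[OF fg(4)])
  then show ?thesis
    unfolding isomorphic_def using fg hk
    by (intro bexI[of _ "h \<cdot> f"] bexI[of _ "g \<cdot> k"]) (auto simp: Hom_iff)
qed

context is_functor
begin

lemma amap_Arr [simp]:
  assumes "f \<in> Arr C"
  shows "amap F f \<in> Arr D" "Dom D (amap F f) = omap F (Dom C f)"
    "Cod D (amap F f) = omap F (Cod C f)"
  using amap_in_Hom[OF C.Arr_Hom[OF assms]] by (auto simp: D.Hom_iff)

lemma amap_Cmp' [simp]:
  assumes "f \<in> Arr C" "g \<in> Arr C" "Cod C f = Dom C g"
  shows "amap F (g \<cdot>\<^bsub>C\<^esub> f) = amap F g \<cdot>\<^bsub>D\<^esub> amap F f"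
  using amap_Cmp[of f "Dom C f" "Cod C f" g "Cod C g"] assms by (auto simp: C.Hom_iff)

declare omap_in_Obj [simp] amap_Idn [simp]

lemma isomorphic_omap:
  assumes "isomorphic C a b"
  shows "isomorphic D (omap F a) (omap F b)"
proof -
  obtain f g where fg: "f \<in> Hom C a b" "g \<in> Hom C b a" "g \<cdot>\<^bsub>C\<^esub> f = Idn C a" "f \<cdot>\<^bsub>C\<^esub> g = Idn C b"
    using assms by (auto simp: isomorphic_def)
  have "amap F g \<cdot>\<^bsub>D\<^esub> amap F f = Idn D (omap F a)" "amap F f \<cdot>\<^bsub>D\<^esub> amap F g = Idn D (omap F b)"
    using fg C.Hom_Dom_Obj amap_Cmp amap_Idn by metis+
  then show ?thesis
    unfolding isomorphic_def using fg amap_in_Hom by blast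
qed

lemma equivalenceD:
  assumes "is_equivalence C D F"
  shows "fully_faithful C D F" "ess_surj C D F"
proof -
  obtain G \<eta> \<epsilon> where G: "is_functor D C G"
    and eta: "natural_iso C C id_functor (G \<circ>\<^sub>F F) \<eta>"
    and eps: "natural_iso D D (F \<circ>\<^sub>F G) id_functor \<epsilon>"
    using assms unfolding is_equivalence_def by blast
  interpret G: is_functor D C G by fact
  have e1: "\<eta> a \<in> Hom C a (omap G (omap F a))" "is_iso C (\<eta> a)" if "a \<in> Obj C" for a
    using eta that by (auto simp: natural_iso_def id_functor_def comp_functor_def)
  have e2: "amap G (amap F f) \<cdot>\<^bsub>C\<^esub> \<eta> (Dom C f) = \<eta> (Cod C f) \<cdot>\<^bsub>C\<^esub> f" if "f \<in> Arr C" for f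
    using eta that by (auto simp: natural_iso_def id_functor_def comp_functor_def)
  have p1: "\<epsilon> a \<in> Hom D (omap F (omap G a)) a" "is_iso D (\<epsilon> a)" if "a \<in> Obj D" for a
    using eps that by (auto simp: natural_iso_def id_functor_def comp_functor_def)
  have p2: "f \<cdot>\<^bsub>D\<^esub> \<epsilon> (Dom D f) = \<epsilon> (Cod D f) \<cdot>\<^bsub>D\<^esub> amap F (amap G f)" if "f \<in> Arr D" for f
    using eps that by (auto simp: natural_iso_def id_functor_def comp_functor_def)
  show "ess_surj C D F"
    unfolding ess_surj_def
  proof
    fix d assume d: "d \<in> Obj D"
    obtain g where "g \<in> Hom D d (omap F (omap G d))" "g \<cdot>\<^bsub>D\<^esub> \<epsilon> d = Idn D (omap F (omap G d))"
      "\<epsilon> d \<cdot>\<^bsub>D\<^esub> g = Idn D d"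
      using D.iso_HomE[OF p1(2)[OF d] p1(1)[OF d]] by blast
    then show "\<exists>c\<in>Obj C. isomorphic D (omap F c) d"
      using p1(1)[OF d] G.omap_in_Obj[OF d] unfolding isomorphic_def by blast
  qed
  \<comment> \<open>Naturality turns equal images under \<open>F\<close> into equal composites with
    \<open>\<eta> b\<close>, which has a left inverse \<open>k\<close>.\<close>
  have Finj: "f = g" if f: "f \<in> Hom C a b" and g: "g \<in> Hom C a b" and eq: "amap F f = amap F g" for f g a b
  proof -
    have b: "b \<in> Obj C" using f C.Hom_Cod_Obj by blast
    obtain k where k: "k \<in> Hom C (omap G (omap F b)) b" "k \<cdot>\<^bsub>C\<^esub> \<eta> b = Idn C b"
      using C.iso_HomE[OF e1(2)[OF b] e1(1)[OF b]] by blast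
    have "\<eta> b \<cdot>\<^bsub>C\<^esub> f = \<eta> b \<cdot>\<^bsub>C\<^esub> g"
      using e2[of f] e2[of g] f g eq by (auto simp: C.Hom_iff)
    then have "(k \<cdot>\<^bsub>C\<^esub> \<eta> b) \<cdot>\<^bsub>C\<^esub> f = (k \<cdot>\<^bsub>C\<^esub> \<eta> b) \<cdot>\<^bsub>C\<^esub> g"
      using C.Cmp_assoc[OF f e1(1)[OF b] k(1)] C.Cmp_assoc[OF g e1(1)[OF b] k(1)] by simp
    then show ?thesis using k(2) f g C.Cmp_Idn_left by auto
  qed
  \<comment> \<open>The dual argument with \<open>\<epsilon>\<close> makes \<open>G\<close>
    faithful; fullness of \<open>F\<close> can then be checked after applying
    \<open>G\<close>.\<close>
  have Ginj: "f = g" if f: "f \<in> Hom D a b" and g: "g \<in> Hom D a b" and eq: "amap G f = amap G g" for f g a b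
  proof -
    have a: "a \<in> Obj D" using f D.Hom_Dom_Obj by blast
    obtain k where k: "k \<in> Hom D a (omap F (omap G a))" "\<epsilon> a \<cdot>\<^bsub>D\<^esub> k = Idn D a"
      using D.iso_HomE[OF p1(2)[OF a] p1(1)[OF a]] by blast
    have "f \<cdot>\<^bsub>D\<^esub> \<epsilon> a = g \<cdot>\<^bsub>D\<^esub> \<epsilon> a"
      using p2[of f] p2[of g] f g eq by (auto simp: D.Hom_iff)
    then have "f \<cdot>\<^bsub>D\<^esub> (\<epsilon> a \<cdot>\<^bsub>D\<^esub> k) = g \<cdot>\<^bsub>D\<^esub> (\<epsilon> a \<cdot>\<^bsub>D\<^esub> k)"
      using D.Cmp_assoc[OF k(1) p1(1)[OF a] f] D.Cmp_assoc[OF k(1) p1(1)[OF a] g] by simp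
    then show ?thesis using k(2) f g D.Cmp_Idn_right by auto
  qed
  have full: "\<exists>f \<in> Hom C a b. amap F f = g"
    if a: "a \<in> Obj C" and b: "b \<in> Obj C" and g: "g \<in> Hom D (omap F a) (omap F b)" for a b g
  proof -
    obtain k where k: "k \<in> Hom C (omap G (omap F b)) b" "\<eta> b \<cdot>\<^bsub>C\<^esub> k = Idn C (omap G (omap F b))"
      using C.iso_HomE[OF e1(2)[OF b] e1(1)[OF b]] by blast
    obtain k' where k': "k' \<in> Hom C (omap G (omap F a)) a" "\<eta> a \<cdot>\<^bsub>C\<^esub> k' = Idn C (omap G (omap F a))"
      using C.iso_HomE[OF e1(2)[OF a] e1(1)[OF a]] by blast
    have Gg: "amap G g \<in> Hom C (omap G (omap F a)) (omap G (omap F b))"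
      using g G.amap_in_Hom by blast
    \<comment> \<open>For any preimage of \<open>g\<close>, naturality of \<open>\<eta>\<close>
      forces \<open>\<eta> b \<cdot> f = amap G g \<cdot> \<eta> a\<close>; inverting
      \<open>\<eta> b\<close> leaves this one candidate.\<close>
    define f where "f = k \<cdot>\<^bsub>C\<^esub> (amap G g \<cdot>\<^bsub>C\<^esub> \<eta> a)"
    have f: "f \<in> Hom C a b" unfolding f_def using k Gg e1(1)[OF a] C.Cmp_in_Hom by blast
    have GFf: "amap G (amap F f) \<in> Hom C (omap G (omap F a)) (omap G (omap F b))"
      using f amap_in_Hom G.amap_in_Hom by blast
    have 1: "\<eta> b \<cdot>\<^bsub>C\<^esub> f = amap G g \<cdot>\<^bsub>C\<^esub> \<eta> a"
    proof -
      have h: "amap G g \<cdot>\<^bsub>C\<^esub> \<eta> a \<in> Hom C a (omap G (omap F b))"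
        using Gg e1(1)[OF a] C.Cmp_in_Hom by blast
      show ?thesis
        unfolding f_def using C.Cmp_assoc[OF h k(1) e1(1)[OF b]] k(2) C.Cmp_Idn_left[OF h] by simp
    qed
    have "amap G (amap F f) \<cdot>\<^bsub>C\<^esub> \<eta> a = amap G g \<cdot>\<^bsub>C\<^esub> \<eta> a"
      using e2[of f] f 1 by (auto simp: C.Hom_iff)
    then have "amap G (amap F f) \<cdot>\<^bsub>C\<^esub> (\<eta> a \<cdot>\<^bsub>C\<^esub> k') = amap G g \<cdot>\<^bsub>C\<^esub> (\<eta> a \<cdot>\<^bsub>C\<^esub> k')"
      using C.Cmp_assoc[OF k'(1) e1(1)[OF a] Gg] C.Cmp_assoc[OF k'(1) e1(1)[OF a] GFf] by simp
    then have "amap G (amap F f) = amap G g"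
      using k' C.Cmp_Idn_right[OF Gg] C.Cmp_Idn_right[OF GFf] by simp
    then have "amap F f = g" using Ginj g amap_in_Hom[OF f] by blast
    then show ?thesis using f by blast
  qed
  show "fully_faithful C D F"
    unfolding fully_faithful_def bij_betw_def
  proof (intro ballI conjI)
    fix a b assume ab: "a \<in> Obj C" "b \<in> Obj C"
    show "inj_on (amap F) (Hom C a b)" using Finj by (auto simp: inj_on_def)
    show "amap F ` Hom C a b = Hom D (omap F a) (omap F b)"
      using full[OF ab] amap_in_Hom by (fastforce simp: image_iff)
  qed
qed

text \<open>The inverse chooses for each \<open>d\<close> an object \<open>g d\<close> with an
  isomorphism \<open>e d\<close>, and sends \<open>h\<close> to the unique arrow lying over the
  conjugate of \<open>h\<close> by these isomorphisms. Every equation between arrows of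
  \<open>C\<close>, functor laws included, is checked after applying the faithful
  \<open>F\<close>.\<close>

lemma equivalenceI:
  assumes ff: "fully_faithful C D F" and es: "ess_surj C D F"
  shows "is_equivalence C D F"
proof -
  have "\<forall>d. \<exists>c e e'. d \<in> Obj D \<longrightarrow> c \<in> Obj C \<and> e \<in> Hom D (omap F c) d \<and> e' \<in> Hom D d (omap F c)
     \<and> e' \<cdot>\<^bsub>D\<^esub> e = Idn D (omap F c) \<and> e \<cdot>\<^bsub>D\<^esub> e' = Idn D d"
    using es unfolding ess_surj_def isomorphic_def by blast
  then obtain g e e' where g: "\<And>d. d \<in> Obj D \<Longrightarrow> g d \<in> Obj C"
    and e: "\<And>d. d \<in> Obj D \<Longrightarrow> e d \<in> Hom D (omap F (g d)) d"
    and e': "\<And>d. d \<in> Obj D \<Longrightarrow> e' d \<in> Hom D d (omap F (g d))"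
    and e'e: "\<And>d. d \<in> Obj D \<Longrightarrow> e' d \<cdot>\<^bsub>D\<^esub> e d = Idn D (omap F (g d))"
    and ee': "\<And>d. d \<in> Obj D \<Longrightarrow> e d \<cdot>\<^bsub>D\<^esub> e' d = Idn D d"
    by metis
  define lift where "lift a b h = (THE f. f \<in> Hom C a b \<and> amap F f = h)" for a b h
  have lift: "lift a b h \<in> Hom C a b \<and> amap F (lift a b h) = h"
    if prems: "a \<in> Obj C" "b \<in> Obj C" "h \<in> Hom D (omap F a) (omap F b)" for a b h
  proof -
    obtain f where f: "f \<in> Hom C a b" "amap F f = h"
      using fully_faithful_full[OF ff prems] by blast
    have "\<exists>!f. f \<in> Hom C a b \<and> amap F f = h"
      by (rule ex1I[of _ f]) (use f fully_faithful_faithful[OF ff prems(1,2)] in auto)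
    then show ?thesis unfolding lift_def by (rule theI')
  qed
  have inj: "f = f'" if "f \<in> Hom C a b" "f' \<in> Hom C a b" "amap F f = amap F f'" for a b f f'
    using fully_faithful_faithful[OF ff C.Hom_Dom_Obj[OF that(1)] C.Hom_Cod_Obj[OF that(1)] that] .
  define G where "G = \<lparr>omap = g, amap = \<lambda>h. lift (g (Dom D h)) (g (Cod D h))
     (e' (Cod D h) \<cdot>\<^bsub>D\<^esub> (h \<cdot>\<^bsub>D\<^esub> e (Dom D h)))\<rparr>"
  have Gh: "amap G h \<in> Hom C (g a) (g b)" "amap F (amap G h) = e' b \<cdot>\<^bsub>D\<^esub> (h \<cdot>\<^bsub>D\<^esub> e a)"
    if h: "h \<in> Hom D a b" for a b h
  proof -
    have a: "a \<in> Obj D" and b: "b \<in> Obj D"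
      using h D.Hom_Dom_Obj D.Hom_Cod_Obj by blast+
    have "e' b \<cdot>\<^bsub>D\<^esub> (h \<cdot>\<^bsub>D\<^esub> e a) \<in> Hom D (omap F (g a)) (omap F (g b))"
      using h e[OF a] e'[OF b] D.Cmp_in_Hom by blast
    from lift[OF g[OF a] g[OF b] this]
    show "amap G h \<in> Hom C (g a) (g b)" "amap F (amap G h) = e' b \<cdot>\<^bsub>D\<^esub> (h \<cdot>\<^bsub>D\<^esub> e a)"
      using h by (auto simp: G_def D.Hom_iff)
  qed
  have Gfun: "is_functor D C G"
  proof
    fix a assume a: "a \<in> Obj D"
    show "omap G a \<in> Obj C" using g a by (simp add: G_def)
    have "amap F (amap G (Idn D a)) = amap F (Idn C (g a))"
      using Gh(2)[OF D.Idn_in_Hom[OF a]] e[OF a] e'e[OF a] a g[OF a] by (simp add: D.Hom_iff)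
    then show "amap G (Idn D a) = Idn C (omap G a)"
      using inj[OF Gh(1)[OF D.Idn_in_Hom[OF a]] C.Idn_in_Hom[OF g[OF a]]] by (simp add: G_def)
  next
    fix f a b assume "f \<in> Hom D a b"
    then show "amap G f \<in> Hom C (omap G a) (omap G b)" using Gh(1) by (simp add: G_def)
  next
    fix f h a b c assume f: "f \<in> Hom D a b" and h: "h \<in> Hom D b c"
    have o: "a \<in> Obj D" "b \<in> Obj D" "c \<in> Obj D"
      using f h D.Hom_Dom_Obj D.Hom_Cod_Obj by blast+
    have hf: "h \<cdot>\<^bsub>D\<^esub> f \<in> Hom D a c" using f h D.Cmp_in_Hom by blast
    have "e b \<cdot>\<^bsub>D\<^esub> (e' b \<cdot>\<^bsub>D\<^esub> (f \<cdot>\<^bsub>D\<^esub> e a)) = f \<cdot>\<^bsub>D\<^esub> e a"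
      using f o e[of a] e[of b] e'[of b] by (simp add: D.Hom_iff D.Cmp_reduce[OF ee'[OF o(2)]])
    then have "amap F (amap G (h \<cdot>\<^bsub>D\<^esub> f)) = amap F (amap G h \<cdot>\<^bsub>C\<^esub> amap G f)"
      using amap_Cmp[OF Gh(1)[OF f] Gh(1)[OF h]] Gh(2)[OF f] Gh(2)[OF h] Gh(2)[OF hf] o
        f h e[of a] e'[of c] e[of b] e'[of b] by (simp add: D.Hom_iff)
    then show "amap G (h \<cdot>\<^bsub>D\<^esub> f) = amap G h \<cdot>\<^bsub>C\<^esub> amap G f"
      using inj[OF Gh(1)[OF hf] C.Cmp_in_Hom[OF Gh(1)[OF f] Gh(1)[OF h]]] by simp
  qed
  have "natural_iso D D (F \<circ>\<^sub>F G) id_functor e"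
    unfolding natural_iso_def
  proof (intro conjI ballI)
    fix a assume a: "a \<in> Obj D"
    show "e a \<in> Hom D (omap (F \<circ>\<^sub>F G) a) (omap id_functor a)"
      using e[OF a] by (simp add: comp_functor_def id_functor_def G_def)
    show "is_iso D (e a)" by (rule D.isoI[OF e[OF a] e'[OF a] e'e[OF a] ee'[OF a]])
  next
    fix f assume "f \<in> Arr D"
    then have f: "f \<in> Hom D (Dom D f) (Cod D f)" and o: "Dom D f \<in> Obj D" "Cod D f \<in> Obj D"
      by (simp_all add: D.Arr_Hom D.Dom_in_Obj D.Cod_in_Obj)
    have "e (Cod D f) \<cdot>\<^bsub>D\<^esub> (e' (Cod D f) \<cdot>\<^bsub>D\<^esub> (f \<cdot>\<^bsub>D\<^esub> e (Dom D f))) = f \<cdot>\<^bsub>D\<^esub> e (Dom D f)"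
      using f e[OF o(1)] e[OF o(2)] e'[OF o(2)] by (simp add: D.Hom_iff D.Cmp_reduce[OF ee'[OF o(2)]])
    then show "amap id_functor f \<cdot>\<^bsub>D\<^esub> e (Dom D f) = e (Cod D f) \<cdot>\<^bsub>D\<^esub> amap (F \<circ>\<^sub>F G) f"
      using Gh(2)[OF f] by (simp add: comp_functor_def id_functor_def)
  qed
  \<comment> \<open>The unit at \<open>a\<close> is the arrow over \<open>e' (omap F a)\<close>; the
    arrow over \<open>e (omap F a)\<close> is its inverse.\<close>
  moreover have "natural_iso C C id_functor (G \<circ>\<^sub>F F) (\<lambda>a. lift a (g (omap F a)) (e' (omap F a)))"
    unfolding natural_iso_def
  proof (intro conjI ballI)
    fix a assume a: "a \<in> Obj C"
    let ?a = "omap F a"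
    have o: "?a \<in> Obj D" using a by simp
    have l: "lift a (g ?a) (e' ?a) \<in> Hom C a (g ?a)" "amap F (lift a (g ?a) (e' ?a)) = e' ?a"
      using lift[OF a g[OF o] e'[OF o]] by auto
    have k: "lift (g ?a) a (e ?a) \<in> Hom C (g ?a) a" "amap F (lift (g ?a) a (e ?a)) = e ?a"
      using lift[OF g[OF o] a e[OF o]] by auto
    show "lift a (g ?a) (e' ?a) \<in> Hom C (omap id_functor a) (omap (G \<circ>\<^sub>F F) a)"
      using l by (simp add: comp_functor_def id_functor_def G_def)
    have 1: "lift (g ?a) a (e ?a) \<cdot>\<^bsub>C\<^esub> lift a (g ?a) (e' ?a) = Idn C a"
      by (rule inj[OF C.Cmp_in_Hom[OF l(1) k(1)] C.Idn_in_Hom[OF a]])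
         (simp add: amap_Cmp[OF l(1) k(1)] l k ee'[OF o] a)
    have 2: "lift a (g ?a) (e' ?a) \<cdot>\<^bsub>C\<^esub> lift (g ?a) a (e ?a) = Idn C (g ?a)"
      by (rule inj[OF C.Cmp_in_Hom[OF k(1) l(1)] C.Idn_in_Hom[OF g[OF o]]])
         (simp add: amap_Cmp[OF k(1) l(1)] l k e'e[OF o] g[OF o])
    show "is_iso C (lift a (g ?a) (e' ?a))" by (rule C.isoI[OF l(1) k(1) 1 2])
  next
    fix f assume fA: "f \<in> Arr C"
    let ?a = "Dom C f" and ?b = "Cod C f"
    have f: "f \<in> Hom C ?a ?b" and oC: "?a \<in> Obj C" "?b \<in> Obj C"
      using fA by (simp_all add: C.Arr_Hom C.Dom_in_Obj C.Cod_in_Obj)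
    have o: "omap F ?a \<in> Obj D" "omap F ?b \<in> Obj D" using oC by simp_all
    have l: "lift a (g (omap F a)) (e' (omap F a)) \<in> Hom C a (g (omap F a))"
      "amap F (lift a (g (omap F a)) (e' (omap F a))) = e' (omap F a)" if "a \<in> Obj C" for a
      using lift[OF that g e'] that by auto
    have Ff: "amap F f \<in> Hom D (omap F ?a) (omap F ?b)" using f by (rule amap_in_Hom)
    have "amap F (amap G (amap F f) \<cdot>\<^bsub>C\<^esub> lift ?a (g (omap F ?a)) (e' (omap F ?a)))
        = amap F (lift ?b (g (omap F ?b)) (e' (omap F ?b)) \<cdot>\<^bsub>C\<^esub> f)"
      unfolding amap_Cmp[OF l(1)[OF oC(1)] Gh(1)[OF Ff]] amap_Cmp[OF f l(1)[OF oC(2)]]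
        Gh(2)[OF Ff] l(2)[OF oC(1)] l(2)[OF oC(2)]
      using Ff e[OF o(1)] e'[OF o(1)] e'[OF o(2)] by (simp add: D.Hom_iff ee'[OF o(1)])
    then show "amap (G \<circ>\<^sub>F F) f \<cdot>\<^bsub>C\<^esub> lift ?a (g (omap F ?a)) (e' (omap F ?a))
        = lift ?b (g (omap F ?b)) (e' (omap F ?b)) \<cdot>\<^bsub>C\<^esub> amap id_functor f"
      using inj[OF C.Cmp_in_Hom[OF l(1)[OF oC(1)] Gh(1)[OF Ff]] C.Cmp_in_Hom[OF f l(1)[OF oC(2)]]]
      by (simp add: comp_functor_def id_functor_def)
  qed
  ultimately show ?thesis
    unfolding is_equivalence_def using Gfun is_functor_axioms by blast
qed

end

lemma is_equivalence_iff:
  "is_equivalence C D F \<longleftrightarrow> is_functor C D F \<and> fully_faithful C D F \<and> ess_surj C D F"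
  using is_functor.equivalenceD[of C D F] is_functor.equivalenceI[of C D F] is_equivalence_def[of C D F]
  by argo

lemma comp_is_functor:
  assumes "is_functor B C F" "is_functor C D G"
  shows "is_functor B D (G \<circ>\<^sub>F F)"
proof -
  interpret F: is_functor B C F by fact
  interpret G: is_functor C D G by fact
  show ?thesis
  proof
    fix f g a b c assume "f \<in> Hom B a b" "g \<in> Hom B b c"
    then show "amap (G \<circ>\<^sub>F F) (g \<cdot>\<^bsub>B\<^esub> f) = amap (G \<circ>\<^sub>F F) g \<cdot>\<^bsub>D\<^esub> amap (G \<circ>\<^sub>F F) f"
      using G.amap_Cmp[OF F.amap_in_Hom F.amap_in_Hom] by (simp add: comp_functor_def F.amap_Cmp)
  qed (auto simp: comp_functor_def F.amap_in_Hom G.amap_in_Hom)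
qed

section \<open>Coproducts and connected objects\<close>

context category
begin

lemma coproduct_Obj: "is_coproduct C I b c \<iota> \<Longrightarrow> c \<in> Obj C"
  by (simp add: is_coproduct_def)

lemma coproduct_in: "is_coproduct C I b c \<iota> \<Longrightarrow> i \<in> I \<Longrightarrow> b i \<in> Obj C"
  by (simp add: is_coproduct_def)

lemma coproduct_inj: "is_coproduct C I b c \<iota> \<Longrightarrow> i \<in> I \<Longrightarrow> \<iota> i \<in> Hom C (b i) c"
  by (simp add: is_coproduct_def)

lemma coproduct_copair:
  assumes "is_coproduct C I b c \<iota>" "x \<in> Obj C" "\<And>i. i \<in> I \<Longrightarrow> \<xi> i \<in> Hom C (b i) x"
  obtains u where "u \<in> Hom C c x" "\<And>i. i \<in> I \<Longrightarrow> u \<cdot> \<iota> i = \<xi> i"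
proof -
  have "\<exists>!u. u \<in> Hom C c x \<and> (\<forall>i\<in>I. u \<cdot> \<iota> i = \<xi> i)"
    using assms(1)[unfolded is_coproduct_def, THEN conjunct2, THEN conjunct2, rule_format,
        OF assms(2), of \<xi>] assms(3) by blast
  then show ?thesis using that by blast
qed

lemma coproduct_ext:
  assumes co: "is_coproduct C I b c \<iota>" and u: "u \<in> Hom C c x" and v: "v \<in> Hom C c x"
    and eq: "\<And>i. i \<in> I \<Longrightarrow> u \<cdot> \<iota> i = v \<cdot> \<iota> i"
  shows "u = v"
proof -
  have x: "x \<in> Obj C" using u Hom_Cod_Obj by blast
  have "v \<cdot> \<iota> i \<in> Hom C (b i) x" if "i \<in> I" for i
    using coproduct_inj[OF co that] v Cmp_in_Hom by blast
  then have "\<exists>!u. u \<in> Hom C c x \<and> (\<forall>i\<in>I. u \<cdot> \<iota> i = v \<cdot> \<iota> i)"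
    using co[unfolded is_coproduct_def, THEN conjunct2, THEN conjunct2, rule_format,
        OF x, of "\<lambda>i. v \<cdot> \<iota> i"] by simp
  then show ?thesis using u v eq by blast
qed

lemma coproductI:
  assumes "c \<in> Obj C" "\<And>i. i \<in> I \<Longrightarrow> \<iota> i \<in> Hom C (b i) c"
    and "\<And>x \<xi>. x \<in> Obj C \<Longrightarrow> (\<And>i. i \<in> I \<Longrightarrow> \<xi> i \<in> Hom C (b i) x)
       \<Longrightarrow> \<exists>u \<in> Hom C c x. \<forall>i\<in>I. u \<cdot> \<iota> i = \<xi> i"
    and "\<And>x u v. u \<in> Hom C c x \<Longrightarrow> v \<in> Hom C c x \<Longrightarrow> (\<And>i. i \<in> I \<Longrightarrow> u \<cdot> \<iota> i = v \<cdot> \<iota> i)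
       \<Longrightarrow> u = v"
  shows "is_coproduct C I b c \<iota>"
  unfolding is_coproduct_def
proof (intro conjI ballI allI impI)
  fix i assume "i \<in> I"
  then show "b i \<in> Obj C" "\<iota> i \<in> Hom C (b i) c"
    using assms(2) Hom_Dom_Obj by blast+
next
  fix x \<xi> assume "x \<in> Obj C" and xi: "\<forall>i\<in>I. \<xi> i \<in> Hom C (b i) x"
  with assms(3) obtain u where u: "u \<in> Hom C c x" "\<forall>i\<in>I. u \<cdot> \<iota> i = \<xi> i"
    by blast
  show "\<exists>!u. u \<in> Hom C c x \<and> (\<forall>i\<in>I. u \<cdot> \<iota> i = \<xi> i)"
  proof (rule ex1I[of _ u])
    fix v assume "v \<in> Hom C c x \<and> (\<forall>i\<in>I. v \<cdot> \<iota> i = \<xi> i)"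
    with u show "v = u" by (intro assms(4)[of v x u]) auto
  qed (use u in blast)
qed (rule assms(1))

lemma coproduct_cong:
  assumes "is_coproduct C I b c \<iota>" "\<And>i. i \<in> I \<Longrightarrow> b i = b' i" "\<And>i. i \<in> I \<Longrightarrow> \<iota> i = \<iota>' i"
  shows "is_coproduct C I b' c \<iota>'"
  using assms unfolding is_coproduct_def by simp

lemma coproduct_iso:
  assumes co: "is_coproduct C I b c \<iota>" and w: "w \<in> Hom C c c'" and w': "w' \<in> Hom C c' c"
    and w'w: "w' \<cdot> w = Idn C c" and ww': "w \<cdot> w' = Idn C c'"
  shows "is_coproduct C I b c' (\<lambda>i. w \<cdot> \<iota> i)"
proof (rule coproductI)
  show "c' \<in> Obj C" using w Hom_Cod_Obj by blast
  show "w \<cdot> \<iota> i \<in> Hom C (b i) c'" if "i \<in> I" for i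
    using coproduct_inj[OF co that] w Cmp_in_Hom by blast
next
  fix x \<xi> assume "x \<in> Obj C" and "\<And>i. i \<in> I \<Longrightarrow> \<xi> i \<in> Hom C (b i) x"
  then obtain u where u: "u \<in> Hom C c x" "\<And>i. i \<in> I \<Longrightarrow> u \<cdot> \<iota> i = \<xi> i"
    using coproduct_copair[OF co] by blast
  have "(u \<cdot> w') \<cdot> (w \<cdot> \<iota> i) = \<xi> i" if "i \<in> I" for i
  proof -
    have "w' \<cdot> (w \<cdot> \<iota> i) = \<iota> i"
      using w w' coproduct_inj[OF co that] by (simp add: Hom_iff Cmp_reduce[OF w'w])
    then show ?thesis
      using u that w w' coproduct_inj[OF co that] by (simp add: Hom_iff)
  qed
  then show "\<exists>u \<in> Hom C c' x. \<forall>i\<in>I. u \<cdot> (w \<cdot> \<iota> i) = \<xi> i"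
    using Cmp_in_Hom[OF w' u(1)] by blast
next
  fix x u v assume u: "u \<in> Hom C c' x" and v: "v \<in> Hom C c' x"
    and eq: "\<And>i. i \<in> I \<Longrightarrow> u \<cdot> (w \<cdot> \<iota> i) = v \<cdot> (w \<cdot> \<iota> i)"
  have "u \<cdot> w = v \<cdot> w"
  proof (rule coproduct_ext[OF co Cmp_in_Hom[OF w u] Cmp_in_Hom[OF w v]])
    fix i assume "i \<in> I"
    then show "(u \<cdot> w) \<cdot> \<iota> i = (v \<cdot> w) \<cdot> \<iota> i"
      using Cmp_assoc[OF coproduct_inj[OF co] w u] Cmp_assoc[OF coproduct_inj[OF co] w v] eq
      by simp
  qed
  then have "u \<cdot> (w \<cdot> w') = v \<cdot> (w \<cdot> w')"
    using Cmp_assoc[OF w' w u] Cmp_assoc[OF w' w v] by simp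
  then show "u = v" using ww' Cmp_Idn_right[OF u] Cmp_Idn_right[OF v] by simp
qed

lemma coproduct_unique:
  assumes c: "is_coproduct C I b c \<iota>" and c': "is_coproduct C I b c' \<iota>'"
  obtains w w' where "w \<in> Hom C c c'" "w' \<in> Hom C c' c" "w' \<cdot> w = Idn C c" "w \<cdot> w' = Idn C c'"
    "\<And>i. i \<in> I \<Longrightarrow> w \<cdot> \<iota> i = \<iota>' i"
proof -
  obtain w where w: "w \<in> Hom C c c'" "\<And>i. i \<in> I \<Longrightarrow> w \<cdot> \<iota> i = \<iota>' i"
    using coproduct_copair[OF c coproduct_Obj[OF c'] coproduct_inj[OF c']] by blast
  obtain w' where w': "w' \<in> Hom C c' c" "\<And>i. i \<in> I \<Longrightarrow> w' \<cdot> \<iota>' i = \<iota> i"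
    using coproduct_copair[OF c' coproduct_Obj[OF c] coproduct_inj[OF c]] by blast
  have "w' \<cdot> w = Idn C c"
  proof (rule coproduct_ext[OF c Cmp_in_Hom[OF w(1) w'(1)] Idn_in_Hom[OF coproduct_Obj[OF c]]])
    fix i assume "i \<in> I"
    then show "(w' \<cdot> w) \<cdot> \<iota> i = Idn C c \<cdot> \<iota> i"
      using Cmp_assoc[OF coproduct_inj[OF c] w(1) w'(1)] w(2) w'(2)
        Cmp_Idn_left[OF coproduct_inj[OF c]] by simp
  qed
  moreover have "w \<cdot> w' = Idn C c'"
  proof (rule coproduct_ext[OF c' Cmp_in_Hom[OF w'(1) w(1)] Idn_in_Hom[OF coproduct_Obj[OF c']]])
    fix i assume "i \<in> I"
    then show "(w \<cdot> w') \<cdot> \<iota>' i = Idn C c' \<cdot> \<iota>' i"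
      using Cmp_assoc[OF coproduct_inj[OF c'] w'(1) w(1)] w(2) w'(2)
        Cmp_Idn_left[OF coproduct_inj[OF c']] by simp
  qed
  ultimately show ?thesis using that w w' by blast
qed

lemma coproduct_iso_components:
  assumes co: "is_coproduct C I b c \<iota>"
    and v: "\<And>i. i \<in> I \<Longrightarrow> v i \<in> Hom C (b' i) (b i)" and v': "\<And>i. i \<in> I \<Longrightarrow> v' i \<in> Hom C (b i) (b' i)"
    and v'v: "\<And>i. i \<in> I \<Longrightarrow> v' i \<cdot> v i = Idn C (b' i)"
    and vv': "\<And>i. i \<in> I \<Longrightarrow> v i \<cdot> v' i = Idn C (b i)"
  shows "is_coproduct C I b' c (\<lambda>i. \<iota> i \<cdot> v i)"
proof (rule coproductI)
  show "c \<in> Obj C" by (rule coproduct_Obj[OF co])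
  show "\<iota> i \<cdot> v i \<in> Hom C (b' i) c" if "i \<in> I" for i
    using coproduct_inj[OF co that] v[OF that] Cmp_in_Hom by blast
next
  fix x \<xi> assume x: "x \<in> Obj C" and xi: "\<And>i. i \<in> I \<Longrightarrow> \<xi> i \<in> Hom C (b' i) x"
  have "\<xi> i \<cdot> v' i \<in> Hom C (b i) x" if "i \<in> I" for i
    using Cmp_in_Hom[OF v'[OF that] xi[OF that]] .
  then obtain u where u: "u \<in> Hom C c x" "\<And>i. i \<in> I \<Longrightarrow> u \<cdot> \<iota> i = \<xi> i \<cdot> v' i"
    using coproduct_copair[OF co x, of "\<lambda>i. \<xi> i \<cdot> v' i"] by blast
  have "u \<cdot> (\<iota> i \<cdot> v i) = \<xi> i" if "i \<in> I" for i
    using Cmp_assoc[OF v[OF that] coproduct_inj[OF co that] u(1)] u(2)[OF that]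
      Cmp_assoc[OF v[OF that] v'[OF that] xi[OF that]] v'v[OF that] Cmp_Idn_right[OF xi[OF that]]
    by simp
  then show "\<exists>u \<in> Hom C c x. \<forall>i\<in>I. u \<cdot> (\<iota> i \<cdot> v i) = \<xi> i"
    using u(1) by blast
next
  fix x u w assume u: "u \<in> Hom C c x" and w: "w \<in> Hom C c x"
    and eq: "\<And>i. i \<in> I \<Longrightarrow> u \<cdot> (\<iota> i \<cdot> v i) = w \<cdot> (\<iota> i \<cdot> v i)"
  show "u = w"
  proof (rule coproduct_ext[OF co u w])
    fix i assume i: "i \<in> I"
    have "z \<cdot> \<iota> i = (z \<cdot> (\<iota> i \<cdot> v i)) \<cdot> v' i" if "z \<in> Hom C c x" for z
      using that v[OF i] v'[OF i] coproduct_inj[OF co i] vv'[OF i] by (simp add: Hom_iff)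
    then show "u \<cdot> \<iota> i = w \<cdot> \<iota> i" using u w eq[OF i] by simp
  qed
qed

text \<open>Associativity of coproducts: \<open>q\<close> cuts \<open>K\<close> into fibres, and a
  cocone on the fibre coproducts carries the same information as one on all the \<open>b k\<close>.
  It serves to collect the connected pieces of an algebra by equivalence class.\<close>

lemma coproduct_regroup:
  assumes co: "is_coproduct C K b c e"
    and z: "\<And>l. l \<in> q ` K \<Longrightarrow> is_coproduct C {k \<in> K. q k = l} b (z l) (d l)"
    and m: "\<And>l. l \<in> q ` K \<Longrightarrow> m l \<in> Hom C (z l) c"
    and md: "\<And>k. k \<in> K \<Longrightarrow> m (q k) \<cdot> d (q k) k = e k"
  shows "is_coproduct C (q ` K) z c m"
proof (rule coproductI)
  show "c \<in> Obj C" by (rule coproduct_Obj[OF co])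
  show "m l \<in> Hom C (z l) c" if "l \<in> q ` K" for l by (rule m[OF that])
next
  have d: "d (q k) k \<in> Hom C (b k) (z (q k))" if "k \<in> K" for k
    using coproduct_inj[OF z, of "q k" k] that by simp
  {
    fix x \<xi> assume x: "x \<in> Obj C" and xi: "\<And>l. l \<in> q ` K \<Longrightarrow> \<xi> l \<in> Hom C (z l) x"
    have "\<xi> (q k) \<cdot> d (q k) k \<in> Hom C (b k) x" if "k \<in> K" for k
      using xi d[OF that] that Cmp_in_Hom by blast
    then obtain u where u: "u \<in> Hom C c x" "\<And>k. k \<in> K \<Longrightarrow> u \<cdot> e k = \<xi> (q k) \<cdot> d (q k) k"
      using coproduct_copair[OF co x, of "\<lambda>k. \<xi> (q k) \<cdot> d (q k) k"] by blast
    have "u \<cdot> m l = \<xi> l" if l: "l \<in> q ` K" for l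
    proof (rule coproduct_ext[OF z[OF l] Cmp_in_Hom[OF m[OF l] u(1)] xi[OF l]])
      fix k assume "k \<in> {k \<in> K. q k = l}"
      then show "(u \<cdot> m l) \<cdot> d l k = \<xi> l \<cdot> d l k"
        using Cmp_assoc[OF d m u(1), of k] md[of k] u(2)[of k] l by auto
    qed
    then show "\<exists>u \<in> Hom C c x. \<forall>l\<in>q ` K. u \<cdot> m l = \<xi> l" using u(1) by blast
  }
  fix x u v assume u: "u \<in> Hom C c x" and v: "v \<in> Hom C c x"
    and eq: "\<And>l. l \<in> q ` K \<Longrightarrow> u \<cdot> m l = v \<cdot> m l"
  show "u = v"
  proof (rule coproduct_ext[OF co u v])
    fix k assume k: "k \<in> K"
    then have qk: "q k \<in> q ` K" by blast
    show "u \<cdot> e k = v \<cdot> e k"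
      using Cmp_assoc[OF d[OF k] m[OF qk] u] Cmp_assoc[OF d[OF k] m[OF qk] v] md[OF k] eq[OF qk]
      by simp
  qed
qed

section \<open>Connected objects and factorisation through summands\<close>

lemma connected_Obj: "connected_object U C a \<Longrightarrow> a \<in> Obj C"
  by (simp add: connected_object_def)

lemma connected_factor:
  assumes "connected_object U C a" "I \<in> U" "is_coproduct C I b c \<iota>" "f \<in> Hom C a c"
  obtains i g where "i \<in> I" "g \<in> Hom C a (b i)" "f = \<iota> i \<cdot> g"
proof -
  have "bij_betw (\<lambda>(i, g). \<iota> i \<cdot> g) (SIGMA i:I. Hom C a (b i)) (Hom C a c)"
    using assms by (simp add: connected_object_def)
  then have "f \<in> (\<lambda>(i, g). \<iota> i \<cdot> g) ` (SIGMA i:I. Hom C a (b i))"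
    using assms(4) by (simp add: bij_betw_def)
  then show ?thesis using that by auto
qed

lemma connected_factor_unique:
  assumes "connected_object U C a" "I \<in> U" "is_coproduct C I b c \<iota>"
    and "i \<in> I" "j \<in> I" "g \<in> Hom C a (b i)" "h \<in> Hom C a (b j)" "\<iota> i \<cdot> g = \<iota> j \<cdot> h"
  shows "i = j" "g = h"
proof -
  have "inj_on (\<lambda>(i, g). \<iota> i \<cdot> g) (SIGMA i:I. Hom C a (b i))"
    using assms by (simp add: connected_object_def bij_betw_def)
  from inj_onD[OF this, of "(i, g)" "(j, h)"] assms(4-8)
  show "i = j" "g = h" by auto
qed

lemma bij_coproductI:
  assumes "\<And>i. i \<in> I \<Longrightarrow> \<iota> i \<in> Hom C (b i) c"
    and "\<And>f. f \<in> Hom C a c \<Longrightarrow> \<exists>i\<in>I. \<exists>g \<in> Hom C a (b i). f = \<iota> i \<cdot> g"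
    and "\<And>i j g h. \<lbrakk>i \<in> I; j \<in> I; g \<in> Hom C a (b i); h \<in> Hom C a (b j); \<iota> i \<cdot> g = \<iota> j \<cdot> h\<rbrakk>
           \<Longrightarrow> i = j \<and> g = h"
  shows "bij_betw (\<lambda>(i, g). \<iota> i \<cdot> g) (SIGMA i:I. Hom C a (b i)) (Hom C a c)"
  unfolding bij_betw_def
proof
  show "inj_on (\<lambda>(i, g). \<iota> i \<cdot> g) (SIGMA i:I. Hom C a (b i))"
    using assms(3) by (intro inj_onI) auto
  show "(\<lambda>(i, g). \<iota> i \<cdot> g) ` (SIGMA i:I. Hom C a (b i)) = Hom C a c"
  proof (intro equalityI subsetI)
    fix f assume "f \<in> Hom C a c"
    then obtain i g where "i \<in> I" "g \<in> Hom C a (b i)" "f = \<iota> i \<cdot> g" using assms(2) by blast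
    then show "f \<in> (\<lambda>(i, g). \<iota> i \<cdot> g) ` (SIGMA i:I. Hom C a (b i))"
      by (intro image_eqI[of _ _ "(i, g)"]) auto
  qed (use assms(1) Cmp_in_Hom in auto)
qed

lemma connectedI:
  assumes "a \<in> Obj C"
    and "\<And>I b c \<iota> f. \<lbrakk>I \<in> U; is_coproduct C I b c \<iota>; f \<in> Hom C a c\<rbrakk>
           \<Longrightarrow> \<exists>i\<in>I. \<exists>g \<in> Hom C a (b i). f = \<iota> i \<cdot> g"
    and "\<And>I b c \<iota> i j g h. \<lbrakk>I \<in> U; is_coproduct C I b c \<iota>; i \<in> I; j \<in> I; g \<in> Hom C a (b i);
           h \<in> Hom C a (b j); \<iota> i \<cdot> g = \<iota> j \<cdot> h\<rbrakk> \<Longrightarrow> i = j \<and> g = h"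
  shows "connected_object U C a"
  unfolding connected_object_def
proof (intro conjI ballI allI impI)
  fix I b c \<iota> assume I: "I \<in> U" and co: "is_coproduct C I b c \<iota>"
  show "bij_betw (\<lambda>(i, g). \<iota> i \<cdot> g) (SIGMA i:I. Hom C a (b i)) (Hom C a c)"
    by (rule bij_coproductI[OF coproduct_inj[OF co] assms(2)[OF I co] assms(3)[OF I co]])
qed (rule assms(1))

text \<open>Precomposing with \<open>v\<close> turns a map out of \<open>a'\<close> into one out of
  \<open>a\<close>, where the factorisation is known; precomposing with \<open>w\<close> brings the
  factor back.\<close>

lemma connected_isomorphic:
  fixes U :: "'i set set"
  assumes a: "connected_object U C a" and "isomorphic C a a'"
  shows "connected_object U C a'"
proof -
  obtain v w where v: "v \<in> Hom C a a'" and w: "w \<in> Hom C a' a"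
    and vw: "v \<cdot> w = Idn C a'"
    using assms(2) by (auto simp: isomorphic_def)
  show ?thesis
  proof (rule connectedI)
    show "a' \<in> Obj C" using v Hom_Cod_Obj by blast
    fix I :: "'i set" and b c \<iota> assume I: "I \<in> U" and co: "is_coproduct C I b c \<iota>"
    {
      fix f assume f: "f \<in> Hom C a' c"
      obtain i g where i: "i \<in> I" and g: "g \<in> Hom C a (b i)" and eq: "f \<cdot> v = \<iota> i \<cdot> g"
        using connected_factor[OF a I co Cmp_in_Hom[OF v f]] by blast
      have "f = (f \<cdot> v) \<cdot> w" using f v w vw by (simp add: Hom_iff)
      also have "\<dots> = \<iota> i \<cdot> (g \<cdot> w)"
        unfolding eq using Cmp_assoc[OF w g coproduct_inj[OF co i]] by simp
      finally show "\<exists>i\<in>I. \<exists>g \<in> Hom C a' (b i). f = \<iota> i \<cdot> g"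
        using i Cmp_in_Hom[OF w g] by blast
    }
    fix i j g h assume i: "i \<in> I" and j: "j \<in> I" and g: "g \<in> Hom C a' (b i)"
      and h: "h \<in> Hom C a' (b j)" and eq: "\<iota> i \<cdot> g = \<iota> j \<cdot> h"
    have "\<iota> i \<cdot> (g \<cdot> v) = \<iota> j \<cdot> (h \<cdot> v)"
      using Cmp_assoc[OF v g coproduct_inj[OF co i]] Cmp_assoc[OF v h coproduct_inj[OF co j]] eq
      by simp
    then have "i = j" "g \<cdot> v = h \<cdot> v"
      using connected_factor_unique[OF a I co i j Cmp_in_Hom[OF v g] Cmp_in_Hom[OF v h]] by blast+
    moreover have "(g \<cdot> v) \<cdot> w = g" "(h \<cdot> v) \<cdot> w = h"
      using g h v w vw by (simp_all add: Hom_iff)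
    ultimately show "i = j \<and> g = h" by metis
  qed
qed

end

text \<open>Categories of the form \<open>Fam(W)\<close>, described intrinsically.\<close>

locale familial = universe U + category C
  for U :: "'i set set" and C :: "('o, 'a) cat" (structure) +
  assumes coproducts_exist:
      "I \<in> U \<Longrightarrow> (\<And>i. i \<in> I \<Longrightarrow> b i \<in> Obj C) \<Longrightarrow> \<exists>c \<iota>. is_coproduct C I b c \<iota>"
    and connected_decomposition:
      "c \<in> Obj C \<Longrightarrow> \<exists>I \<in> U. \<exists>b \<iota>. is_coproduct C I b c \<iota> \<and> (\<forall>i\<in>I. connected_object U C (b i))"
begin

text \<open>The injections of a decomposition of \<open>c\<close> are jointly epic and have
  connected domains, so connected objects are generators.\<close>

lemma separation:
  assumes f: "f \<in> Hom C c d" and g: "g \<in> Hom C c d"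
    and eq: "\<And>a x. connected_object U C a \<Longrightarrow> x \<in> Hom C a c \<Longrightarrow> f \<cdot> x = g \<cdot> x"
  shows "f = g"
proof -
  obtain I b \<iota> where "I \<in> U" and co: "is_coproduct C I b c \<iota>"
    and "\<And>i. i \<in> I \<Longrightarrow> connected_object U C (b i)"
    using connected_decomposition[OF Hom_Dom_Obj[OF f]] by blast
  then show ?thesis using coproduct_inj[OF co] by (intro coproduct_ext[OF co f g] eq) auto
qed

text \<open>On a connected test object, cancelling \<open>\<iota> i\<close> is the uniqueness of
  factorisations through a coproduct. Connected objects separate maps, so the injection is
  monic.\<close>

lemma injection_mono:
  assumes I: "I \<in> U" and co: "is_coproduct C I b c \<iota>" and i: "i \<in> I"
    and f: "f \<in> Hom C x (b i)" and g: "g \<in> Hom C x (b i)" and eq: "\<iota> i \<cdot> f = \<iota> i \<cdot> g"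
  shows "f = g"
proof (rule separation[OF f g])
  fix a y assume a: "connected_object U C a" and y: "y \<in> Hom C a x"
  have "\<iota> i \<cdot> (f \<cdot> y) = \<iota> i \<cdot> (g \<cdot> y)"
    using Cmp_assoc[OF y f coproduct_inj[OF co i]] Cmp_assoc[OF y g coproduct_inj[OF co i]] eq
    by simp
  then show "f \<cdot> y = g \<cdot> y"
    by (rule connected_factor_unique(2)[OF a I co i i Cmp_in_Hom[OF y f] Cmp_in_Hom[OF y g]])
qed

text \<open>A converse to the defining property of connected objects. Cutting \<open>c\<close> into
  connected pieces places each piece inside one \<open>b i\<close>, so a map out of \<open>c\<close>
  can be prescribed piece by piece. The criterion replaces the explicit construction of copairings,
  notably for pullbacks.\<close>

lemma coproduct_criterion:
  assumes c: "c \<in> Obj C" and inj: "\<And>i. i \<in> I \<Longrightarrow> \<iota> i \<in> Hom C (b i) c"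
    and fac: "\<And>a f. connected_object U C a \<Longrightarrow> f \<in> Hom C a c
       \<Longrightarrow> \<exists>i\<in>I. \<exists>g \<in> Hom C a (b i). f = \<iota> i \<cdot> g"
    and uni: "\<And>a i j g h. \<lbrakk>connected_object U C a; i \<in> I; j \<in> I; g \<in> Hom C a (b i);
       h \<in> Hom C a (b j); \<iota> i \<cdot> g = \<iota> j \<cdot> h\<rbrakk> \<Longrightarrow> i = j \<and> g = h"
  shows "is_coproduct C I b c \<iota>"
proof -
  obtain L g e where L: "L \<in> U" and co: "is_coproduct C L g c e"
    and conn: "\<And>l. l \<in> L \<Longrightarrow> connected_object U C (g l)"
    using connected_decomposition[OF c] by blast
  \<comment> \<open>\<open>p l\<close> is the summand that contains the connected piece
    \<open>l\<close>, and \<open>s l\<close> is the inclusion of the piece into it.\<close>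
  have "\<forall>l. \<exists>i s. l \<in> L \<longrightarrow> i \<in> I \<and> s \<in> Hom C (g l) (b i) \<and> e l = \<iota> i \<cdot> s"
    using fac[OF conn coproduct_inj[OF co]] by blast
  then obtain p s where p: "\<And>l. l \<in> L \<Longrightarrow> p l \<in> I" and s: "\<And>l. l \<in> L \<Longrightarrow> s l \<in> Hom C (g l) (b (p l))"
    and e: "\<And>l. l \<in> L \<Longrightarrow> e l = \<iota> (p l) \<cdot> s l"
    by metis
  show ?thesis
  proof (rule coproductI[OF c inj])
    fix x \<xi> assume x: "x \<in> Obj C" and xi: "\<And>i. i \<in> I \<Longrightarrow> \<xi> i \<in> Hom C (b i) x"
    have "\<xi> (p l) \<cdot> s l \<in> Hom C (g l) x" if "l \<in> L" for l
      using Cmp_in_Hom[OF s[OF that] xi[OF p[OF that]]] .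
    then obtain u where u: "u \<in> Hom C c x" and ue: "\<And>l. l \<in> L \<Longrightarrow> u \<cdot> e l = \<xi> (p l) \<cdot> s l"
      using coproduct_copair[OF co x, of "\<lambda>l. \<xi> (p l) \<cdot> s l"] by blast
    \<comment> \<open>By construction \<open>u\<close> is known only on the pieces. A connected test
      map \<open>y\<close> into \<open>b i\<close>, followed by \<open>\<iota> i\<close>, runs
      through some piece \<open>l\<close>; uniqueness of factorisation then gives
      \<open>p l = i\<close> and \<open>s l \<cdot> t = y\<close>, which reduces the claim to that
      piece.\<close>
    have "u \<cdot> \<iota> i = \<xi> i" if i: "i \<in> I" for i
    proof (rule separation[OF Cmp_in_Hom[OF inj[OF i] u] xi[OF i]])
      fix a y assume a: "connected_object U C a" and y: "y \<in> Hom C a (b i)"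
      obtain l t where l: "l \<in> L" and t: "t \<in> Hom C a (g l)" and eq: "\<iota> i \<cdot> y = e l \<cdot> t"
        using connected_factor[OF a L co Cmp_in_Hom[OF y inj[OF i]]] by blast
      have "e l \<cdot> t = \<iota> (p l) \<cdot> (s l \<cdot> t)"
        using Cmp_assoc[OF t s[OF l] inj[OF p[OF l]]] e[OF l] by simp
      then have pl: "p l = i" "s l \<cdot> t = y"
        using uni[OF a p[OF l] i Cmp_in_Hom[OF t s[OF l]] y] eq by simp_all
      have "(u \<cdot> \<iota> i) \<cdot> y = u \<cdot> (e l \<cdot> t)"
        using Cmp_assoc[OF y inj[OF i] u] eq by simp
      also have "\<dots> = \<xi> (p l) \<cdot> (s l \<cdot> t)"
        using Cmp_assoc[OF t coproduct_inj[OF co l] u] ue[OF l] Cmp_assoc[OF t s[OF l] xi[OF p[OF l]]]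
        by simp
      finally show "(u \<cdot> \<iota> i) \<cdot> y = \<xi> i \<cdot> y" using pl by simp
    qed
    then show "\<exists>u \<in> Hom C c x. \<forall>i\<in>I. u \<cdot> \<iota> i = \<xi> i" using u by blast
  next
    fix x u v assume u: "u \<in> Hom C c x" and v: "v \<in> Hom C c x"
      and eq: "\<And>i. i \<in> I \<Longrightarrow> u \<cdot> \<iota> i = v \<cdot> \<iota> i"
    show "u = v"
    proof (rule coproduct_ext[OF co u v])
      fix l assume l: "l \<in> L"
      show "u \<cdot> e l = v \<cdot> e l"
        using Cmp_assoc[OF s[OF l] inj[OF p[OF l]] u] Cmp_assoc[OF s[OF l] inj[OF p[OF l]] v]
          e[OF l] eq[OF p[OF l]] by simp
    qed
  qed
qed

end

definition preserves_coproducts ::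
  "'i set set \<Rightarrow> ('o, 'a) cat \<Rightarrow> ('p, 'b) cat \<Rightarrow> ('o, 'a, 'p, 'b) fctr \<Rightarrow> bool" where
  "preserves_coproducts U C D F \<longleftrightarrow> (\<forall>I \<in> U. \<forall>b c \<iota>. is_coproduct C I b c \<iota> \<longrightarrow>
     is_coproduct D I (\<lambda>i. omap F (b i)) (omap F c) (\<lambda>i. amap F (\<iota> i)))"

lemma preserves_coproductsD:
  assumes "preserves_coproducts U C D F" "I \<in> U" "is_coproduct C I b c \<iota>"
  shows "is_coproduct D I (\<lambda>i. omap F (b i)) (omap F c) (\<lambda>i. amap F (\<iota> i))"
  using assms unfolding preserves_coproducts_def by blast

lemma preserves_coproducts_comp:
  fixes U :: "'i set set"
  assumes "preserves_coproducts U B C F" "preserves_coproducts U C D G"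
  shows "preserves_coproducts U B D (G \<circ>\<^sub>F F)"
  unfolding preserves_coproducts_def
proof (intro ballI allI impI)
  fix I :: "'i set" and b c \<iota> assume I: "I \<in> U" and co: "is_coproduct B I b c \<iota>"
  show "is_coproduct D I (\<lambda>i. omap (G \<circ>\<^sub>F F) (b i)) (omap (G \<circ>\<^sub>F F) c) (\<lambda>i. amap (G \<circ>\<^sub>F F) (\<iota> i))"
    using preserves_coproductsD[OF assms(2) I preserves_coproductsD[OF assms(1) I co]]
    by (simp add: comp_functor_def)
qed

section \<open>Coproducts of structured objects\<close>

locale structured_objects = category C
  for C :: "('o, 'a) cat" (structure) +
  fixes S :: "'s set" and u :: "'s \<Rightarrow> 'o" and R :: "'s \<Rightarrow> 'a \<Rightarrow> 's \<Rightarrow> bool"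
  assumes u_in: "x \<in> S \<Longrightarrow> u x \<in> Obj C"
    and R_Idn: "x \<in> S \<Longrightarrow> R x (Idn C (u x)) x"
    and R_Cmp: "\<lbrakk>x \<in> S; y \<in> S; z \<in> S; h \<in> Hom C (u x) (u y); k \<in> Hom C (u y) (u z); R x h y; R y k z\<rbrakk>
      \<Longrightarrow> R x (k \<cdot> h) z"
begin

abbreviation Q :: "('s, 's \<times> 'a \<times> 's) cat" where
  "Q \<equiv> structured C S u R"

lemma Obj_Q: "Obj Q = S"
  by (simp add: structured_def)

lemma Hom_Q_iff:
  "t \<in> Hom Q x y \<longleftrightarrow> (\<exists>h. t = (x, h, y) \<and> x \<in> S \<and> y \<in> S \<and> h \<in> Hom C (u x) (u y) \<and> R x h y)"
  by (cases t) (auto simp: Hom_def structured_def)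

lemma Cmp_Q: "(y', k, z) \<cdot>\<^bsub>Q\<^esub> (x, h, y) = (x, k \<cdot> h, z)"
  by (simp add: structured_def)

lemma Idn_Q: "Idn Q x = (x, Idn C (u x), x)"
  by (simp add: structured_def)

lemma category_Q: "category Q"
proof
  fix f assume "f \<in> Arr Q"
  then show "Dom Q f \<in> Obj Q" "Cod Q f \<in> Obj Q" by (auto simp: structured_def)
next
  fix a assume "a \<in> Obj Q"
  then show "Idn Q a \<in> Hom Q a a"
    using Idn_in_Hom[OF u_in] R_Idn by (simp add: Hom_Q_iff Obj_Q Idn_Q)
next
  fix f a b g c assume "f \<in> Hom Q a b" "g \<in> Hom Q b c"
  then show "g \<cdot>\<^bsub>Q\<^esub> f \<in> Hom Q a c"
    using Cmp_in_Hom R_Cmp unfolding Hom_Q_iff by (auto simp: Cmp_Q)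
next
  fix f a b assume "f \<in> Hom Q a b"
  then show "Idn Q b \<cdot>\<^bsub>Q\<^esub> f = f" "f \<cdot>\<^bsub>Q\<^esub> Idn Q a = f"
    using Cmp_Idn_left Cmp_Idn_right unfolding Hom_Q_iff by (auto simp: Cmp_Q Idn_Q)
next
  fix f a b g c h d assume "f \<in> Hom Q a b" "g \<in> Hom Q b c" "h \<in> Hom Q c d"
  then show "h \<cdot>\<^bsub>Q\<^esub> (g \<cdot>\<^bsub>Q\<^esub> f) = (h \<cdot>\<^bsub>Q\<^esub> g) \<cdot>\<^bsub>Q\<^esub> f"
    using Cmp_assoc unfolding Hom_Q_iff by (auto simp: Cmp_Q)
qed

text \<open>The premise \<open>refl\<close> says that a map out of \<open>c\<close> respects the
  structure once its restrictions to the summands do. In slices it holds because injections are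
  jointly epic, for algebras because the monad preserves the coproduct.\<close>

lemma structured_coproductI:
  assumes c: "c \<in> S" and i: "\<And>i. i \<in> I \<Longrightarrow> \<iota> i \<in> Hom Q (b i) c"
    and co: "is_coproduct C I (\<lambda>i. u (b i)) (u c) (\<lambda>i. fst (snd (\<iota> i)))"
    and refl: "\<And>y h. \<lbrakk>y \<in> S; h \<in> Hom C (u c) (u y); \<And>i. i \<in> I \<Longrightarrow> R (b i) (h \<cdot> fst (snd (\<iota> i))) y\<rbrakk>
        \<Longrightarrow> R c h y"
  shows "is_coproduct Q I b c \<iota>"
proof (rule category.coproductI[OF category_Q])
  show "c \<in> Obj Q" using c by (simp add: Obj_Q)
  show "\<iota> i \<in> Hom Q (b i) c" if "i \<in> I" for i using i[OF that] .
next
  have ij: "\<iota> j = (b j, fst (snd (\<iota> j)), c)" if "j \<in> I" for j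
    using i[OF that] by (auto simp: Hom_Q_iff)
  {
    fix y \<xi> assume y: "y \<in> Obj Q" and xi: "\<And>i. i \<in> I \<Longrightarrow> \<xi> i \<in> Hom Q (b i) y"
    have xij: "\<xi> j = (b j, fst (snd (\<xi> j)), y)" "R (b j) (fst (snd (\<xi> j))) y"
      "fst (snd (\<xi> j)) \<in> Hom C (u (b j)) (u y)" if "j \<in> I" for j
      using xi[OF that] by (auto simp: Hom_Q_iff)
    have y': "y \<in> S" using y by (simp add: Obj_Q)
    obtain h where h: "h \<in> Hom C (u c) (u y)" "\<And>i. i \<in> I \<Longrightarrow> h \<cdot> fst (snd (\<iota> i)) = fst (snd (\<xi> i))"
      using coproduct_copair[OF co u_in[OF y'], of "\<lambda>i. fst (snd (\<xi> i))"] xij(3) by blast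
    have "(c, h, y) \<in> Hom Q c y"
      using refl[OF y' h(1)] h xij(2) c y' by (simp add: Hom_Q_iff)
    moreover have "(c, h, y) \<cdot>\<^bsub>Q\<^esub> \<iota> j = \<xi> j" if "j \<in> I" for j
      using ij[OF that] xij[OF that] h(2)[OF that] Cmp_Q by metis
    ultimately show "\<exists>t\<in>Hom Q c y. \<forall>i\<in>I. t \<cdot>\<^bsub>Q\<^esub> \<iota> i = \<xi> i" by blast
  }
  fix y s t assume s: "s \<in> Hom Q c y" and t: "t \<in> Hom Q c y"
    and eq: "\<And>i. i \<in> I \<Longrightarrow> s \<cdot>\<^bsub>Q\<^esub> \<iota> i = t \<cdot>\<^bsub>Q\<^esub> \<iota> i"
  obtain h k where hk: "s = (c, h, y)" "t = (c, k, y)" "h \<in> Hom C (u c) (u y)" "k \<in> Hom C (u c) (u y)"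
    using s t by (auto simp: Hom_Q_iff)
  have "h = k"
  proof (rule coproduct_ext[OF co hk(3,4)])
    fix j assume j: "j \<in> I"
    show "h \<cdot> fst (snd (\<iota> j)) = k \<cdot> fst (snd (\<iota> j))"
      using eq[OF j] ij[OF j] hk(1,2) Cmp_Q by (metis fst_conv snd_conv)
  qed
  then show "s = t" using hk by simp
qed

text \<open>Coproducts of one family are isomorphic, compatibly with the injections. Hence a single
  structured coproduct known to lie over a coproduct of \<open>C\<close> settles the matter for all
  coproducts of that family.\<close>

lemma forget_coproduct:
  assumes "is_coproduct Q I b c \<iota>"
    and "is_coproduct Q I b c' \<iota>'" "is_coproduct C I (\<lambda>i. u (b i)) (u c') (\<lambda>i. fst (snd (\<iota>' i)))"
  shows "is_coproduct C I (\<lambda>i. u (b i)) (u c) (\<lambda>i. fst (snd (\<iota> i)))"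
proof -
  obtain w w' where w: "w \<in> Hom Q c' c" "w' \<in> Hom Q c c'" "w' \<cdot>\<^bsub>Q\<^esub> w = Idn Q c'" "w \<cdot>\<^bsub>Q\<^esub> w' = Idn Q c"
    and eq: "\<And>i. i \<in> I \<Longrightarrow> w \<cdot>\<^bsub>Q\<^esub> \<iota>' i = \<iota> i"
    using category.coproduct_unique[OF category_Q assms(2,1)] by blast
  obtain h h' where h: "w = (c', h, c)" "w' = (c, h', c')" "h \<in> Hom C (u c') (u c)" "h' \<in> Hom C (u c) (u c')"
    using w(1,2) by (auto simp: Hom_Q_iff)
  have "h' \<cdot> h = Idn C (u c')" "h \<cdot> h' = Idn C (u c)"
    using w(3,4) h by (simp_all add: Cmp_Q Idn_Q)
  from coproduct_iso[OF assms(3) h(3,4) this]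
  show ?thesis
  proof (rule coproduct_cong)
    fix i assume i: "i \<in> I"
    have "\<iota>' i \<in> Hom Q (b i) c'"
      using category.coproduct_inj[OF category_Q assms(2) i] .
    then obtain k where "\<iota>' i = (b i, k, c')" by (auto simp: Hom_Q_iff)
    then show "h \<cdot> fst (snd (\<iota>' i)) = fst (snd (\<iota> i))"
      using eq[OF i] h(1) Cmp_Q by (metis fst_conv snd_conv)
  qed simp
qed

end

section \<open>Slices\<close>

context category
begin

lemma slice_structured:
  "structured_objects C {f \<in> Arr C. Cod C f = b} (Dom C) (\<lambda>f h g. g \<cdot> h = f)"
proof
  fix x y z h k
  assume "x \<in> {f \<in> Arr C. Cod C f = b}" "y \<in> {f \<in> Arr C. Cod C f = b}" "z \<in> {f \<in> Arr C. Cod C f = b}"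
    and h: "h \<in> Hom C (Dom C x) (Dom C y)" and k: "k \<in> Hom C (Dom C y) (Dom C z)"
    and eq: "y \<cdot> h = x" "z \<cdot> k = y"
  then have "z \<in> Hom C (Dom C z) b" by (simp add: Hom_iff)
  from Cmp_assoc[OF h k this] eq show "z \<cdot> (k \<cdot> h) = x" by argo
qed (simp_all add: Dom_in_Obj)

lemmas category_slice = structured_objects.category_Q[OF slice_structured, folded slice_def]

lemma Obj_slice: "Obj (slice C X) = {f \<in> Arr C. Cod C f = X}"
  by (simp add: slice_def structured_def)

lemma Hom_slice_iff:
  "t \<in> Hom (slice C X) f g \<longleftrightarrow> (\<exists>h. t = (f, h, g) \<and> f \<in> Arr C \<and> Cod C f = X \<and> g \<in> Arr C \<and> Cod C g = X
     \<and> h \<in> Hom C (Dom C f) (Dom C g) \<and> g \<cdot> h = f)"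
  using structured_objects.Hom_Q_iff[OF slice_structured, folded slice_def] by auto

lemma Cmp_slice [simp]: "(y', k, z) \<cdot>\<^bsub>slice C X\<^esub> (x, h, y) = (x, k \<cdot> h, z)"
  by (simp add: structured_def slice_def)

lemma Idn_slice [simp]: "Idn (slice C X) f = (f, Idn C (Dom C f), f)"
  by (simp add: structured_def slice_def)

lemma slice_coproductI:
  assumes c: "c \<in> Arr C" "Cod C c = X" and i: "\<And>i. i \<in> I \<Longrightarrow> \<iota> i \<in> Hom (slice C X) (b i) c"
    and co: "is_coproduct C I (\<lambda>i. Dom C (b i)) (Dom C c) (\<lambda>i. fst (snd (\<iota> i)))"
  shows "is_coproduct (slice C X) I b c \<iota>"
  unfolding slice_def
proof (rule structured_objects.structured_coproductI[OF slice_structured])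
  show "c \<in> {f \<in> Arr C. Cod C f = X}" using c by simp
  show "\<iota> j \<in> Hom (structured C {f \<in> Arr C. Cod C f = X} (Dom C) (\<lambda>f h g. g \<cdot> h = f)) (b j) c"
    if "j \<in> I" for j
    using i[OF that] by (simp add: slice_def)
  show "is_coproduct C I (\<lambda>i. Dom C (b i)) (Dom C c) (\<lambda>i. fst (snd (\<iota> i)))" by (rule co)
  fix y h assume y: "y \<in> {f \<in> Arr C. Cod C f = X}" and h: "h \<in> Hom C (Dom C c) (Dom C y)"
    and eq: "\<And>i. i \<in> I \<Longrightarrow> y \<cdot> (h \<cdot> fst (snd (\<iota> i))) = b i"
  have yH: "y \<in> Hom C (Dom C y) X" using y by (simp add: Hom_iff)
  show "y \<cdot> h = c"
  proof (rule coproduct_ext[OF co Cmp_in_Hom[OF h yH]])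
    show "c \<in> Hom C (Dom C c) X" using c by (simp add: Hom_iff)
    fix j assume j: "j \<in> I"
    have "fst (snd (\<iota> j)) \<in> Hom C (Dom C (b j)) (Dom C c)" "c \<cdot> fst (snd (\<iota> j)) = b j"
      using i[OF j] by (auto simp: Hom_slice_iff)
    then show "(y \<cdot> h) \<cdot> fst (snd (\<iota> j)) = c \<cdot> fst (snd (\<iota> j))"
      using Cmp_assoc[OF _ h yH] eq[OF j] by simp
  qed
qed

end

context familial
begin

text \<open>The structure map of the coproduct is the copairing of the given structure maps. The
  second conclusion records that this coproduct lies over one in \<open>C\<close>, which is the
  input that \<open>forget_coproduct\<close> requires.\<close>

lemma slice_coproduct_exists:
  assumes X: "X \<in> Obj C" and I: "I \<in> U" and b: "\<And>i. i \<in> I \<Longrightarrow> b i \<in> Obj (slice C X)"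
  obtains c \<iota> where "is_coproduct (slice C X) I b c \<iota>"
    "is_coproduct C I (\<lambda>i. Dom C (b i)) (Dom C c) (\<lambda>i. fst (snd (\<iota> i)))"
proof -
  have bH: "b i \<in> Hom C (Dom C (b i)) X" if "i \<in> I" for i
    using b[OF that] by (simp add: Obj_slice Hom_iff)
  have "Dom C (b i) \<in> Obj C" if "i \<in> I" for i
    using Hom_Dom_Obj[OF bH[OF that]] .
  with coproducts_exist[OF I, of "\<lambda>i. Dom C (b i)"] obtain d \<kappa> where co: "is_coproduct C I (\<lambda>i. Dom C (b i)) d \<kappa>"
    by blast
  obtain c where c: "c \<in> Hom C d X" "\<And>i. i \<in> I \<Longrightarrow> c \<cdot> \<kappa> i = b i"
    using coproduct_copair[OF co X bH] by blast
  have cA: "c \<in> Arr C" "Cod C c = X" "Dom C c = d" using c(1) by (auto simp: Hom_iff)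
  have "is_coproduct (slice C X) I b c (\<lambda>i. (b i, \<kappa> i, c))"
  proof (rule slice_coproductI[OF cA(1,2)])
    show "(b i, \<kappa> i, c) \<in> Hom (slice C X) (b i) c" if "i \<in> I" for i
      using coproduct_inj[OF co that] bH[OF that] cA c(2)[OF that] by (simp add: Hom_slice_iff Hom_iff)
    show "is_coproduct C I (\<lambda>i. Dom C (b i)) (Dom C c) (\<lambda>i. fst (snd (b i, \<kappa> i, c)))"
      using co cA by simp
  qed
  then show ?thesis using that[of c "\<lambda>i. (b i, \<kappa> i, c)"] co cA by simp
qed

lemma slice_coproductD:
  assumes X: "X \<in> Obj C" and I: "I \<in> U" and co: "is_coproduct (slice C X) I b c \<iota>"
  shows "is_coproduct C I (\<lambda>i. Dom C (b i)) (Dom C c) (\<lambda>i. fst (snd (\<iota> i)))"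
proof -
  obtain c' \<iota>' where "is_coproduct (slice C X) I b c' \<iota>'"
    "is_coproduct C I (\<lambda>i. Dom C (b i)) (Dom C c') (\<lambda>i. fst (snd (\<iota>' i)))"
    using slice_coproduct_exists[OF X I, of b] category.coproduct_in[OF category_slice co] by blast
  then show ?thesis
    using structured_objects.forget_coproduct[OF slice_structured] co unfolding slice_def by blast
qed

text \<open>A factorisation of the underlying map through a summand lies over \<open>X\<close>
  automatically, since each injection of a coproduct in the slice commutes with the structure
  maps.\<close>

lemma slice_connected:
  assumes f: "f \<in> Arr C" "Cod C f = X" and conn: "connected_object U C (Dom C f)"
  shows "connected_object U (slice C X) f"
proof (rule category.connectedI[OF category_slice])
  have X: "X \<in> Obj C" using f Cod_in_Obj by blast
  show "f \<in> Obj (slice C X)" using f by (simp add: Obj_slice)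
  fix I :: "'i set" and b c \<iota> assume I: "I \<in> U" and co: "is_coproduct (slice C X) I b c \<iota>"
  note co' = slice_coproductD[OF X I co]
  have ij: "\<iota> j = (b j, fst (snd (\<iota> j)), c)" "fst (snd (\<iota> j)) \<in> Hom C (Dom C (b j)) (Dom C c)"
    "b j \<in> Hom C (Dom C (b j)) X" "c \<cdot> fst (snd (\<iota> j)) = b j" if "j \<in> I" for j
    using category.coproduct_inj[OF category_slice co that] by (auto simp: Hom_slice_iff Hom_iff)
  have c: "c \<in> Hom C (Dom C c) X"
    using category.coproduct_Obj[OF category_slice co] by (simp add: Obj_slice Hom_iff)
  {
    fix t assume "t \<in> Hom (slice C X) f c"
    then obtain h where t: "t = (f, h, c)" and h: "h \<in> Hom C (Dom C f) (Dom C c)" "c \<cdot> h = f"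
      by (auto simp: Hom_slice_iff)
    obtain i g where i: "i \<in> I" and g: "g \<in> Hom C (Dom C f) (Dom C (b i))" and eq: "h = fst (snd (\<iota> i)) \<cdot> g"
      using connected_factor[OF conn I co' h(1)] by blast
    have "b i \<cdot> g = f"
      using Cmp_assoc[OF g ij(2)[OF i] c] ij(4)[OF i] eq h(2) by simp
    then have "(f, g, b i) \<in> Hom (slice C X) f (b i)"
      using f g ij(3)[OF i] by (auto simp: Hom_slice_iff Hom_iff)
    moreover have "t = \<iota> i \<cdot>\<^bsub>slice C X\<^esub> (f, g, b i)"
      using t eq ij(1)[OF i] Cmp_slice by metis
    ultimately show "\<exists>i\<in>I. \<exists>g\<in>Hom (slice C X) f (b i). t = \<iota> i \<cdot>\<^bsub>slice C X\<^esub> g"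
      using i by blast
  }
  fix i j s t assume i: "i \<in> I" and j: "j \<in> I" and s: "s \<in> Hom (slice C X) f (b i)"
    and t: "t \<in> Hom (slice C X) f (b j)" and eq: "\<iota> i \<cdot>\<^bsub>slice C X\<^esub> s = \<iota> j \<cdot>\<^bsub>slice C X\<^esub> t"
  obtain g h where gh: "s = (f, g, b i)" "t = (f, h, b j)"
    "g \<in> Hom C (Dom C f) (Dom C (b i))" "h \<in> Hom C (Dom C f) (Dom C (b j))"
    using s t by (auto simp: Hom_slice_iff)
  have "fst (snd (\<iota> i)) \<cdot> g = fst (snd (\<iota> j)) \<cdot> h"
    using eq ij(1)[OF i] ij(1)[OF j] gh(1,2) Cmp_slice by (metis fst_conv snd_conv)
  then show "i = j \<and> s = t"
    using connected_factor_unique[OF conn I co' i j gh(3,4)] gh by auto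
qed

text \<open>An object \<open>f\<close> of the slice is decomposed by restricting it to the connected
  pieces of its domain.\<close>

lemma familial_slice:
  assumes X: "X \<in> Obj C"
  shows "familial U (slice C X)"
proof -
  interpret S: category "slice C X" by (rule category_slice)
  show ?thesis
  proof
    fix I :: "'i set" and b assume "I \<in> U" "\<And>i. i \<in> I \<Longrightarrow> b i \<in> Obj (slice C X)"
    then show "\<exists>c \<iota>. is_coproduct (slice C X) I b c \<iota>"
      using slice_coproduct_exists[OF X, of I b] by blast
  next
    fix f assume "f \<in> Obj (slice C X)"
    then have f: "f \<in> Arr C" "Cod C f = X" by (auto simp: Obj_slice)
    obtain I b \<iota> where I: "I \<in> U" and co: "is_coproduct C I b (Dom C f) \<iota>"
      and conn: "\<And>i. i \<in> I \<Longrightarrow> connected_object U C (b i)"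
      using connected_decomposition[OF Dom_in_Obj[OF f(1)]] by blast
    have iH: "\<iota> i \<in> Arr C" "Dom C (\<iota> i) = b i" "Cod C (\<iota> i) = Dom C f" if "i \<in> I" for i
      using coproduct_inj[OF co that] by (auto simp: Hom_iff)
    have "is_coproduct (slice C X) I (\<lambda>i. f \<cdot> \<iota> i) f (\<lambda>i. (f \<cdot> \<iota> i, \<iota> i, f))"
    proof (rule slice_coproductI[OF f])
      show "(f \<cdot> \<iota> i, \<iota> i, f) \<in> Hom (slice C X) (f \<cdot> \<iota> i) f" if "i \<in> I" for i
        using iH[OF that] f by (simp add: Hom_slice_iff Hom_iff)
      show "is_coproduct C I (\<lambda>i. Dom C (f \<cdot> \<iota> i)) (Dom C f) (\<lambda>i. fst (snd (f \<cdot> \<iota> i, \<iota> i, f)))"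
        by (rule coproduct_cong[OF co]) (use iH f in auto)
    qed
    moreover have "connected_object U (slice C X) (f \<cdot> \<iota> i)" if "i \<in> I" for i
      using slice_connected[of "f \<cdot> \<iota> i" X] iH[OF that] f conn[OF that] by simp
    ultimately show "\<exists>I\<in>U. \<exists>b \<iota>. is_coproduct (slice C X) I b f \<iota>
        \<and> (\<forall>i\<in>I. connected_object U (slice C X) (b i))"
      using I by blast
  qed
qed

end

section \<open>Eilenberg--Moore categories of coproduct-preserving monads\<close>

locale familial_monad = familial U C + T: is_functor C C T
  for U :: "'i set set" and C :: "('o, 'a) cat" (structure) and T :: "('o, 'a, 'o, 'a) fctr" +
  fixes \<eta> \<mu> :: "'o \<Rightarrow> 'a"
  assumes unit_in: "a \<in> Obj C \<Longrightarrow> \<eta> a \<in> Hom C a (omap T a)"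
    and unit_natural: "f \<in> Hom C a b \<Longrightarrow> amap T f \<cdot> \<eta> a = \<eta> b \<cdot> f"
    and mult_in: "a \<in> Obj C \<Longrightarrow> \<mu> a \<in> Hom C (omap T (omap T a)) (omap T a)"
    and mult_natural: "f \<in> Hom C a b \<Longrightarrow> amap T f \<cdot> \<mu> a = \<mu> b \<cdot> amap T (amap T f)"
    and T_preserves: "preserves_coproducts U C C T"
begin

abbreviation EM where "EM \<equiv> em_category C T \<eta> \<mu>"

definition algebra :: "'o \<Rightarrow> 'a \<Rightarrow> bool" where
  "algebra a \<alpha> \<longleftrightarrow> a \<in> Obj C \<and> \<alpha> \<in> Hom C (omap T a) a \<and>
     \<alpha> \<cdot> \<eta> a = Idn C a \<and> \<alpha> \<cdot> amap T \<alpha> = \<alpha> \<cdot> \<mu> a"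

lemma EM_eq_structured: "EM = structured C {(a, \<alpha>). algebra a \<alpha>} fst
    (\<lambda>x h y. h \<cdot> snd x = snd y \<cdot> amap T h)"
  by (simp add: em_category_def algebra_def case_prod_unfold)

lemma EM_structured:
  "structured_objects C {(a, \<alpha>). algebra a \<alpha>} fst (\<lambda>x h y. h \<cdot> snd x = snd y \<cdot> amap T h)"
proof
  fix x y z h k
  assume "x \<in> {(a, \<alpha>). algebra a \<alpha>}" "y \<in> {(a, \<alpha>). algebra a \<alpha>}" "z \<in> {(a, \<alpha>). algebra a \<alpha>}"
    and h: "h \<in> Hom C (fst x) (fst y)" and k: "k \<in> Hom C (fst y) (fst z)"
    and eq: "h \<cdot> snd x = snd y \<cdot> amap T h" "k \<cdot> snd y = snd z \<cdot> amap T k"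
  then have a: "snd x \<in> Hom C (omap T (fst x)) (fst x)" "snd y \<in> Hom C (omap T (fst y)) (fst y)"
    "snd z \<in> Hom C (omap T (fst z)) (fst z)" by (auto simp: algebra_def)
  have "(k \<cdot> h) \<cdot> snd x = k \<cdot> (snd y \<cdot> amap T h)"
    using Cmp_assoc[OF a(1) h k] eq(1) by simp
  also have "\<dots> = (snd z \<cdot> amap T k) \<cdot> amap T h"
    using Cmp_assoc[OF T.amap_in_Hom[OF h] a(2) k] eq(2) by simp
  also have "\<dots> = snd z \<cdot> amap T (k \<cdot> h)"
    using Cmp_assoc[OF T.amap_in_Hom[OF h] T.amap_in_Hom[OF k] a(3)] T.amap_Cmp[OF h k] by simp
  finally show "(k \<cdot> h) \<cdot> snd x = snd z \<cdot> amap T (k \<cdot> h)" .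
next
  fix x assume "x \<in> {(a, \<alpha>). algebra a \<alpha>}"
  then show "fst x \<in> Obj C" "Idn C (fst x) \<cdot> snd x = snd x \<cdot> amap T (Idn C (fst x))"
    by (auto simp: algebra_def Hom_iff)
qed

lemmas category_EM = structured_objects.category_Q[OF EM_structured, folded EM_eq_structured]

lemma Obj_EM: "x \<in> Obj EM \<longleftrightarrow> algebra (fst x) (snd x)"
  by (simp add: EM_eq_structured structured_def case_prod_unfold)

lemma Hom_EM_iff:
  "t \<in> Hom EM x y \<longleftrightarrow> (\<exists>h. t = (x, h, y) \<and> algebra (fst x) (snd x) \<and> algebra (fst y) (snd y)
     \<and> h \<in> Hom C (fst x) (fst y) \<and> h \<cdot> snd x = snd y \<cdot> amap T h)"
  using structured_objects.Hom_Q_iff[OF EM_structured, folded EM_eq_structured] by (simp add: case_prod_unfold)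

lemma Cmp_EM: "(y', k, z) \<cdot>\<^bsub>EM\<^esub> (x, h, y) = (x, k \<cdot> h, z)"
  by (simp add: structured_def EM_eq_structured)

text \<open>Compatibility of \<open>h\<close> with the actions is an equation between maps out of
  \<open>T\<close> applied to the coproduct. It may be tested on the images of the injections under
  \<open>T\<close>, which again form a coproduct cocone.\<close>

lemma EM_coproductI:
  assumes I: "I \<in> U" and c: "c \<in> Obj EM" and i: "\<And>i. i \<in> I \<Longrightarrow> \<iota> i \<in> Hom EM (b i) c"
    and co: "is_coproduct C I (\<lambda>i. fst (b i)) (fst c) (\<lambda>i. fst (snd (\<iota> i)))"
  shows "is_coproduct EM I b c \<iota>"
  unfolding EM_eq_structured
proof (rule structured_objects.structured_coproductI[OF EM_structured])
  let ?\<iota> = "\<lambda>i. fst (snd (\<iota> i))"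
  show "c \<in> {(a, \<alpha>). algebra a \<alpha>}" using c by (simp add: Obj_EM case_prod_unfold)
  show "\<iota> j \<in> Hom (structured C {(a, \<alpha>). algebra a \<alpha>} fst (\<lambda>x h y. h \<cdot> snd x = snd y \<cdot> amap T h)) (b j) c"
    if "j \<in> I" for j
    using i[OF that] by (simp add: EM_eq_structured)
  show "is_coproduct C I (\<lambda>i. fst (b i)) (fst c) ?\<iota>" by (rule co)
  fix y h assume y: "y \<in> {(a, \<alpha>). algebra a \<alpha>}" and h: "h \<in> Hom C (fst c) (fst y)"
    and eq: "\<And>i. i \<in> I \<Longrightarrow> (h \<cdot> ?\<iota> i) \<cdot> snd (b i) = snd y \<cdot> amap T (h \<cdot> ?\<iota> i)"
  have yH: "snd y \<in> Hom C (omap T (fst y)) (fst y)" using y by (auto simp: algebra_def)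
  have cH: "snd c \<in> Hom C (omap T (fst c)) (fst c)" using c by (auto simp: Obj_EM algebra_def)
  note Th = T.amap_in_Hom[OF h]
  show "h \<cdot> snd c = snd y \<cdot> amap T h"
  proof (rule coproduct_ext[OF preserves_coproductsD[OF T_preserves I co]
        Cmp_in_Hom[OF cH h] Cmp_in_Hom[OF Th yH]])
    fix j assume j: "j \<in> I"
    have ij: "?\<iota> j \<in> Hom C (fst (b j)) (fst c)" "?\<iota> j \<cdot> snd (b j) = snd c \<cdot> amap T (?\<iota> j)"
      "snd (b j) \<in> Hom C (omap T (fst (b j))) (fst (b j))"
      using i[OF j] by (auto simp: Hom_EM_iff algebra_def)
    note Ti = T.amap_in_Hom[OF ij(1)]
    have "(h \<cdot> snd c) \<cdot> amap T (?\<iota> j) = h \<cdot> (?\<iota> j \<cdot> snd (b j))"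
      using Cmp_assoc[OF Ti cH h] ij(2) by simp
    also have "\<dots> = snd y \<cdot> (amap T h \<cdot> amap T (?\<iota> j))"
      using Cmp_assoc[OF ij(3) ij(1) h] eq[OF j] T.amap_Cmp[OF ij(1) h] by simp
    also have "\<dots> = (snd y \<cdot> amap T h) \<cdot> amap T (?\<iota> j)"
      by (rule Cmp_assoc[OF Ti Th yH])
    finally show "(h \<cdot> snd c) \<cdot> amap T (?\<iota> j) = (snd y \<cdot> amap T h) \<cdot> amap T (?\<iota> j)" .
  qed
qed

text \<open>\<open>T\<close> applied to \<open>c\<close> is the coproduct of the objects
  \<open>omap T (fst (b i))\<close>, so the action \<open>\<gamma>\<close> can be glued from the
  actions of the summands. Its laws are then checked on injections, using those of the summands and
  the naturality of \<open>\<eta>\<close> and \<open>\<mu>\<close>.\<close>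

lemma EM_coproduct_exists:
  assumes I: "I \<in> U" and b: "\<And>i. i \<in> I \<Longrightarrow> b i \<in> Obj EM"
  obtains c \<iota> where "is_coproduct EM I b c \<iota>"
    "is_coproduct C I (\<lambda>i. fst (b i)) (fst c) (\<lambda>i. fst (snd (\<iota> i)))"
proof -
  let ?a = "\<lambda>i. fst (b i)" and ?\<alpha> = "\<lambda>i. snd (b i)"
  have alg: "?a i \<in> Obj C" "?\<alpha> i \<in> Hom C (omap T (?a i)) (?a i)"
     "?\<alpha> i \<cdot> \<eta> (?a i) = Idn C (?a i)" "?\<alpha> i \<cdot> amap T (?\<alpha> i) = ?\<alpha> i \<cdot> \<mu> (?a i)" if "i \<in> I" for i
    using b[OF that] by (auto simp: Obj_EM algebra_def)
  obtain c \<kappa> where co: "is_coproduct C I ?a c \<kappa>"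
    using coproducts_exist[OF I, of ?a] alg(1) by blast
  have c: "c \<in> Obj C" by (rule coproduct_Obj[OF co])
  note k = coproduct_inj[OF co]
  note Tco = preserves_coproductsD[OF T_preserves I co]
  have "\<kappa> i \<cdot> ?\<alpha> i \<in> Hom C (omap T (?a i)) c" if "i \<in> I" for i
    using Cmp_in_Hom[OF alg(2)[OF that] k[OF that]] .
  then obtain \<gamma> where g: "\<gamma> \<in> Hom C (omap T c) c" and gk: "\<And>i. i \<in> I \<Longrightarrow> \<gamma> \<cdot> amap T (\<kappa> i) = \<kappa> i \<cdot> ?\<alpha> i"
    using coproduct_copair[OF Tco c, of "\<lambda>i. \<kappa> i \<cdot> ?\<alpha> i"] by blast
  have "\<gamma> \<cdot> \<eta> c = Idn C c"
  proof (rule coproduct_ext[OF co Cmp_in_Hom[OF unit_in[OF c] g] Idn_in_Hom[OF c]])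
    fix i assume i: "i \<in> I"
    have "(\<gamma> \<cdot> \<eta> c) \<cdot> \<kappa> i = \<gamma> \<cdot> (amap T (\<kappa> i) \<cdot> \<eta> (?a i))"
      using Cmp_assoc[OF k[OF i] unit_in[OF c] g] unit_natural[OF k[OF i]] by simp
    also have "\<dots> = \<kappa> i \<cdot> (?\<alpha> i \<cdot> \<eta> (?a i))"
      using Cmp_assoc[OF unit_in[OF alg(1)[OF i]] T.amap_in_Hom[OF k[OF i]] g]
        Cmp_assoc[OF unit_in[OF alg(1)[OF i]] alg(2)[OF i] k[OF i]] gk[OF i] by simp
    finally show "(\<gamma> \<cdot> \<eta> c) \<cdot> \<kappa> i = Idn C c \<cdot> \<kappa> i"
      using alg(3)[OF i] Cmp_Idn_left[OF k[OF i]] Cmp_Idn_right[OF k[OF i]] by simp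
  qed
  \<comment> \<open>Both sides start at \<open>T (T c)\<close>, which is a coproduct because
    \<open>T\<close> preserves the coproduct \<open>T c\<close> in turn.\<close>
  moreover have "\<gamma> \<cdot> amap T \<gamma> = \<gamma> \<cdot> \<mu> c"
  proof (rule coproduct_ext[OF preserves_coproductsD[OF T_preserves I Tco]
        Cmp_in_Hom[OF T.amap_in_Hom[OF g] g] Cmp_in_Hom[OF mult_in[OF c] g]])
    fix i assume i: "i \<in> I"
    note ki = k[OF i] and ai = alg(2)[OF i]
    note Tki = T.amap_in_Hom[OF ki] and Tai = T.amap_in_Hom[OF ai]
    note TTki = T.amap_in_Hom[OF Tki]
    have "(\<gamma> \<cdot> amap T \<gamma>) \<cdot> amap T (amap T (\<kappa> i)) = \<gamma> \<cdot> (amap T (\<kappa> i) \<cdot> amap T (?\<alpha> i))"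
      using Cmp_assoc[OF TTki T.amap_in_Hom[OF g] g] T.amap_Cmp[OF Tki g] T.amap_Cmp[OF ai ki] gk[OF i]
      by simp
    also have "\<dots> = \<kappa> i \<cdot> (?\<alpha> i \<cdot> amap T (?\<alpha> i))"
      using Cmp_assoc[OF Tai Tki g] Cmp_assoc[OF Tai ai ki] gk[OF i] by simp
    also have "\<dots> = (\<gamma> \<cdot> amap T (\<kappa> i)) \<cdot> \<mu> (?a i)"
      using alg(4)[OF i] Cmp_assoc[OF mult_in[OF alg(1)[OF i]] ai ki] gk[OF i] by simp
    also have "\<dots> = (\<gamma> \<cdot> \<mu> c) \<cdot> amap T (amap T (\<kappa> i))"
      using Cmp_assoc[OF mult_in[OF alg(1)[OF i]] Tki g] mult_natural[OF ki]
        Cmp_assoc[OF TTki mult_in[OF c] g] by simp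
    finally show "(\<gamma> \<cdot> amap T \<gamma>) \<cdot> amap T (amap T (\<kappa> i)) = (\<gamma> \<cdot> \<mu> c) \<cdot> amap T (amap T (\<kappa> i))" .
  qed
  ultimately have algc: "algebra c \<gamma>" using c g by (simp add: algebra_def)
  have "is_coproduct EM I b (c, \<gamma>) (\<lambda>i. (b i, \<kappa> i, (c, \<gamma>)))"
  proof (rule EM_coproductI[OF I])
    show "(c, \<gamma>) \<in> Obj EM" using algc by (simp add: Obj_EM)
    show "(b i, \<kappa> i, c, \<gamma>) \<in> Hom EM (b i) (c, \<gamma>)" if "i \<in> I" for i
      using b[OF that] algc k[OF that] gk[OF that] by (simp add: Hom_EM_iff Obj_EM)
    show "is_coproduct C I ?a (fst (c, \<gamma>)) (\<lambda>i. fst (snd (b i, \<kappa> i, c, \<gamma>)))" using co by simp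
  qed
  then show ?thesis using that[of "(c, \<gamma>)" "\<lambda>i. (b i, \<kappa> i, (c, \<gamma>))"] co by simp
qed

lemma EM_coproductD:
  assumes I: "I \<in> U" and co: "is_coproduct EM I b c \<iota>"
  shows "is_coproduct C I (\<lambda>i. fst (b i)) (fst c) (\<lambda>i. fst (snd (\<iota> i)))"
proof -
  obtain c' \<iota>' where "is_coproduct EM I b c' \<iota>'"
    "is_coproduct C I (\<lambda>i. fst (b i)) (fst c') (\<lambda>i. fst (snd (\<iota>' i)))"
    using EM_coproduct_exists[OF I, of b] category.coproduct_in[OF category_EM co] by blast
  then show ?thesis
    using structured_objects.forget_coproduct[OF EM_structured] co unfolding EM_eq_structured by blast
qed

text \<open>The action of an algebra links two summands \<open>k\<close>, \<open>k'\<close> of its underlying object when it maps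
  some connected part of \<open>T\<close> applied to the first into the second.  The summands of the algebra
  are the classes of the generated equivalence relation.\<close>

lemma EM_connected_decomposition:
  assumes alg: "algebra z \<alpha>"
  shows "\<exists>I \<in> U. \<exists>b \<iota>. is_coproduct EM I b (z, \<alpha>) \<iota> \<and> (\<forall>i\<in>I. connected_object U EM (b i))"
proof -
  have z: "z \<in> Obj C" and al: "\<alpha> \<in> Hom C (omap T z) z" and unit: "\<alpha> \<cdot> \<eta> z = Idn C z"
    and assoc: "\<alpha> \<cdot> amap T \<alpha> = \<alpha> \<cdot> \<mu> z"
    using alg by (auto simp: algebra_def)
  obtain K zk e where K: "K \<in> U" and co: "is_coproduct C K zk z e"
    and conn: "\<And>k. k \<in> K \<Longrightarrow> connected_object U C (zk k)"
    using connected_decomposition[OF z] by blast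
  note e = coproduct_inj[OF co]
  define r where "r = {(k, k'). k \<in> K \<and> k' \<in> K \<and> (\<exists>a s t. connected_object U C a \<and>
    s \<in> Hom C a (omap T (zk k)) \<and> t \<in> Hom C a (zk k') \<and> \<alpha> \<cdot> (amap T (e k) \<cdot> s) = e k' \<cdot> t)}"
  define E where "E = (r \<union> r\<inverse>)\<^sup>*"
  have E_refl: "(k, k) \<in> E" for k by (simp add: E_def)
  have E_sym: "(k, k') \<in> E \<Longrightarrow> (k', k) \<in> E" for k k'
    unfolding E_def by (metis converse_Un converse_converse rtrancl_converseI sup_commute)
  have E_trans: "(k, k') \<in> E \<Longrightarrow> (k', k'') \<in> E \<Longrightarrow> (k, k'') \<in> E" for k k' k''
    unfolding E_def by (rule rtrancl_trans)
  \<comment> \<open>A class is named by a chosen representative rather than by itself, since the new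
    summands must again be indexed by elements of \<open>'i\<close>; \<open>image_in\<close> then
    places the set of names in \<open>U\<close>.\<close>
  define q where "q k = (SOME k'. (k, k') \<in> E)" for k
  have q_E: "(k, q k) \<in> E" for k unfolding q_def by (rule someI[of _ k]) (rule E_refl)
  have q_eq: "q k = q k'" if "(k, k') \<in> E" for k k'
  proof -
    have "(\<lambda>j. (k, j) \<in> E) = (\<lambda>j. (k', j) \<in> E)" using that E_sym E_trans by blast
    then show ?thesis by (simp add: q_def)
  qed
  define Kl where "Kl l = {k \<in> K. q k = l}" for l
  have KlU: "Kl l \<in> U" for l by (rule subset_in[OF K]) (auto simp: Kl_def)
  have qU: "q ` K \<in> U" by (rule image_in[OF K])
  have KlK: "k \<in> K" if "k \<in> Kl l" for k l using that by (simp add: Kl_def)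
  \<comment> \<open>A coproduct is chosen for every \<open>l\<close>, also when no member of
    \<open>K\<close> has that label, so that \<open>zl\<close> and \<open>d\<close> are total
    functions.\<close>
  have "\<exists>x. is_coproduct C (Kl l) zk (fst x) (snd x)" for l
    using coproducts_exist[OF KlU, of l zk] connected_Obj[OF conn[OF KlK]] by simp
  then have "\<exists>x. \<forall>l. is_coproduct C (Kl l) zk (fst (x l)) (snd (x l))"
    by (intro choice allI)
  then obtain x where x: "\<And>l. is_coproduct C (Kl l) zk (fst (x l)) (snd (x l))" by blast
  define zl d where "zl l = fst (x l)" and "d l = snd (x l)" for l
  have zl: "is_coproduct C (Kl l) zk (zl l) (d l)" for l by (simp add: zl_def d_def x)
  note d = coproduct_inj[OF zl]
  have "\<exists>m. m \<in> Hom C (zl l) z \<and> (\<forall>k\<in>Kl l. m \<cdot> d l k = e k)" for l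
  proof -
    have "e k \<in> Hom C (zk k) z" if "k \<in> Kl l" for k using e[OF KlK[OF that]] .
    from coproduct_copair[OF zl z this] obtain u
      where "u \<in> Hom C (zl l) z" "\<And>k. k \<in> Kl l \<Longrightarrow> u \<cdot> d l k = e k" by blast
    then show ?thesis by blast
  qed
  then obtain m where m: "\<And>l. m l \<in> Hom C (zl l) z" and md: "\<And>l k. k \<in> Kl l \<Longrightarrow> m l \<cdot> d l k = e k"
    by metis
  have mco: "is_coproduct C (q ` K) zl z m"
  proof (rule coproduct_regroup[OF co])
    show "is_coproduct C {k \<in> K. q k = l} zk (zl l) (d l)" for l using zl[of l] by (simp add: Kl_def)
    show "m (q k) \<cdot> d (q k) k = e k" if "k \<in> K" for k using md that by (simp add: Kl_def)
  qed (rule m)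
  \<comment> \<open>Because the \<open>m l\<close> are monic, laws for the restricted actions will
    follow from those of \<open>\<alpha>\<close> by cancellation.\<close>
  have mono: "f = g" if "l \<in> q ` K" "f \<in> Hom C x (zl l)" "g \<in> Hom C x (zl l)" "m l \<cdot> f = m l \<cdot> g"
    for f g x l
    by (rule injection_mono[OF qU mco that])
  have zlO: "zl l \<in> Obj C" for l by (rule coproduct_Obj[OF zl])
  note Tm = T.amap_in_Hom[OF m]
  \<comment> \<open>The action restricts to each class. A connected piece of \<open>T (zl l)\<close>
    lies in some \<open>T (zk k)\<close> with \<open>k\<close> in the class, and
    \<open>\<alpha>\<close> sends it into a single summand \<open>k'\<close>. That piece itself
    witnesses a link from \<open>k\<close> to \<open>k'\<close>, so \<open>k'\<close> belongs to the
    class as well and the piece lands in \<open>zl l\<close>.\<close>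
  have "\<exists>\<beta>. \<beta> \<in> Hom C (omap T (zl l)) (zl l) \<and> m l \<cdot> \<beta> = \<alpha> \<cdot> amap T (m l)" for l
  proof -
    obtain J w j where J: "J \<in> U" and jco: "is_coproduct C J w (omap T (zl l)) j"
      and jconn: "\<And>i. i \<in> J \<Longrightarrow> connected_object U C (w i)"
      using connected_decomposition[OF T.omap_in_Obj[OF zlO[of l]]] by blast
    note ji = coproduct_inj[OF jco]
    have "\<exists>v. v \<in> Hom C (w i) (zl l) \<and> m l \<cdot> v = (\<alpha> \<cdot> amap T (m l)) \<cdot> j i" if i: "i \<in> J" for i
    proof -
      obtain k s where k: "k \<in> Kl l" and s: "s \<in> Hom C (w i) (omap T (zk k))"
        and js: "j i = amap T (d l k) \<cdot> s"
        using connected_factor[OF jconn[OF i] KlU preserves_coproductsD[OF T_preserves KlU zl] ji[OF i]]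
        by blast
      note Td = T.amap_in_Hom[OF d[OF k]] and Te = T.amap_in_Hom[OF e[OF KlK[OF k]]]
      have Te_s: "amap T (e k) \<cdot> s \<in> Hom C (w i) (omap T z)" by (rule Cmp_in_Hom[OF s Te])
      have "(\<alpha> \<cdot> amap T (m l)) \<cdot> j i = \<alpha> \<cdot> (amap T (m l) \<cdot> j i)"
        using Cmp_assoc[OF ji[OF i] Tm al] by simp
      also have "amap T (m l) \<cdot> j i = amap T (e k) \<cdot> s"
        unfolding js using Cmp_assoc[OF s Td Tm] T.amap_Cmp[OF d[OF k] m] md[OF k] by simp
      finally have 1: "(\<alpha> \<cdot> amap T (m l)) \<cdot> j i = \<alpha> \<cdot> (amap T (e k) \<cdot> s)" .
      obtain k' t where k': "k' \<in> K" and t: "t \<in> Hom C (w i) (zk k')"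
        and eq: "\<alpha> \<cdot> (amap T (e k) \<cdot> s) = e k' \<cdot> t"
        using connected_factor[OF jconn[OF i] K co Cmp_in_Hom[OF Te_s al]] by blast
      have "(k, k') \<in> r" unfolding r_def using KlK[OF k] k' jconn[OF i] s t eq by blast
      then have "q k' = q k" by (intro q_eq[symmetric]) (auto simp: E_def)
      then have k'l: "k' \<in> Kl l" using k k' by (simp add: Kl_def)
      have "m l \<cdot> (d l k' \<cdot> t) = e k' \<cdot> t"
        using Cmp_assoc[OF t d[OF k'l] m] md[OF k'l] by simp
      then show ?thesis using 1 eq Cmp_in_Hom[OF t d[OF k'l]] by (intro exI[of _ "d l k' \<cdot> t"]) simp
    qed
    then obtain v where v: "\<And>i. i \<in> J \<Longrightarrow> v i \<in> Hom C (w i) (zl l)"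
      and mv: "\<And>i. i \<in> J \<Longrightarrow> m l \<cdot> v i = (\<alpha> \<cdot> amap T (m l)) \<cdot> j i" by metis
    obtain \<beta> where b: "\<beta> \<in> Hom C (omap T (zl l)) (zl l)" and bj: "\<And>i. i \<in> J \<Longrightarrow> \<beta> \<cdot> j i = v i"
      using coproduct_copair[OF jco zlO v] by blast
    have "m l \<cdot> \<beta> = \<alpha> \<cdot> amap T (m l)"
    proof (rule coproduct_ext[OF jco Cmp_in_Hom[OF b m] Cmp_in_Hom[OF Tm al]])
      fix i assume i: "i \<in> J"
      show "(m l \<cdot> \<beta>) \<cdot> j i = (\<alpha> \<cdot> amap T (m l)) \<cdot> j i"
        using Cmp_assoc[OF ji[OF i] b m] bj[OF i] mv[OF i] by simp
    qed
    then show ?thesis using b by blast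
  qed
  then obtain \<beta> where b: "\<And>l. \<beta> l \<in> Hom C (omap T (zl l)) (zl l)"
    and mb: "\<And>l. m l \<cdot> \<beta> l = \<alpha> \<cdot> amap T (m l)" by metis
  note Tb = T.amap_in_Hom[OF b]
  have algl: "algebra (zl l) (\<beta> l)" if l: "l \<in> q ` K" for l
  proof -
    note u = unit_in[OF zlO[of l]] and mu = mult_in[OF zlO[of l]]
    have "m l \<cdot> (\<beta> l \<cdot> \<eta> (zl l)) = \<alpha> \<cdot> (amap T (m l) \<cdot> \<eta> (zl l))"
      using Cmp_assoc[OF u b m] Cmp_assoc[OF u Tm al] mb by simp
    also have "\<dots> = m l"
      using unit_natural[OF m] Cmp_assoc[OF m unit_in[OF z] al] unit Cmp_Idn_left[OF m] by simp
    also have "\<dots> = m l \<cdot> Idn C (zl l)" by (rule Cmp_Idn_right[OF m, symmetric])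
    finally have 1: "\<beta> l \<cdot> \<eta> (zl l) = Idn C (zl l)"
      by (rule mono[OF l Cmp_in_Hom[OF u b] Idn_in_Hom[OF zlO]])
    have Tmb: "amap T (m l) \<cdot> amap T (\<beta> l) = amap T (\<alpha> \<cdot> amap T (m l))"
      unfolding mb[symmetric] by (rule T.amap_Cmp[OF b m, symmetric])
    have "m l \<cdot> (\<beta> l \<cdot> amap T (\<beta> l)) = \<alpha> \<cdot> amap T (\<alpha> \<cdot> amap T (m l))"
      using Cmp_assoc[OF Tb b m, of l] Cmp_assoc[OF Tb Tm al, of l] Tmb mb[of l] by simp
    also have "\<dots> = (\<alpha> \<cdot> \<mu> z) \<cdot> amap T (amap T (m l))"
      using T.amap_Cmp[OF Tm al] Cmp_assoc[OF T.amap_in_Hom[OF Tm] T.amap_in_Hom[OF al] al] assoc by simp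
    also have "\<dots> = (\<alpha> \<cdot> amap T (m l)) \<cdot> \<mu> (zl l)"
      using Cmp_assoc[OF T.amap_in_Hom[OF Tm] mult_in[OF z] al] mult_natural[OF m]
        Cmp_assoc[OF mu Tm al] by simp
    also have "\<dots> = m l \<cdot> (\<beta> l \<cdot> \<mu> (zl l))"
      using Cmp_assoc[OF mu b m] mb[of l] by simp
    finally have 2: "\<beta> l \<cdot> amap T (\<beta> l) = \<beta> l \<cdot> \<mu> (zl l)"
      by (rule mono[OF l Cmp_in_Hom[OF Tb b] Cmp_in_Hom[OF mu b]])
    show ?thesis using 1 2 zlO b by (simp add: algebra_def)
  qed
  have "is_coproduct EM (q ` K) (\<lambda>l. (zl l, \<beta> l)) (z, \<alpha>) (\<lambda>l. ((zl l, \<beta> l), m l, (z, \<alpha>)))"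
  proof (rule EM_coproductI[OF qU])
    show "(z, \<alpha>) \<in> Obj EM" using alg by (simp add: Obj_EM)
    show "((zl l, \<beta> l), m l, (z, \<alpha>)) \<in> Hom EM (zl l, \<beta> l) (z, \<alpha>)" if "l \<in> q ` K" for l
      using algl[OF that] alg m mb by (simp add: Hom_EM_iff)
    show "is_coproduct C (q ` K) (\<lambda>l. fst (zl l, \<beta> l)) (fst (z, \<alpha>))
        (\<lambda>l. fst (snd ((zl l, \<beta> l), m l, (z, \<alpha>))))" using mco by simp
  qed
  moreover have "connected_object U EM (zl l, \<beta> l)" if l: "l \<in> q ` K" for l
  proof (rule category.connectedI[OF category_EM])
    \<comment> \<open>A label taken by \<open>q\<close> has a nonempty class. The member
      \<open>k0\<close> designates the summand through which a homomorphism will factor, and it also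
      serves to tell summands apart in the uniqueness part.\<close>
    obtain k0 where k0: "k0 \<in> Kl l" using l by (auto simp: Kl_def)
    show "(zl l, \<beta> l) \<in> Obj EM" using algl[OF l] by (simp add: Obj_EM)
    fix I :: "'i set" and b' c \<iota> assume I: "I \<in> U" and EMco: "is_coproduct EM I b' c \<iota>"
    let ?\<iota> = "\<lambda>i. fst (snd (\<iota> i))"
    note cco = EM_coproductD[OF I EMco]
    note inj = coproduct_inj[OF cco]
    have c: "snd c \<in> Hom C (omap T (fst c)) (fst c)"
      using category.coproduct_Obj[OF category_EM EMco] by (simp add: Obj_EM algebra_def)
    have ij: "\<iota> j = (b' j, ?\<iota> j, c)" "snd (b' j) \<in> Hom C (omap T (fst (b' j))) (fst (b' j))"
      "?\<iota> j \<cdot> snd (b' j) = snd c \<cdot> amap T (?\<iota> j)" "algebra (fst (b' j)) (snd (b' j))"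
      if "j \<in> I" for j
      using category.coproduct_inj[OF category_EM EMco that] by (auto simp: Hom_EM_iff algebra_def)
    {
      fix t assume "t \<in> Hom EM (zl l, \<beta> l) c"
      then obtain h where t: "t = ((zl l, \<beta> l), h, c)" and h: "h \<in> Hom C (zl l) (fst c)"
        and hb: "h \<cdot> \<beta> l = snd c \<cdot> amap T h"
        by (auto simp: Hom_EM_iff)
      \<comment> \<open>The pieces \<open>zk k\<close> are connected in \<open>C\<close>, so
        \<open>h\<close> carries each of them into one summand \<open>p k\<close>. What has to be
        shown is that \<open>p\<close> is constant on the class.\<close>
      have "\<exists>i g. i \<in> I \<and> g \<in> Hom C (zk k) (fst (b' i)) \<and> h \<cdot> d l k = ?\<iota> i \<cdot> g" if k: "k \<in> Kl l" for k
        using connected_factor[OF conn[OF KlK[OF k]] I cco Cmp_in_Hom[OF d[OF k] h]] by blast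
      then obtain p g where p: "\<And>k. k \<in> Kl l \<Longrightarrow> p k \<in> I"
        and g: "\<And>k. k \<in> Kl l \<Longrightarrow> g k \<in> Hom C (zk k) (fst (b' (p k)))"
        and hd: "\<And>k. k \<in> Kl l \<Longrightarrow> h \<cdot> d l k = ?\<iota> (p k) \<cdot> g k"
        by metis
      \<comment> \<open>A link gives a connected \<open>a\<close> with maps into
        \<open>T (zk k)\<close> and into \<open>zk k'\<close> that agree after the action. As
        \<open>h\<close> respects the actions, the resulting map from \<open>a\<close> to
        \<open>fst c\<close> factors both through summand \<open>p k\<close> and through summand
        \<open>p k'\<close>; connectedness of \<open>a\<close> identifies the two.\<close>
      have p_r: "p k = p k'" if kk: "(k, k') \<in> r" and k: "k \<in> Kl l" and k': "k' \<in> Kl l" for k k'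
      proof -
        obtain a s t where a: "connected_object U C a" and s: "s \<in> Hom C a (omap T (zk k))"
          and t: "t \<in> Hom C a (zk k')" and eq: "\<alpha> \<cdot> (amap T (e k) \<cdot> s) = e k' \<cdot> t"
          using kk by (auto simp: r_def)
        note dk = d[OF k] and dk' = d[OF k']
        note Td = T.amap_in_Hom[OF dk]
        note Tds = Cmp_in_Hom[OF s Td]
        have "m l \<cdot> (\<beta> l \<cdot> (amap T (d l k) \<cdot> s)) = \<alpha> \<cdot> (amap T (m l) \<cdot> (amap T (d l k) \<cdot> s))"
          using Cmp_assoc[OF Tds b m] Cmp_assoc[OF Tds Tm al] mb by simp
        also have "\<dots> = m l \<cdot> (d l k' \<cdot> t)"
          using Cmp_assoc[OF s Td Tm] T.amap_Cmp[OF dk m] md[OF k] md[OF k'] eq Cmp_assoc[OF t dk' m]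
          by simp
        finally have 1: "\<beta> l \<cdot> (amap T (d l k) \<cdot> s) = d l k' \<cdot> t"
          by (rule mono[OF l Cmp_in_Hom[OF Tds b] Cmp_in_Hom[OF t dk']])
        note gk = g[OF k] and pk = p[OF k] and gk' = g[OF k'] and pk' = p[OF k']
        note Tg = T.amap_in_Hom[OF gk] and Ti = T.amap_in_Hom[OF inj[OF pk]] and Th = T.amap_in_Hom[OF h]
        have "?\<iota> (p k) \<cdot> (snd (b' (p k)) \<cdot> (amap T (g k) \<cdot> s))
            = snd c \<cdot> (amap T (?\<iota> (p k)) \<cdot> (amap T (g k) \<cdot> s))"
          using Cmp_assoc[OF Cmp_in_Hom[OF s Tg] ij(2)[OF pk] inj[OF pk]] ij(3)[OF pk]
            Cmp_assoc[OF Cmp_in_Hom[OF s Tg] Ti c] by simp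
        also have "\<dots> = snd c \<cdot> (amap T (h \<cdot> d l k) \<cdot> s)"
          using Cmp_assoc[OF s Tg Ti] T.amap_Cmp[OF gk inj[OF pk]] hd[OF k] by simp
        also have "\<dots> = (h \<cdot> \<beta> l) \<cdot> (amap T (d l k) \<cdot> s)"
          using T.amap_Cmp[OF dk h] Cmp_assoc[OF s Td Th] Cmp_assoc[OF Tds Th c] hb by simp
        also have "\<dots> = ?\<iota> (p k') \<cdot> (g k' \<cdot> t)"
          using Cmp_assoc[OF Tds b h] 1 Cmp_assoc[OF t dk' h] hd[OF k'] Cmp_assoc[OF t gk' inj[OF pk']]
          by simp
        finally show ?thesis
          by (rule connected_factor_unique(1)[OF a I cco pk pk'
              Cmp_in_Hom[OF Cmp_in_Hom[OF s Tg] ij(2)[OF pk]] Cmp_in_Hom[OF t gk']])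
      qed
      \<comment> \<open>Membership in the class is part of the induction claim because
        \<open>p\<close> is controlled only on \<open>Kl l\<close>. Links are followed in both
        directions.\<close>
      have p_E: "k' \<in> Kl l \<and> p k = p k'" if "(k, k') \<in> E" and k: "k \<in> Kl l" for k k'
        using that(1) unfolding E_def
      proof (induction rule: rtrancl_induct)
        case (step y w)
        then have "w \<in> K" by (auto simp: r_def)
        moreover have "q w = q y" using step.hyps(2) by (intro q_eq) (auto simp: E_def)
        ultimately have "w \<in> Kl l" using step.IH by (simp add: Kl_def)
        then show ?case using step.hyps(2) step.IH p_r[of y w] p_r[of w y] by auto
      qed (use k in simp)
      have pk0: "p k = p k0" if "k \<in> Kl l" for k
      proof -
        have "(k, q k0) \<in> E" using q_E[of k] that k0 by (simp add: Kl_def)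
        from E_trans[OF this E_sym[OF q_E]] have "(k, k0) \<in> E" .
        from p_E[OF this that] show ?thesis by simp
      qed
      note i0 = p[OF k0]
      have "g k \<in> Hom C (zk k) (fst (b' (p k0)))" if "k \<in> Kl l" for k
        using g[OF that] pk0[OF that] by simp
      then obtain f where f: "f \<in> Hom C (zl l) (fst (b' (p k0)))" and fd: "\<And>k. k \<in> Kl l \<Longrightarrow> f \<cdot> d l k = g k"
        using coproduct_copair[OF zl Hom_Dom_Obj[OF inj[OF i0]], of l g] by blast
      have ih: "?\<iota> (p k0) \<cdot> f = h"
      proof (rule coproduct_ext[OF zl Cmp_in_Hom[OF f inj[OF i0]] h])
        fix k assume k: "k \<in> Kl l"
        show "(?\<iota> (p k0) \<cdot> f) \<cdot> d l k = h \<cdot> d l k"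
          using Cmp_assoc[OF d[OF k] f inj[OF i0]] fd[OF k] hd[OF k] pk0[OF k] by simp
      qed
      note Tf = T.amap_in_Hom[OF f] and Ti = T.amap_in_Hom[OF inj[OF i0]]
      \<comment> \<open>\<open>h\<close> and the injection both respect the actions, hence so does
        \<open>f\<close>, once the monic injection is cancelled.\<close>
      have "?\<iota> (p k0) \<cdot> (f \<cdot> \<beta> l) = snd c \<cdot> amap T h"
        using Cmp_assoc[OF b f inj[OF i0]] ih hb by simp
      also have "\<dots> = ?\<iota> (p k0) \<cdot> (snd (b' (p k0)) \<cdot> amap T f)"
        using T.amap_Cmp[OF f inj[OF i0]] ih Cmp_assoc[OF Tf Ti c] ij(3)[OF i0]
          Cmp_assoc[OF Tf ij(2)[OF i0] inj[OF i0]] by simp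
      finally have "f \<cdot> \<beta> l = snd (b' (p k0)) \<cdot> amap T f"
        by (rule injection_mono[OF I cco i0 Cmp_in_Hom[OF b f] Cmp_in_Hom[OF Tf ij(2)[OF i0]]])
      then have "((zl l, \<beta> l), f, b' (p k0)) \<in> Hom EM (zl l, \<beta> l) (b' (p k0))"
        using algl[OF l] ij(4)[OF i0] f by (simp add: Hom_EM_iff)
      moreover have "t = \<iota> (p k0) \<cdot>\<^bsub>EM\<^esub> ((zl l, \<beta> l), f, b' (p k0))"
        using t ih ij(1)[OF i0] Cmp_EM by metis
      ultimately show "\<exists>i\<in>I. \<exists>g\<in>Hom EM (zl l, \<beta> l) (b' i). t = \<iota> i \<cdot>\<^bsub>EM\<^esub> g"
        using i0 by blast
    }
    fix i j s t assume i: "i \<in> I" and j: "j \<in> I" and s: "s \<in> Hom EM (zl l, \<beta> l) (b' i)"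
      and t: "t \<in> Hom EM (zl l, \<beta> l) (b' j)" and eq: "\<iota> i \<cdot>\<^bsub>EM\<^esub> s = \<iota> j \<cdot>\<^bsub>EM\<^esub> t"
    obtain g h where gh: "s = ((zl l, \<beta> l), g, b' i)" "t = ((zl l, \<beta> l), h, b' j)"
      "g \<in> Hom C (zl l) (fst (b' i))" "h \<in> Hom C (zl l) (fst (b' j))"
      using s t by (auto simp: Hom_EM_iff)
    have eq': "?\<iota> i \<cdot> g = ?\<iota> j \<cdot> h"
      using eq ij(1)[OF i] ij(1)[OF j] gh(1,2) Cmp_EM by (metis fst_conv snd_conv)
    note dk = d[OF k0]
    \<comment> \<open>Restriction to the connected piece \<open>k0\<close> identifies the indices;
      after that the maps are compared by cancelling a single injection.\<close>
    have "?\<iota> i \<cdot> (g \<cdot> d l k0) = ?\<iota> j \<cdot> (h \<cdot> d l k0)"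
      using Cmp_assoc[OF dk gh(3) inj[OF i]] Cmp_assoc[OF dk gh(4) inj[OF j]] eq' by simp
    then have "i = j"
      by (rule connected_factor_unique(1)[OF conn[OF KlK[OF k0]] I cco i j
          Cmp_in_Hom[OF dk gh(3)] Cmp_in_Hom[OF dk gh(4)]])
    moreover from this have "g = h"
      using injection_mono[OF I cco i gh(3)] gh(4) eq' by blast
    ultimately show "i = j \<and> s = t" using gh by simp
  qed
  ultimately show ?thesis using qU by blast
qed

lemma familial_EM: "familial U EM"
proof -
  interpret E: category EM by (rule category_EM)
  show ?thesis
  proof
    fix I :: "'i set" and b assume "I \<in> U" "\<And>i. i \<in> I \<Longrightarrow> b i \<in> Obj EM"
    then show "\<exists>c \<iota>. is_coproduct EM I b c \<iota>"
      using EM_coproduct_exists[of I b] by blast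
  next
    fix x assume "x \<in> Obj EM"
    then show "\<exists>I\<in>U. \<exists>b \<iota>. is_coproduct EM I b x \<iota> \<and> (\<forall>i\<in>I. connected_object U EM (b i))"
      using EM_connected_decomposition[of "fst x" "snd x"] by (simp add: Obj_EM)
  qed
qed

end

section \<open>Monads of adjunctions and their comparison functors\<close>

locale adjunction = F: is_functor C D F + R: is_functor D C R
  for C :: "('o, 'a) cat" and D :: "('p, 'b) cat" and F R +
  fixes \<eta> \<epsilon>
  assumes adj_unit_in: "a \<in> Obj C \<Longrightarrow> \<eta> a \<in> Hom C a (omap R (omap F a))"
    and adj_unit_natural: "f \<in> Hom C a b \<Longrightarrow> amap R (amap F f) \<cdot>\<^bsub>C\<^esub> \<eta> a = \<eta> b \<cdot>\<^bsub>C\<^esub> f"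
    and counit_in: "d \<in> Obj D \<Longrightarrow> \<epsilon> d \<in> Hom D (omap F (omap R d)) d"
    and counit_natural: "g \<in> Hom D c d \<Longrightarrow> g \<cdot>\<^bsub>D\<^esub> \<epsilon> c = \<epsilon> d \<cdot>\<^bsub>D\<^esub> amap F (amap R g)"
    and triangle: "d \<in> Obj D \<Longrightarrow> amap R (\<epsilon> d) \<cdot>\<^bsub>C\<^esub> \<eta> (omap R d) = Idn C (omap R d)"
begin

abbreviation \<mu> where "\<mu> a \<equiv> amap R (\<epsilon> (omap F a))"

text \<open>Naturality of \<open>\<mu>\<close> is the image under \<open>R\<close> of the naturality
  of the counit at \<open>amap F f\<close>.\<close>

lemma familial_monadI:
  assumes "familial U C" "preserves_coproducts U C C (R \<circ>\<^sub>F F)"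
  shows "familial_monad U C (R \<circ>\<^sub>F F) \<eta> \<mu>"
proof -
  interpret familial U C by fact
  interpret T: is_functor C C "R \<circ>\<^sub>F F"
    by (rule comp_is_functor[OF F.is_functor_axioms R.is_functor_axioms])
  show ?thesis
  proof
    fix a assume a: "a \<in> Obj C"
    show "\<eta> a \<in> Hom C a (omap (R \<circ>\<^sub>F F) a)"
      using adj_unit_in[OF a] by (simp add: comp_functor_def)
    show "\<mu> a \<in> Hom C (omap (R \<circ>\<^sub>F F) (omap (R \<circ>\<^sub>F F) a)) (omap (R \<circ>\<^sub>F F) a)"
      using R.amap_in_Hom[OF counit_in[OF F.omap_in_Obj[OF a]]] by (simp add: comp_functor_def)
  next
    fix f a b assume f: "f \<in> Hom C a b"
    show "amap (R \<circ>\<^sub>F F) f \<cdot>\<^bsub>C\<^esub> \<eta> a = \<eta> b \<cdot>\<^bsub>C\<^esub> f"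
      using adj_unit_natural[OF f] by (simp add: comp_functor_def)
    note Ff = F.amap_in_Hom[OF f]
    have o: "omap F a \<in> Obj D" "omap F b \<in> Obj D"
      using F.D.Hom_Dom_Obj[OF Ff] F.D.Hom_Cod_Obj[OF Ff] .
    have "amap R (amap F f) \<cdot>\<^bsub>C\<^esub> \<mu> a = amap R (amap F f \<cdot>\<^bsub>D\<^esub> \<epsilon> (omap F a))"
      by (rule R.amap_Cmp[OF counit_in[OF o(1)] Ff, symmetric])
    also have "\<dots> = amap R (\<epsilon> (omap F b) \<cdot>\<^bsub>D\<^esub> amap F (amap R (amap F f)))"
      using counit_natural[OF Ff] by simp
    also have "\<dots> = \<mu> b \<cdot>\<^bsub>C\<^esub> amap R (amap F (amap R (amap F f)))"
      by (rule R.amap_Cmp[OF F.amap_in_Hom[OF R.amap_in_Hom[OF Ff]] counit_in[OF o(2)]])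
    finally show "amap (R \<circ>\<^sub>F F) f \<cdot>\<^bsub>C\<^esub> \<mu> a = \<mu> b \<cdot>\<^bsub>C\<^esub> amap (R \<circ>\<^sub>F F) (amap (R \<circ>\<^sub>F F) f)"
      by (simp add: comp_functor_def)
  qed (rule assms)
qed

text \<open>For the action \<open>amap R (\<epsilon> x)\<close>, associativity is the naturality of
  the counit at the arrow \<open>\<epsilon> x\<close> itself, and the unit law is the triangle
  identity. Naturality of the counit at \<open>f\<close> makes \<open>amap R f\<close> a
  homomorphism.\<close>

lemma em_comparison_functor:
  assumes "familial_monad U C (R \<circ>\<^sub>F F) \<eta> \<mu>"
  shows "is_functor D (em_category C (R \<circ>\<^sub>F F) \<eta> \<mu>) (em_comparison D R \<epsilon>)"
proof -
  interpret M: familial_monad U C "R \<circ>\<^sub>F F" \<eta> \<mu> by fact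
  interpret E: category M.EM by (rule M.category_EM)
  let ?K = "em_comparison D R \<epsilon>"
  have alg: "M.algebra (omap R x) (amap R (\<epsilon> x))" if x: "x \<in> Obj D" for x
  proof -
    note e = counit_in[OF x]
    note eFR = counit_in[OF F.omap_in_Obj[OF R.omap_in_Obj[OF x]]]
    have "amap R (\<epsilon> x) \<cdot>\<^bsub>C\<^esub> amap R (amap F (amap R (\<epsilon> x))) = amap R (\<epsilon> x \<cdot>\<^bsub>D\<^esub> amap F (amap R (\<epsilon> x)))"
      by (rule R.amap_Cmp[OF F.amap_in_Hom[OF R.amap_in_Hom[OF e]] e, symmetric])
    also have "\<dots> = amap R (\<epsilon> x \<cdot>\<^bsub>D\<^esub> \<epsilon> (omap F (omap R x)))"
      using counit_natural[OF e] by simp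
    also have "\<dots> = amap R (\<epsilon> x) \<cdot>\<^bsub>C\<^esub> \<mu> (omap R x)"
      by (rule R.amap_Cmp[OF eFR e])
    finally show ?thesis
      using triangle[OF x] R.amap_in_Hom[OF e] R.omap_in_Obj[OF x]
      unfolding M.algebra_def by (simp add: comp_functor_def)
  qed
  have mor: "amap ?K f \<in> Hom M.EM (omap ?K x) (omap ?K y)" if f: "f \<in> Hom D x y" for f x y
  proof -
    have xy: "x \<in> Obj D" "y \<in> Obj D" using f F.D.Hom_Dom_Obj F.D.Hom_Cod_Obj by blast+
    have "amap R f \<cdot>\<^bsub>C\<^esub> amap R (\<epsilon> x) = amap R (f \<cdot>\<^bsub>D\<^esub> \<epsilon> x)"
      by (rule R.amap_Cmp[OF counit_in[OF xy(1)] f, symmetric])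
    also have "\<dots> = amap R (\<epsilon> y \<cdot>\<^bsub>D\<^esub> amap F (amap R f))"
      using counit_natural[OF f] by simp
    also have "\<dots> = amap R (\<epsilon> y) \<cdot>\<^bsub>C\<^esub> amap R (amap F (amap R f))"
      by (rule R.amap_Cmp[OF F.amap_in_Hom[OF R.amap_in_Hom[OF f]] counit_in[OF xy(2)]])
    finally have 1: "amap R f \<cdot>\<^bsub>C\<^esub> amap R (\<epsilon> x) = amap R (\<epsilon> y) \<cdot>\<^bsub>C\<^esub> amap R (amap F (amap R f))" .
    have d: "Dom D f = x" "Cod D f = y" using f by (auto simp: F.D.Hom_iff)
    show ?thesis
      using 1 d alg[OF xy(1)] alg[OF xy(2)] R.amap_in_Hom[OF f]
      unfolding M.Hom_EM_iff by (simp add: em_comparison_def comp_functor_def)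
  qed
  show ?thesis
  proof
    fix x assume x: "x \<in> Obj D"
    show "omap ?K x \<in> Obj M.EM" using alg[OF x] by (simp add: em_comparison_def M.Obj_EM)
    show "amap ?K (Idn D x) = Idn M.EM (omap ?K x)"
      using x by (simp add: em_comparison_def M.EM_eq_structured structured_def)
  next
    fix f x y assume "f \<in> Hom D x y"
    then show "amap ?K f \<in> Hom M.EM (omap ?K x) (omap ?K y)" by (rule mor)
  next
    fix f g x y z assume f: "f \<in> Hom D x y" and g: "g \<in> Hom D y z"
    have d: "Dom D f = x" "Cod D f = y" "Dom D g = y" "Cod D g = z" "f \<in> Arr D" "g \<in> Arr D"
      using f g by (auto simp: F.D.Hom_iff)
    show "amap ?K (g \<cdot>\<^bsub>D\<^esub> f) = amap ?K g \<cdot>\<^bsub>M.EM\<^esub> amap ?K f"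
      using d by (simp add: em_comparison_def M.EM_eq_structured structured_def)
  qed
qed

text \<open>Coproducts of algebras are recognised on underlying objects, and there the comparison
  functor is \<open>R\<close>.\<close>

lemma em_comparison_preserves:
  assumes "familial_monad U C (R \<circ>\<^sub>F F) \<eta> \<mu>" "preserves_coproducts U D C R"
  shows "preserves_coproducts U D (em_category C (R \<circ>\<^sub>F F) \<eta> \<mu>) (em_comparison D R \<epsilon>)"
  unfolding preserves_coproducts_def
proof (intro ballI allI impI)
  interpret M: familial_monad U C "R \<circ>\<^sub>F F" \<eta> \<mu> by fact
  interpret K: is_functor D M.EM "em_comparison D R \<epsilon>" by (rule em_comparison_functor[OF assms(1)])
  let ?K = "em_comparison D R \<epsilon>"
  fix I b c \<iota> assume I: "I \<in> U" and co: "is_coproduct D I b c \<iota>"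
  note i = F.D.coproduct_inj[OF co]
  show "is_coproduct M.EM I (\<lambda>i. omap (?K) (b i)) (omap (?K) c)
      (\<lambda>i. amap (?K) (\<iota> i))"
  proof (rule M.EM_coproductI[OF I])
    show "omap (?K) c \<in> Obj M.EM"
      using F.D.coproduct_Obj[OF co] by simp
    show "amap (?K) (\<iota> j) \<in> Hom M.EM (omap (?K) (b j)) (omap (?K) c)"
      if "j \<in> I" for j
      using K.amap_in_Hom[OF i[OF that]] .
    show "is_coproduct C I (\<lambda>i. fst (omap (?K) (b i))) (fst (omap (?K) c))
      (\<lambda>i. fst (snd (amap (?K) (\<iota> i))))"
      using preserves_coproductsD[OF assms(2) I co] by (simp add: em_comparison_def)
  qed
qed

end

section \<open>Pulling back along a morphism\<close>

locale category_with_pullbacks = category C for C :: "('o, 'a) cat" (structure) +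
  assumes pullbacks_exist: "\<lbrakk>f \<in> Arr C; g \<in> Arr C; Cod C f = Cod C g\<rbrakk> \<Longrightarrow> \<exists>p q. is_pullback C f g p q"
begin

lemma is_pullback_pb:
  assumes "f \<in> Arr C" "g \<in> Arr C" "Cod C f = Cod C g"
  shows "is_pullback C f g (pb1 C f g) (pb2 C f g)"
proof -
  have "\<exists>pq. is_pullback C f g (fst pq) (snd pq)" using pullbacks_exist[OF assms] by simp
  then show ?thesis unfolding pb1_def pb2_def pb_def by (rule someI_ex)
qed

text \<open>The last equation is oriented so that the apex of a chosen pullback is always written as
  the domain of \<open>pb2\<close>, the projection that \<open>pull\<close> uses as its value on
  objects.\<close>

lemma pb_Arr [simp]:
  assumes "f \<in> Arr C" "g \<in> Arr C" "Cod C f = Cod C g"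
  shows "pb1 C f g \<in> Arr C" "pb2 C f g \<in> Arr C" "Cod C (pb1 C f g) = Dom C f"
    "Cod C (pb2 C f g) = Dom C g" "Dom C (pb1 C f g) = Dom C (pb2 C f g)"
  using is_pullback_pb[OF assms] by (auto simp: is_pullback_def)

lemma pb_commute:
  assumes "f \<in> Arr C" "g \<in> Arr C" "Cod C f = Cod C g"
  shows "f \<cdot> pb1 C f g = g \<cdot> pb2 C f g"
  using is_pullback_pb[OF assms] by (simp add: is_pullback_def)

lemma pb_ex1:
  assumes "f \<in> Arr C" "g \<in> Arr C" "Cod C f = Cod C g" "s \<in> Hom C x (Dom C f)" "t \<in> Hom C x (Dom C g)"
    "f \<cdot> s = g \<cdot> t"
  shows "\<exists>!u. u \<in> Hom C x (Dom C (pb1 C f g)) \<and> pb1 C f g \<cdot> u = s \<and> pb2 C f g \<cdot> u = t"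
  using is_pullback_pb[OF assms(1-3)] assms(4-6) unfolding is_pullback_def by blast

lemma pb_lift:
  assumes "f \<in> Arr C" "g \<in> Arr C" "Cod C f = Cod C g" "s \<in> Hom C x (Dom C f)" "t \<in> Hom C x (Dom C g)"
    "f \<cdot> s = g \<cdot> t"
  shows "pb_lift C f g s t \<in> Hom C x (Dom C (pb2 C f g))"
    "pb1 C f g \<cdot> pb_lift C f g s t = s" "pb2 C f g \<cdot> pb_lift C f g s t = t"
proof -
  have "Dom C s = x" using assms(4) by (simp add: Hom_iff)
  then have "pb_lift C f g s t \<in> Hom C x (Dom C (pb1 C f g)) \<and>
      pb1 C f g \<cdot> pb_lift C f g s t = s \<and> pb2 C f g \<cdot> pb_lift C f g s t = t"
    unfolding pb_lift_def using theI'[OF pb_ex1[OF assms]] by simp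
  then show "pb_lift C f g s t \<in> Hom C x (Dom C (pb2 C f g))"
    "pb1 C f g \<cdot> pb_lift C f g s t = s" "pb2 C f g \<cdot> pb_lift C f g s t = t"
    using assms(1-3) by simp_all
qed

lemma pb_ext:
  assumes fg: "f \<in> Arr C" "g \<in> Arr C" "Cod C f = Cod C g"
    and u: "u \<in> Hom C x (Dom C (pb2 C f g))" and v: "v \<in> Hom C x (Dom C (pb2 C f g))"
    and eq: "pb1 C f g \<cdot> u = pb1 C f g \<cdot> v" "pb2 C f g \<cdot> u = pb2 C f g \<cdot> v"
  shows "u = v"
proof -
  have p: "pb1 C f g \<in> Hom C (Dom C (pb2 C f g)) (Dom C f)" "pb2 C f g \<in> Hom C (Dom C (pb2 C f g)) (Dom C g)"
    and fH: "f \<in> Hom C (Dom C f) (Cod C g)" "g \<in> Hom C (Dom C g) (Cod C g)"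
    using fg by (simp_all add: Hom_iff)
  have "f \<cdot> (pb1 C f g \<cdot> v) = g \<cdot> (pb2 C f g \<cdot> v)"
    using Cmp_assoc[OF v p(1) fH(1)] Cmp_assoc[OF v p(2) fH(2)] pb_commute[OF fg] by simp
  from pb_ex1[OF fg Cmp_in_Hom[OF v p(1)] Cmp_in_Hom[OF v p(2)] this] show ?thesis
    using u v eq fg by auto
qed

end

section \<open>The adjunction of composition with \<open>p\<close> and pullback along
  \<open>p\<close>\<close>

locale descent = category_with_pullbacks C for C :: "('o, 'a) cat" (structure) +
  fixes p :: 'a
  assumes p: "p \<in> Arr C"
begin

abbreviation "e \<equiv> Dom C p"
abbreviation "b \<equiv> Cod C p"
abbreviation lift where "lift g h g' \<equiv> pb_lift C g' p (h \<cdot> pb1 C g p) (pb2 C g p)"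

lemma lift:
  assumes g: "g \<in> Arr C" "Cod C g = b" and g': "g' \<in> Arr C" "Cod C g' = b"
    and h: "h \<in> Hom C (Dom C g) (Dom C g')" and eq: "g' \<cdot> h = g"
  shows "lift g h g' \<in> Hom C (Dom C (pb2 C g p)) (Dom C (pb2 C g' p))"
    "pb1 C g' p \<cdot> lift g h g' = h \<cdot> pb1 C g p" "pb2 C g' p \<cdot> lift g h g' = pb2 C g p"
proof -
  have pH: "pb1 C g p \<in> Hom C (Dom C (pb2 C g p)) (Dom C g)" "pb2 C g p \<in> Hom C (Dom C (pb2 C g p)) e"
    and gH: "g' \<in> Hom C (Dom C g') b"
    using g g' p by (simp_all add: Hom_iff)
  have "g' \<cdot> (h \<cdot> pb1 C g p) = p \<cdot> pb2 C g p"
    using Cmp_assoc[OF pH(1) h gH] eq pb_commute[OF g(1) p g(2)] by simp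
  note L = pb_lift[OF g'(1) p g'(2) Cmp_in_Hom[OF pH(1) h] pH(2) this]
  show "lift g h g' \<in> Hom C (Dom C (pb2 C g p)) (Dom C (pb2 C g' p))"
    "pb1 C g' p \<cdot> lift g h g' = h \<cdot> pb1 C g p" "pb2 C g' p \<cdot> lift g h g' = pb2 C g p"
    by (rule L)+
qed

lemma push_functor: "is_functor (slice C e) (slice C b) (push C p)"
proof -
  interpret E: category "slice C e" by (rule category_slice)
  interpret B: category "slice C b" by (rule category_slice)
  show ?thesis
  proof
    fix f assume "f \<in> Obj (slice C e)"
    then have f: "f \<in> Arr C" "Cod C f = e" by (auto simp: Obj_slice)
    then show "omap (push C p) f \<in> Obj (slice C b)" using p by (simp add: push_def Obj_slice)
    show "amap (push C p) (Idn (slice C e) f) = Idn (slice C b) (omap (push C p) f)"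
      using f p by (simp add: push_def)
  next
    fix t f g assume "t \<in> Hom (slice C e) f g"
    then obtain h where t: "t = (f, h, g)" and f: "f \<in> Arr C" "Cod C f = e" and g: "g \<in> Arr C" "Cod C g = e"
      and h: "h \<in> Hom C (Dom C f) (Dom C g)" "g \<cdot> h = f"
      by (auto simp: Hom_slice_iff)
    have gH: "g \<in> Hom C (Dom C g) e" and pH: "p \<in> Hom C e b" using g p by (simp_all add: Hom_iff)
    have "(p \<cdot> g) \<cdot> h = p \<cdot> f" using Cmp_assoc[OF h(1) gH pH] h(2) by simp
    then show "amap (push C p) t \<in> Hom (slice C b) (omap (push C p) f) (omap (push C p) g)"
      using t f g h(1) p by (simp add: push_def Hom_slice_iff)
  next
    fix s t x y z assume "s \<in> Hom (slice C e) x y" "t \<in> Hom (slice C e) y z"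
    then show "amap (push C p) (t \<cdot>\<^bsub>slice C e\<^esub> s) = amap (push C p) t \<cdot>\<^bsub>slice C b\<^esub> amap (push C p) s"
      by (auto simp: push_def Hom_slice_iff)
  qed
qed

lemma pull_functor: "is_functor (slice C b) (slice C e) (pull C p)"
proof -
  interpret E: category "slice C e" by (rule category_slice)
  interpret B: category "slice C b" by (rule category_slice)
  show ?thesis
  proof
    fix g assume "g \<in> Obj (slice C b)"
    then have g: "g \<in> Arr C" "Cod C g = b" by (auto simp: Obj_slice)
    then show "omap (pull C p) g \<in> Obj (slice C e)" using p by (simp add: pull_def Obj_slice)
    have i: "Idn C (Dom C g) \<in> Hom C (Dom C g) (Dom C g)" "g \<cdot> Idn C (Dom C g) = g"
      using g Dom_in_Obj by (simp_all add: Hom_iff)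
    have P: "Dom C (pb2 C g p) \<in> Obj C" using g p by (simp add: Dom_in_Obj)
    have "lift g (Idn C (Dom C g)) g = Idn C (Dom C (pb2 C g p))"
      by (rule pb_ext[OF g(1) p g(2) lift(1)[OF g g i] Idn_in_Hom[OF P]])
         (use lift(2,3)[OF g g i] g p in simp_all)
    then show "amap (pull C p) (Idn (slice C b) g) = Idn (slice C e) (omap (pull C p) g)"
      by (simp add: pull_def)
  next
    fix t f g assume "t \<in> Hom (slice C b) f g"
    then obtain h where t: "t = (f, h, g)" and f: "f \<in> Arr C" "Cod C f = b" and g: "g \<in> Arr C" "Cod C g = b"
      and h: "h \<in> Hom C (Dom C f) (Dom C g)" "g \<cdot> h = f"
      by (auto simp: Hom_slice_iff)
    show "amap (pull C p) t \<in> Hom (slice C e) (omap (pull C p) f) (omap (pull C p) g)"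
      using t f g p lift[OF f g h] by (simp add: pull_def Hom_slice_iff)
  next
    fix s t x y z assume s: "s \<in> Hom (slice C b) x y" and t: "t \<in> Hom (slice C b) y z"
    obtain h where s': "s = (x, h, y)" and x: "x \<in> Arr C" "Cod C x = b" and y: "y \<in> Arr C" "Cod C y = b"
      and h: "h \<in> Hom C (Dom C x) (Dom C y)" "y \<cdot> h = x"
      using s by (auto simp: Hom_slice_iff)
    obtain k where t': "t = (y, k, z)" and z: "z \<in> Arr C" "Cod C z = b"
      and k: "k \<in> Hom C (Dom C y) (Dom C z)" "z \<cdot> k = y"
      using t by (auto simp: Hom_slice_iff)
    have kh: "k \<cdot> h \<in> Hom C (Dom C x) (Dom C z)" "z \<cdot> (k \<cdot> h) = x"
      using h k x y z by (auto simp: Hom_iff Cmp_reduce[OF k(2)])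
    note L = lift[OF x y h] and M = lift[OF y z k] and N = lift[OF x z kh]
    have p1: "pb1 C z p \<in> Hom C (Dom C (pb2 C z p)) (Dom C z)" "pb1 C y p \<in> Hom C (Dom C (pb2 C y p)) (Dom C y)"
      "pb1 C x p \<in> Hom C (Dom C (pb2 C x p)) (Dom C x)"
      and p2: "pb2 C z p \<in> Hom C (Dom C (pb2 C z p)) e"
      using x y z p by (simp_all add: Hom_iff)
    have "lift x (k \<cdot> h) z = lift y k z \<cdot> lift x h y"
    proof (rule pb_ext[OF z(1) p z(2) N(1) Cmp_in_Hom[OF L(1) M(1)]])
      show "pb1 C z p \<cdot> lift x (k \<cdot> h) z = pb1 C z p \<cdot> (lift y k z \<cdot> lift x h y)"
        unfolding N(2) Cmp_assoc[OF L(1) M(1) p1(1)] M(2) Cmp_assoc[OF L(1) p1(2) k(1), symmetric] L(2)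
          Cmp_assoc[OF p1(3) h(1) k(1)] ..
      show "pb2 C z p \<cdot> lift x (k \<cdot> h) z = pb2 C z p \<cdot> (lift y k z \<cdot> lift x h y)"
        unfolding N(3) Cmp_assoc[OF L(1) M(1) p2] M(3) L(3) ..
    qed
    then show "amap (pull C p) (t \<cdot>\<^bsub>slice C b\<^esub> s) = amap (pull C p) t \<cdot>\<^bsub>slice C e\<^esub> amap (pull C p) s"
      using s' t' by (simp add: pull_def)
  qed
qed

abbreviation unit_arr where "unit_arr f \<equiv> pb_lift C (p \<cdot> f) p (Idn C (Dom C f)) f"

lemma unit:
  assumes f: "f \<in> Arr C" "Cod C f = e"
  shows "unit_arr f \<in> Hom C (Dom C f) (Dom C (pb2 C (p \<cdot> f) p))"
    "pb1 C (p \<cdot> f) p \<cdot> unit_arr f = Idn C (Dom C f)"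
    "pb2 C (p \<cdot> f) p \<cdot> unit_arr f = f"
proof -
  have pf: "p \<cdot> f \<in> Arr C" "Cod C (p \<cdot> f) = b" using f p by simp_all
  have i: "Idn C (Dom C f) \<in> Hom C (Dom C f) (Dom C (p \<cdot> f))" "f \<in> Hom C (Dom C f) e"
    "(p \<cdot> f) \<cdot> Idn C (Dom C f) = p \<cdot> f"
    using f p Dom_in_Obj by (simp_all add: Hom_iff)
  note L = pb_lift[OF pf(1) p pf(2) i]
  show "unit_arr f \<in> Hom C (Dom C f) (Dom C (pb2 C (p \<cdot> f) p))"
    "pb1 C (p \<cdot> f) p \<cdot> unit_arr f = Idn C (Dom C f)"
    "pb2 C (p \<cdot> f) p \<cdot> unit_arr f = f"
    by (rule L)+
qed

text \<open>Arrows into a chosen pullback are compared on the two projections. The unit at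
  \<open>f\<close> has the components identity and \<open>f\<close>; the counit is the first
  projection.\<close>

lemma push_pull_adjunction:
  "adjunction (slice C e) (slice C b) (push C p) (pull C p) (pp_unit C p) (pp_counit C p)"
proof -
  interpret F: is_functor "slice C e" "slice C b" "push C p" by (rule push_functor)
  interpret R: is_functor "slice C b" "slice C e" "pull C p" by (rule pull_functor)
  show ?thesis
  proof
    fix f assume "f \<in> Obj (slice C e)"
    then have f: "f \<in> Arr C" "Cod C f = e" by (auto simp: Obj_slice)
    show "pp_unit C p f \<in> Hom (slice C e) f (omap (pull C p) (omap (push C p) f))"
      using f p unit[OF f] by (simp add: pp_unit_def pull_def push_def Hom_slice_iff)
  next
    fix t f g assume "t \<in> Hom (slice C e) f g"
    then obtain h where t: "t = (f, h, g)" and f: "f \<in> Arr C" "Cod C f = e" and g: "g \<in> Arr C" "Cod C g = e"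
      and h: "h \<in> Hom C (Dom C f) (Dom C g)" "g \<cdot> h = f"
      by (auto simp: Hom_slice_iff)
    have pf: "p \<cdot> f \<in> Arr C" "Cod C (p \<cdot> f) = b" and pg: "p \<cdot> g \<in> Arr C" "Cod C (p \<cdot> g) = b"
      using f g p by simp_all
    have gH: "g \<in> Hom C (Dom C g) e" and pH: "p \<in> Hom C e b" using g p by (simp_all add: Hom_iff)
    have h': "h \<in> Hom C (Dom C (p \<cdot> f)) (Dom C (p \<cdot> g))" using h(1) f g p by simp
    have h'': "(p \<cdot> g) \<cdot> h = p \<cdot> f" using Cmp_assoc[OF h(1) gH pH] h(2) by simp
    note L = lift[OF pf pg h' h''] and u = unit[OF f] and v = unit[OF g]
    have P1: "pb1 C (p \<cdot> g) p \<in> Hom C (Dom C (pb2 C (p \<cdot> g) p)) (Dom C g)"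
      "pb1 C (p \<cdot> f) p \<in> Hom C (Dom C (pb2 C (p \<cdot> f) p)) (Dom C f)"
      and P2: "pb2 C (p \<cdot> g) p \<in> Hom C (Dom C (pb2 C (p \<cdot> g) p)) e"
      using pf pg f g p by (simp_all add: Hom_iff)
    have "lift (p \<cdot> f) h (p \<cdot> g) \<cdot> unit_arr f
        = unit_arr g \<cdot> h"
    proof (rule pb_ext[OF pg(1) p pg(2) Cmp_in_Hom[OF u(1) L(1)] Cmp_in_Hom[OF h(1) v(1)]])
      show "pb1 C (p \<cdot> g) p \<cdot> (lift (p \<cdot> f) h (p \<cdot> g) \<cdot> unit_arr f)
        = pb1 C (p \<cdot> g) p \<cdot> (unit_arr g \<cdot> h)"
        unfolding Cmp_assoc[OF u(1) L(1) P1(1)] L(2) Cmp_assoc[OF u(1) P1(2) h(1), symmetric] u(2)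
          Cmp_assoc[OF h(1) v(1) P1(1)] v(2) Cmp_Idn_left[OF h(1)] Cmp_Idn_right[OF h(1)] ..
      show "pb2 C (p \<cdot> g) p \<cdot> (lift (p \<cdot> f) h (p \<cdot> g) \<cdot> unit_arr f)
        = pb2 C (p \<cdot> g) p \<cdot> (unit_arr g \<cdot> h)"
        unfolding Cmp_assoc[OF u(1) L(1) P2] L(3) u(3) Cmp_assoc[OF h(1) v(1) P2] v(3) h(2) ..
    qed
    then show "amap (pull C p) (amap (push C p) t) \<cdot>\<^bsub>slice C e\<^esub> pp_unit C p f
        = pp_unit C p g \<cdot>\<^bsub>slice C e\<^esub> t"
      using t by (simp add: pp_unit_def pull_def push_def)
  next
    fix g assume "g \<in> Obj (slice C b)"
    then have g: "g \<in> Arr C" "Cod C g = b" by (auto simp: Obj_slice)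
    have cin: "pp_counit C p g \<in> Hom (slice C b) (omap (push C p) (omap (pull C p) g)) g"
      using g p pb_commute[OF g(1) p g(2)]
      by (simp add: pp_counit_def pull_def push_def Hom_slice_iff Hom_iff)
    then show "pp_counit C p g \<in> Hom (slice C b) (omap (push C p) (omap (pull C p) g)) g" .
    let ?f = "pb2 C g p"
    have f: "?f \<in> Arr C" "Cod C ?f = e" using g p by simp_all
    have pf: "p \<cdot> ?f \<in> Arr C" "Cod C (p \<cdot> ?f) = b" using f p by simp_all
    have k: "pb1 C g p \<in> Hom C (Dom C (p \<cdot> ?f)) (Dom C g)" "g \<cdot> pb1 C g p = p \<cdot> ?f"
      using g p pb_commute[OF g(1) p g(2)] by (simp_all add: Hom_iff)
    note L = lift[OF pf g k] and u = unit[OF f]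
    have P: "Dom C (pb2 C g p) \<in> Obj C" using g p by (simp add: Dom_in_Obj)
    have P1: "pb1 C g p \<in> Hom C (Dom C ?f) (Dom C g)" "pb1 C (p \<cdot> ?f) p \<in> Hom C (Dom C (pb2 C (p \<cdot> ?f) p)) (Dom C ?f)"
      and P2: "pb2 C g p \<in> Hom C (Dom C ?f) e"
      using g p pf f by (simp_all add: Hom_iff)
    have "lift (p \<cdot> ?f) (pb1 C g p) g \<cdot> unit_arr ?f = Idn C (Dom C ?f)"
    proof (rule pb_ext[OF g(1) p g(2) Cmp_in_Hom[OF u(1) L(1)] Idn_in_Hom[OF P]])
      show "pb1 C g p \<cdot> (lift (p \<cdot> ?f) (pb1 C g p) g \<cdot> unit_arr ?f)
        = pb1 C g p \<cdot> Idn C (Dom C ?f)"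
        unfolding Cmp_assoc[OF u(1) L(1) P1(1)] L(2) Cmp_assoc[OF u(1) P1(2) P1(1), symmetric] u(2) ..
      show "pb2 C g p \<cdot> (lift (p \<cdot> ?f) (pb1 C g p) g \<cdot> unit_arr ?f)
        = pb2 C g p \<cdot> Idn C (Dom C ?f)"
        unfolding Cmp_assoc[OF u(1) L(1) P2] L(3) u(3) using f by simp
    qed
    then show "amap (pull C p) (pp_counit C p g) \<cdot>\<^bsub>slice C e\<^esub> pp_unit C p (omap (pull C p) g)
        = Idn (slice C e) (omap (pull C p) g)"
      by (simp add: pp_unit_def pp_counit_def pull_def)
  next
    fix t f g assume "t \<in> Hom (slice C b) f g"
    then obtain h where t: "t = (f, h, g)" and f: "f \<in> Arr C" "Cod C f = b" and g: "g \<in> Arr C" "Cod C g = b"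
      and h: "h \<in> Hom C (Dom C f) (Dom C g)" "g \<cdot> h = f"
      by (auto simp: Hom_slice_iff)
    show "t \<cdot>\<^bsub>slice C b\<^esub> pp_counit C p f
        = pp_counit C p g \<cdot>\<^bsub>slice C b\<^esub> amap (push C p) (amap (pull C p) t)"
      using t lift(2)[OF f g h] by (simp add: pp_counit_def pull_def push_def)
  qed
qed

text \<open>Coproducts in both slices are computed on domains, and composing with \<open>p\<close>
  leaves the domain of an arrow unchanged.\<close>

lemma push_preserves:
  assumes "familial U C"
  shows "preserves_coproducts U (slice C e) (slice C b) (push C p)"
  unfolding preserves_coproducts_def
proof (intro ballI allI impI)
  interpret familial U C by fact
  interpret F: is_functor "slice C e" "slice C b" "push C p" by (rule push_functor)
  have e: "e \<in> Obj C" using p by (rule Dom_in_Obj)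
  fix I x c \<iota> assume I: "I \<in> U" and co: "is_coproduct (slice C e) I x c \<iota>"
  note i = F.C.coproduct_inj[OF co]
  have xc: "c \<in> Arr C" "Cod C c = e" using F.C.coproduct_Obj[OF co] by (auto simp: Obj_slice)
  have xj: "x j \<in> Arr C" "Cod C (x j) = e" if "j \<in> I" for j
    using F.C.coproduct_in[OF co that] by (auto simp: Obj_slice)
  show "is_coproduct (slice C b) I (\<lambda>i. omap (push C p) (x i)) (omap (push C p) c)
      (\<lambda>i. amap (push C p) (\<iota> i))"
  proof (rule slice_coproductI)
    show "omap (push C p) c \<in> Arr C" "Cod C (omap (push C p) c) = b"
      using xc p by (simp_all add: push_def)
    show "amap (push C p) (\<iota> j) \<in> Hom (slice C b) (omap (push C p) (x j)) (omap (push C p) c)"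
      if "j \<in> I" for j
      by (rule F.amap_in_Hom[OF i[OF that]])
    have "Dom C (omap (push C p) c) = Dom C c" using xc p by (simp add: push_def)
    then show "is_coproduct C I (\<lambda>i. Dom C (omap (push C p) (x i))) (Dom C (omap (push C p) c))
        (\<lambda>i. fst (snd (amap (push C p) (\<iota> i))))"
      using coproduct_cong[OF slice_coproductD[OF e I co], of "\<lambda>i. Dom C (omap (push C p) (x i))"
         "\<lambda>i. fst (snd (amap (push C p) (\<iota> i)))"] xj p
      by (simp add: push_def case_prod_unfold)
  qed
qed

text \<open>A map into the pullback of \<open>c\<close> along \<open>p\<close> is a compatible pair.
  If it starts at a connected object, its first component chooses one summand \<open>x j\<close>,
  and together with the second component it lifts to the pullback of that summand. Thus
  \<open>coproduct_criterion\<close> applies, with test objects connected in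
  \<open>C\<close>.\<close>

lemma pull_preserves:
  assumes "familial U C"
  shows "preserves_coproducts U (slice C b) (slice C e) (pull C p)"
  unfolding preserves_coproducts_def
proof (intro ballI allI impI)
  interpret familial U C by fact
  interpret R: is_functor "slice C b" "slice C e" "pull C p" by (rule pull_functor)
  have b: "b \<in> Obj C" using p by (rule Cod_in_Obj)
  fix I x c \<iota> assume I: "I \<in> U" and co: "is_coproduct (slice C b) I x c \<iota>"
  let ?\<iota> = "\<lambda>i. fst (snd (\<iota> i))"
  let ?L = "\<lambda>i. lift (x i) (?\<iota> i) c"
  have c: "c \<in> Arr C" "Cod C c = b" using R.C.coproduct_Obj[OF co] by (auto simp: Obj_slice)
  have x: "x j \<in> Arr C" "Cod C (x j) = b" if "j \<in> I" for j
    using R.C.coproduct_in[OF co that] by (auto simp: Obj_slice)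
  have i: "\<iota> j = (x j, ?\<iota> j, c)" "?\<iota> j \<in> Hom C (Dom C (x j)) (Dom C c)" "c \<cdot> ?\<iota> j = x j" if "j \<in> I" for j
    using R.C.coproduct_inj[OF co that] by (auto simp: Hom_slice_iff)
  note cco = slice_coproductD[OF b I co]
  \<comment> \<open>Four premises of membership in \<open>I\<close> remain, one from each of the two
    parts of \<open>x\<close> and of \<open>i(2,3)\<close>; this explains the later
    \<open>OF j j j j\<close>.\<close>
  note L = lift[OF x c i(2,3)]
  have c1: "pb1 C c p \<in> Hom C (Dom C (pb2 C c p)) (Dom C c)" "pb2 C c p \<in> Hom C (Dom C (pb2 C c p)) e"
    "c \<in> Hom C (Dom C c) b" "p \<in> Hom C e b"
    using c p by (simp_all add: Hom_iff)
  have x1: "pb1 C (x j) p \<in> Hom C (Dom C (pb2 C (x j) p)) (Dom C (x j))" if "j \<in> I" for j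
    using x[OF that] p by (simp add: Hom_iff)
  have main: "is_coproduct C I (\<lambda>i. Dom C (pb2 C (x i) p)) (Dom C (pb2 C c p)) ?L"
  proof (rule coproduct_criterion)
    show "Dom C (pb2 C c p) \<in> Obj C" using c p by (simp add: Dom_in_Obj)
    show "?L i \<in> Hom C (Dom C (pb2 C (x i) p)) (Dom C (pb2 C c p))" if "i \<in> I" for i
      by (rule L(1)) fact+
    fix a assume a: "connected_object U C a"
    {
      fix f assume f: "f \<in> Hom C a (Dom C (pb2 C c p))"
      obtain j z where j: "j \<in> I" and z: "z \<in> Hom C a (Dom C (x j))" and eq: "pb1 C c p \<cdot> f = ?\<iota> j \<cdot> z"
        using connected_factor[OF a I cco Cmp_in_Hom[OF f c1(1)]] by blast
      have "x j \<cdot> z = p \<cdot> (pb2 C c p \<cdot> f)"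
        using Cmp_assoc[OF z i(2)[OF j] c1(3)] i(3)[OF j] eq[symmetric] Cmp_assoc[OF f c1(1) c1(3)]
          pb_commute[OF c(1) p c(2)] Cmp_assoc[OF f c1(2) c1(4)] by simp
      note l = pb_lift[OF x(1)[OF j] p x(2)[OF j] z Cmp_in_Hom[OF f c1(2)] this]
      have "f = ?L j \<cdot> pb_lift C (x j) p z (pb2 C c p \<cdot> f)"
      proof (rule pb_ext[OF c(1) p c(2) f Cmp_in_Hom[OF l(1) L(1)[OF j j j j]]])
        show "pb1 C c p \<cdot> f = pb1 C c p \<cdot> (?L j \<cdot> pb_lift C (x j) p z (pb2 C c p \<cdot> f))"
          unfolding Cmp_assoc[OF l(1) L(1)[OF j j j j] c1(1)] L(2)[OF j j j j]
            Cmp_assoc[OF l(1) x1[OF j] i(2)[OF j], symmetric] l(2) eq ..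
        show "pb2 C c p \<cdot> f = pb2 C c p \<cdot> (?L j \<cdot> pb_lift C (x j) p z (pb2 C c p \<cdot> f))"
          unfolding Cmp_assoc[OF l(1) L(1)[OF j j j j] c1(2)] L(3)[OF j j j j] l(3) ..
      qed
      then show "\<exists>i\<in>I. \<exists>g\<in>Hom C a (Dom C (pb2 C (x i) p)). f = ?L i \<cdot> g"
        using j l(1) by blast
    }
    fix j k g h assume j: "j \<in> I" and k: "k \<in> I" and g: "g \<in> Hom C a (Dom C (pb2 C (x j) p))"
      and h: "h \<in> Hom C a (Dom C (pb2 C (x k) p))" and eq: "?L j \<cdot> g = ?L k \<cdot> h"
    note Lj = L[OF j j j j] and Lk = L[OF k k k k]
    have "?\<iota> j \<cdot> (pb1 C (x j) p \<cdot> g) = pb1 C c p \<cdot> (?L j \<cdot> g)"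
      "?\<iota> k \<cdot> (pb1 C (x k) p \<cdot> h) = pb1 C c p \<cdot> (?L k \<cdot> h)"
      unfolding Cmp_assoc[OF g x1[OF j] i(2)[OF j]] Cmp_assoc[OF h x1[OF k] i(2)[OF k]]
        Cmp_assoc[OF g Lj(1) c1(1)] Cmp_assoc[OF h Lk(1) c1(1)] Lj(2) Lk(2) by (rule refl)+
    then have "?\<iota> j \<cdot> (pb1 C (x j) p \<cdot> g) = ?\<iota> k \<cdot> (pb1 C (x k) p \<cdot> h)"
      using eq by argo
    note jk = connected_factor_unique[OF a I cco j k Cmp_in_Hom[OF g x1[OF j]] Cmp_in_Hom[OF h x1[OF k]] this]
    have "pb2 C (x j) p \<cdot> g = pb2 C (x k) p \<cdot> h"
      using Cmp_assoc[OF g Lj(1) c1(2)] Cmp_assoc[OF h Lk(1) c1(2)] eq Lj(3) Lk(3) by argo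
    then have "g = h"
      using pb_ext[OF x(1)[OF j] p x(2)[OF j] g] h jk by blast
    then show "j = k \<and> g = h" using jk by blast
  qed
  show "is_coproduct (slice C e) I (\<lambda>i. omap (pull C p) (x i)) (omap (pull C p) c)
      (\<lambda>i. amap (pull C p) (\<iota> i))"
  proof (rule slice_coproductI)
    show "omap (pull C p) c \<in> Arr C" "Cod C (omap (pull C p) c) = e"
      using c p by (simp_all add: pull_def)
    show "amap (pull C p) (\<iota> j) \<in> Hom (slice C e) (omap (pull C p) (x j)) (omap (pull C p) c)"
      if "j \<in> I" for j
      by (rule R.amap_in_Hom[OF R.C.coproduct_inj[OF co that]])
    have "fst (snd (amap (pull C p) (\<iota> i))) = ?L i" if "i \<in> I" for i
      by (subst i(1)[OF that]) (simp add: pull_def)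
    then show "is_coproduct C I (\<lambda>i. Dom C (omap (pull C p) (x i))) (Dom C (omap (pull C p) c))
        (\<lambda>i. fst (snd (amap (pull C p) (\<iota> i))))"
      using coproduct_cong[OF main, of "\<lambda>i. Dom C (omap (pull C p) (x i))"
         "\<lambda>i. fst (snd (amap (pull C p) (\<iota> i)))"] by (simp add: pull_def)
  qed
qed

text \<open>The descent monad preserves coproducts because both of its factors \<open>push\<close>
  and \<open>pull\<close> do, so the results on Eilenberg-Moore categories apply over the slice at
  the domain of \<open>p\<close>.\<close>

lemma
  assumes "familial U C"
  shows familial_Desc: "familial U (Desc C p)"
    and comparison_functor: "is_functor (slice C b) (Desc C p) (comparison C p)"
    and comparison_preserves: "preserves_coproducts U (slice C b) (Desc C p) (comparison C p)"
proof -
  interpret familial U C by fact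
  interpret adjunction "slice C e" "slice C b" "push C p" "pull C p" "pp_unit C p" "pp_counit C p"
    by (rule push_pull_adjunction)
  have "familial_monad U (slice C e) (pull C p \<circ>\<^sub>F push C p) (pp_unit C p) \<mu>"
    using familial_monadI familial_slice[OF Dom_in_Obj[OF p]]
      preserves_coproducts_comp[OF push_preserves[OF assms] pull_preserves[OF assms]] by blast
  then show "familial U (Desc C p)" "is_functor (slice C b) (Desc C p) (comparison C p)"
    "preserves_coproducts U (slice C b) (Desc C p) (comparison C p)"
    unfolding Desc_def comparison_def
    using familial_monad.familial_EM em_comparison_functor em_comparison_preserves[OF _ pull_preserves[OF assms]]
    by blast+
qed

end

section \<open>Functors determined by their values on connected objects\<close>

context is_functor
begin

text \<open>Copairings exist by lifting those in \<open>D\<close> along the full \<open>F\<close>,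
  and they are unique because \<open>F\<close> is faithful.\<close>

lemma reflects_coproducts:
  assumes ff: "fully_faithful C D F" and c: "c \<in> Obj C" and i: "\<And>i. i \<in> I \<Longrightarrow> \<iota> i \<in> Hom C (b i) c"
    and co: "is_coproduct D I (\<lambda>i. omap F (b i)) (omap F c) (\<lambda>i. amap F (\<iota> i))"
  shows "is_coproduct C I b c \<iota>"
proof (rule C.coproductI[OF c i])
  fix x \<xi> assume x: "x \<in> Obj C" and xi: "\<And>i. i \<in> I \<Longrightarrow> \<xi> i \<in> Hom C (b i) x"
  obtain v where v: "v \<in> Hom D (omap F c) (omap F x)"
    "\<And>i. i \<in> I \<Longrightarrow> v \<cdot>\<^bsub>D\<^esub> amap F (\<iota> i) = amap F (\<xi> i)"
    using D.coproduct_copair[OF co omap_in_Obj[OF x] amap_in_Hom[OF xi]] by blast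
  obtain u where u: "u \<in> Hom C c x" "amap F u = v"
    using fully_faithful_full[OF ff c x v(1)] by blast
  have "u \<cdot>\<^bsub>C\<^esub> \<iota> j = \<xi> j" if j: "j \<in> I" for j
  proof (rule fully_faithful_faithful[OF ff C.Hom_Dom_Obj[OF i[OF j]] x C.Cmp_in_Hom[OF i[OF j] u(1)] xi[OF j]])
    show "amap F (u \<cdot>\<^bsub>C\<^esub> \<iota> j) = amap F (\<xi> j)"
      using amap_Cmp[OF i[OF j] u(1)] u(2) v(2)[OF j] by simp
  qed
  then show "\<exists>u\<in>Hom C c x. \<forall>i\<in>I. u \<cdot>\<^bsub>C\<^esub> \<iota> i = \<xi> i" using u(1) by blast
next
  fix x u v assume u: "u \<in> Hom C c x" and v: "v \<in> Hom C c x"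
    and eq: "\<And>i. i \<in> I \<Longrightarrow> u \<cdot>\<^bsub>C\<^esub> \<iota> i = v \<cdot>\<^bsub>C\<^esub> \<iota> i"
  show "u = v"
  proof (rule fully_faithful_faithful[OF ff c C.Hom_Cod_Obj[OF u] u v])
    show "amap F u = amap F v"
    proof (rule D.coproduct_ext[OF co amap_in_Hom[OF u] amap_in_Hom[OF v]])
      fix j assume j: "j \<in> I"
      show "amap F u \<cdot>\<^bsub>D\<^esub> amap F (\<iota> j) = amap F v \<cdot>\<^bsub>D\<^esub> amap F (\<iota> j)"
        using amap_Cmp[OF i[OF j] u] amap_Cmp[OF i[OF j] v] eq[OF j] by simp
    qed
  qed
qed

text \<open>Since \<open>F\<close> preserves the coproduct in question, a factorisation exists and
  is unique in \<open>D\<close>; fullness lifts it to \<open>C\<close> and faithfulness lifts its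
  uniqueness.\<close>

lemma reflects_connected:
  fixes U :: "'i set set"
  assumes ff: "fully_faithful C D F" and pres: "preserves_coproducts U C D F"
    and a: "a \<in> Obj C" and conn: "connected_object U D (omap F a)"
  shows "connected_object U C a"
proof (rule C.connectedI[OF a])
  fix I :: "'i set" and b c \<iota> assume I: "I \<in> U" and co: "is_coproduct C I b c \<iota>"
  note Fco = preserves_coproductsD[OF pres I co] and i = C.coproduct_inj[OF co]
  note c = C.coproduct_Obj[OF co]
  {
    fix f assume f: "f \<in> Hom C a c"
    obtain j g' where j: "j \<in> I" and g': "g' \<in> Hom D (omap F a) (omap F (b j))"
      and eq: "amap F f = amap F (\<iota> j) \<cdot>\<^bsub>D\<^esub> g'"
      using D.connected_factor[OF conn I Fco amap_in_Hom[OF f]] by blast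
    obtain g where g: "g \<in> Hom C a (b j)" "amap F g = g'"
      using fully_faithful_full[OF ff a C.coproduct_in[OF co j] g'] by blast
    have "f = \<iota> j \<cdot>\<^bsub>C\<^esub> g"
      by (rule fully_faithful_faithful[OF ff a c f C.Cmp_in_Hom[OF g(1) i[OF j]]])
         (use amap_Cmp[OF g(1) i[OF j]] eq g(2) in simp)
    then show "\<exists>i\<in>I. \<exists>g\<in>Hom C a (b i). f = \<iota> i \<cdot>\<^bsub>C\<^esub> g" using j g(1) by blast
  }
  fix j k g h assume j: "j \<in> I" and k: "k \<in> I" and g: "g \<in> Hom C a (b j)" and h: "h \<in> Hom C a (b k)"
    and eq: "\<iota> j \<cdot>\<^bsub>C\<^esub> g = \<iota> k \<cdot>\<^bsub>C\<^esub> h"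
  have "amap F (\<iota> j) \<cdot>\<^bsub>D\<^esub> amap F g = amap F (\<iota> k) \<cdot>\<^bsub>D\<^esub> amap F h"
    using amap_Cmp[OF g i[OF j]] amap_Cmp[OF h i[OF k]] eq by simp
  note u = D.connected_factor_unique[OF conn I Fco j k amap_in_Hom[OF g] amap_in_Hom[OF h] this]
  have "g = h"
    using fully_faithful_faithful[OF ff a C.coproduct_in[OF co j] g] h u by blast
  then show "j = k \<and> g = h" using u by blast
qed

text \<open>The test coproducts live in \<open>D\<close> and need not be images of coproducts in
  \<open>C\<close>. Each is replaced by an isomorphic one whose objects are of the form
  \<open>omap F (x d)\<close>; that one is reflected to \<open>C\<close>, where \<open>a\<close> is
  connected.\<close>

lemma equivalence_preserves_connected:
  fixes U :: "'i set set"
  assumes ff: "fully_faithful C D F" and es: "ess_surj C D F" and conn: "connected_object U C a"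
  shows "connected_object U D (omap F a)"
proof (rule D.connectedI)
  have a: "a \<in> Obj C" by (rule C.connected_Obj[OF conn])
  then show "omap F a \<in> Obj D" by simp
  fix I :: "'i set" and b c \<iota> assume I: "I \<in> U" and co: "is_coproduct D I b c \<iota>"
  note i = D.coproduct_inj[OF co]
  have "\<exists>x v v'. x \<in> Obj C \<and> v \<in> Hom D (omap F x) d \<and> v' \<in> Hom D d (omap F x)
      \<and> v' \<cdot>\<^bsub>D\<^esub> v = Idn D (omap F x) \<and> v \<cdot>\<^bsub>D\<^esub> v' = Idn D d" if "d \<in> Obj D" for d
    using es that unfolding ess_surj_def isomorphic_def by blast
  then obtain x v v' where x: "\<And>d. d \<in> Obj D \<Longrightarrow> x d \<in> Obj C"
    and v: "\<And>d. d \<in> Obj D \<Longrightarrow> v d \<in> Hom D (omap F (x d)) d"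
    and v': "\<And>d. d \<in> Obj D \<Longrightarrow> v' d \<in> Hom D d (omap F (x d))"
    and v'v: "\<And>d. d \<in> Obj D \<Longrightarrow> v' d \<cdot>\<^bsub>D\<^esub> v d = Idn D (omap F (x d))"
    and vv': "\<And>d. d \<in> Obj D \<Longrightarrow> v d \<cdot>\<^bsub>D\<^esub> v' d = Idn D d"
    by metis
  have c: "c \<in> Obj D" by (rule D.coproduct_Obj[OF co])
  note b = D.coproduct_in[OF co]
  \<comment> \<open>The injections are conjugated by the isomorphisms \<open>v\<close> to and
    \<open>v'\<close> from the chosen images, so that they run between values of \<open>F\<close>
    and can be lifted.\<close>
  let ?\<kappa> = "\<lambda>i. (v' c \<cdot>\<^bsub>D\<^esub> \<iota> i) \<cdot>\<^bsub>D\<^esub> v (b i)"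
  have co': "is_coproduct D I (\<lambda>i. omap F (x (b i))) (omap F (x c)) ?\<kappa>"
    by (rule D.coproduct_iso_components[OF D.coproduct_iso[OF co v'[OF c] v[OF c] vv'[OF c] v'v[OF c]]
          v[OF b] v'[OF b] v'v[OF b] vv'[OF b]])
  have "\<exists>k. k \<in> Hom C (x (b j)) (x c) \<and> amap F k = ?\<kappa> j" if j: "j \<in> I" for j
    using fully_faithful_full[OF ff x[OF b[OF j]] x[OF c] D.coproduct_inj[OF co' j]] by blast
  then obtain k where k: "\<And>j. j \<in> I \<Longrightarrow> k j \<in> Hom C (x (b j)) (x c)"
    and Fk: "\<And>j. j \<in> I \<Longrightarrow> amap F (k j) = ?\<kappa> j" by metis
  have kco: "is_coproduct C I (\<lambda>i. x (b i)) (x c) k"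
    by (rule reflects_coproducts[OF ff x[OF c] k D.coproduct_cong[OF co' refl]]) (simp_all add: Fk)
  note vc = v[OF c] and v'c = v'[OF c]
  \<comment> \<open>The lifted injections correspond to the given ones under the isomorphisms
    \<open>v'\<close>; with this, factorisations are moved between the two coproducts.\<close>
  have Fk_v': "amap F (k j) \<cdot>\<^bsub>D\<^esub> (v' (b j) \<cdot>\<^bsub>D\<^esub> s) = v' c \<cdot>\<^bsub>D\<^esub> (\<iota> j \<cdot>\<^bsub>D\<^esub> s)"
    if j: "j \<in> I" and s: "s \<in> Hom D y (b j)" for j s y
    using D.Cmp_reduce[OF vv'[OF b[OF j]], of s] that Fk[OF j] v[OF b[OF j]] v'[OF b[OF j]] v'c i[OF j]
    by (simp add: D.Hom_iff)
  have cancel: "s = t" if s: "s \<in> Hom D y d" and t: "t \<in> Hom D y d" and eq: "v' d \<cdot>\<^bsub>D\<^esub> s = v' d \<cdot>\<^bsub>D\<^esub> t"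
    for s t y d
  proof -
    have d: "d \<in> Obj D" using s D.Hom_Cod_Obj by blast
    have "v d \<cdot>\<^bsub>D\<^esub> (v' d \<cdot>\<^bsub>D\<^esub> s) = v d \<cdot>\<^bsub>D\<^esub> (v' d \<cdot>\<^bsub>D\<^esub> t)" using eq by simp
    then show ?thesis
      using D.Cmp_assoc[OF s v'[OF d] v[OF d]] D.Cmp_assoc[OF t v'[OF d] v[OF d]] vv'[OF d]
        D.Cmp_Idn_left[OF s] D.Cmp_Idn_left[OF t] by simp
  qed
  {
    fix f assume f: "f \<in> Hom D (omap F a) c"
    obtain g where g: "g \<in> Hom C a (x c)" "amap F g = v' c \<cdot>\<^bsub>D\<^esub> f"
      using fully_faithful_full[OF ff a x[OF c] D.Cmp_in_Hom[OF f v'c]] by blast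
    obtain j h where j: "j \<in> I" and h: "h \<in> Hom C a (x (b j))" and gh: "g = k j \<cdot>\<^bsub>C\<^esub> h"
      using C.connected_factor[OF conn I kco g(1)] by blast
    define s where "s = v (b j) \<cdot>\<^bsub>D\<^esub> amap F h"
    have s: "s \<in> Hom D (omap F a) (b j)"
      unfolding s_def by (rule D.Cmp_in_Hom[OF amap_in_Hom[OF h] v[OF b[OF j]]])
    have "v' (b j) \<cdot>\<^bsub>D\<^esub> s = amap F h"
      unfolding s_def using D.Cmp_assoc[OF amap_in_Hom[OF h] v[OF b[OF j]] v'[OF b[OF j]]]
        v'v[OF b[OF j]] D.Cmp_Idn_left[OF amap_in_Hom[OF h]] by simp
    then have "v' c \<cdot>\<^bsub>D\<^esub> f = v' c \<cdot>\<^bsub>D\<^esub> (\<iota> j \<cdot>\<^bsub>D\<^esub> s)"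
      using Fk_v'[OF j s] g(2) gh amap_Cmp[OF h k[OF j]] by simp
    then have "f = \<iota> j \<cdot>\<^bsub>D\<^esub> s" by (rule cancel[OF f D.Cmp_in_Hom[OF s i[OF j]]])
    then show "\<exists>i\<in>I. \<exists>g\<in>Hom D (omap F a) (b i). f = \<iota> i \<cdot>\<^bsub>D\<^esub> g" using j s by blast
  }
  fix j l s t assume j: "j \<in> I" and l: "l \<in> I" and s: "s \<in> Hom D (omap F a) (b j)"
    and t: "t \<in> Hom D (omap F a) (b l)" and eq: "\<iota> j \<cdot>\<^bsub>D\<^esub> s = \<iota> l \<cdot>\<^bsub>D\<^esub> t"
  obtain g where g: "g \<in> Hom C a (x (b j))" "amap F g = v' (b j) \<cdot>\<^bsub>D\<^esub> s"
    using fully_faithful_full[OF ff a x[OF b[OF j]] D.Cmp_in_Hom[OF s v'[OF b[OF j]]]] by blast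
  obtain h where h: "h \<in> Hom C a (x (b l))" "amap F h = v' (b l) \<cdot>\<^bsub>D\<^esub> t"
    using fully_faithful_full[OF ff a x[OF b[OF l]] D.Cmp_in_Hom[OF t v'[OF b[OF l]]]] by blast
  have "amap F (k j \<cdot>\<^bsub>C\<^esub> g) = amap F (k l \<cdot>\<^bsub>C\<^esub> h)"
    using amap_Cmp[OF g(1) k[OF j]] amap_Cmp[OF h(1) k[OF l]] g(2) h(2) Fk_v'[OF j s] Fk_v'[OF l t] eq
    by simp
  then have "k j \<cdot>\<^bsub>C\<^esub> g = k l \<cdot>\<^bsub>C\<^esub> h"
    by (rule fully_faithful_faithful[OF ff a x[OF c] C.Cmp_in_Hom[OF g(1) k[OF j]] C.Cmp_in_Hom[OF h(1) k[OF l]]])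
  note jl = C.connected_factor_unique[OF conn I kco j l g(1) h(1) this]
  have "s = t" using cancel[OF s] t jl g(2) h(2) by metis
  then show "j = l \<and> s = t" using jl by blast
qed

end

text \<open>The identity of \<open>c\<close> factors as \<open>\<iota> i \<cdot> s\<close>. As the
  injection is monic, its section \<open>s\<close> is also inverse on the other side.\<close>

lemma (in familial) connected_isomorphic_summand:
  assumes conn: "connected_object U C c" and I: "I \<in> U" and co: "is_coproduct C I b c \<iota>"
  obtains i where "i \<in> I" "isomorphic C (b i) c"
proof -
  have c: "c \<in> Obj C" by (rule connected_Obj[OF conn])
  obtain i s where i: "i \<in> I" and s: "s \<in> Hom C c (b i)" and eq: "Idn C c = \<iota> i \<cdot> s"
    using connected_factor[OF conn I co Idn_in_Hom[OF c]] by blast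
  note ii = coproduct_inj[OF co i]
  have b: "b i \<in> Obj C" by (rule coproduct_in[OF co i])
  have "\<iota> i \<cdot> (s \<cdot> \<iota> i) = \<iota> i \<cdot> Idn C (b i)"
    using Cmp_assoc[OF ii s ii] eq[symmetric] Cmp_Idn_left[OF ii] Cmp_Idn_right[OF ii] by simp
  then have "s \<cdot> \<iota> i = Idn C (b i)"
    by (rule injection_mono[OF I co i Cmp_in_Hom[OF ii s] Idn_in_Hom[OF b]])
  then show ?thesis using that[OF i] ii s eq unfolding isomorphic_def by metis
qed

text \<open>\<open>P\<close> may be any supply of connected objects of which every object is a
  coproduct; it need not be closed under isomorphism. Maps between coproducts of members of
  \<open>P\<close> reduce to maps between the members: the domain splits by the universal property,
  the codomain by connectedness.\<close>

lemma equivalence_from_generators: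
  fixes U :: "'i set set"
  assumes famC: "familial U C" and famD: "familial U D" and functorK: "is_functor C D K"
    and pres: "preserves_coproducts U C D K"
    and conn: "\<And>a. a \<in> P \<Longrightarrow> connected_object U C a"
    and Kconn: "\<And>a. a \<in> P \<Longrightarrow> connected_object U D (omap K a)"
    and dec: "\<And>c. c \<in> Obj C \<Longrightarrow> \<exists>I\<in>U. \<exists>b \<iota>. is_coproduct C I b c \<iota> \<and> (\<forall>i\<in>I. b i \<in> P)"
    and full: "\<And>a b h. \<lbrakk>a \<in> P; b \<in> P; h \<in> Hom D (omap K a) (omap K b)\<rbrakk> \<Longrightarrow> \<exists>f\<in>Hom C a b. amap K f = h"
    and faithful: "\<And>a b f g. \<lbrakk>a \<in> P; b \<in> P; f \<in> Hom C a b; g \<in> Hom C a b; amap K f = amap K g\<rbrakk> \<Longrightarrow> f = g"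
    and es: "\<And>d. connected_object U D d \<Longrightarrow> \<exists>a\<in>P. isomorphic D (omap K a) d"
  shows "is_equivalence C D K"
proof -
  interpret C: familial U C by fact
  interpret D: familial U D by fact
  interpret K: is_functor C D K by fact
  have PO: "a \<in> Obj C" if "a \<in> P" for a using C.connected_Obj[OF conn[OF that]] .
  \<comment> \<open>The codomain is now arbitrary. As \<open>omap K a\<close> is connected and
    \<open>K\<close> preserves the decomposition of \<open>c\<close>, the map \<open>h\<close> lands
    in one \<open>omap K (b i)\<close>, where fullness on \<open>P\<close> applies.\<close>
  have full1: "\<exists>f\<in>Hom C a c. amap K f = h"
    if a: "a \<in> P" and c: "c \<in> Obj C" and h: "h \<in> Hom D (omap K a) (omap K c)" for a c h
  proof -
    obtain I b \<iota> where I: "I \<in> U" and co: "is_coproduct C I b c \<iota>" and bP: "\<And>i. i \<in> I \<Longrightarrow> b i \<in> P"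
      using dec[OF c] by blast
    obtain i g where i: "i \<in> I" and g: "g \<in> Hom D (omap K a) (omap K (b i))" and eq: "h = amap K (\<iota> i) \<cdot>\<^bsub>D\<^esub> g"
      using D.connected_factor[OF Kconn[OF a] I preserves_coproductsD[OF pres I co] h] by blast
    obtain f where f: "f \<in> Hom C a (b i)" "amap K f = g" using full[OF a bP[OF i] g] by blast
    note ii = C.coproduct_inj[OF co i]
    show ?thesis
      using C.Cmp_in_Hom[OF f(1) ii] K.amap_Cmp[OF f(1) ii] f(2) eq by (intro bexI[of _ "\<iota> i \<cdot>\<^bsub>C\<^esub> f"]) simp_all
  qed
  have faithful1: "f = g"
    if a: "a \<in> P" and f: "f \<in> Hom C a c" and g: "g \<in> Hom C a c" and eq: "amap K f = amap K g" for a c f g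
  proof -
    obtain I b \<iota> where I: "I \<in> U" and co: "is_coproduct C I b c \<iota>" and bP: "\<And>i. i \<in> I \<Longrightarrow> b i \<in> P"
      using dec[OF C.Hom_Cod_Obj[OF f]] by blast
    note ii = C.coproduct_inj[OF co]
    obtain i s where i: "i \<in> I" and s: "s \<in> Hom C a (b i)" and fs: "f = \<iota> i \<cdot>\<^bsub>C\<^esub> s"
      using C.connected_factor[OF conn[OF a] I co f] by blast
    obtain j t where j: "j \<in> I" and t: "t \<in> Hom C a (b j)" and gt: "g = \<iota> j \<cdot>\<^bsub>C\<^esub> t"
      using C.connected_factor[OF conn[OF a] I co g] by blast
    \<comment> \<open>A priori \<open>f\<close> and \<open>g\<close> pass through different
      summands. Their common image under \<open>K\<close> factors in only one way through the
      preserved coproduct, which forces \<open>i = j\<close> and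
      \<open>amap K s = amap K t\<close>.\<close>
    have "amap K (\<iota> i) \<cdot>\<^bsub>D\<^esub> amap K s = amap K (\<iota> j) \<cdot>\<^bsub>D\<^esub> amap K t"
      using K.amap_Cmp[OF s ii[OF i]] K.amap_Cmp[OF t ii[OF j]] eq fs gt by simp
    note u = D.connected_factor_unique[OF Kconn[OF a] I preserves_coproductsD[OF pres I co] i j
        K.amap_in_Hom[OF s] K.amap_in_Hom[OF t] this]
    have "s = t" using faithful[OF a bP[OF i] s] t u by blast
    then show ?thesis using fs gt u by simp
  qed
  have ff: "fully_faithful C D K"
    unfolding fully_faithful_def bij_betw_def
  proof (intro ballI conjI)
    fix d c assume d: "d \<in> Obj C" and c: "c \<in> Obj C"
    obtain I b \<iota> where I: "I \<in> U" and co: "is_coproduct C I b d \<iota>" and bP: "\<And>i. i \<in> I \<Longrightarrow> b i \<in> P"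
      using dec[OF d] by blast
    note ii = C.coproduct_inj[OF co] and Kco = preserves_coproductsD[OF pres I co]
    show "inj_on (amap K) (Hom C d c)"
    proof (rule inj_onI)
      fix f g assume f: "f \<in> Hom C d c" and g: "g \<in> Hom C d c" and eq: "amap K f = amap K g"
      show "f = g"
      proof (rule C.coproduct_ext[OF co f g])
        fix i assume i: "i \<in> I"
        show "f \<cdot>\<^bsub>C\<^esub> \<iota> i = g \<cdot>\<^bsub>C\<^esub> \<iota> i"
          by (rule faithful1[OF bP[OF i] C.Cmp_in_Hom[OF ii[OF i] f] C.Cmp_in_Hom[OF ii[OF i] g]])
             (use K.amap_Cmp[OF ii[OF i] f] K.amap_Cmp[OF ii[OF i] g] eq in simp)
      qed
    qed
    show "amap K ` Hom C d c = Hom D (omap K d) (omap K c)"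
    proof (intro equalityI subsetI)
      fix h assume h: "h \<in> Hom D (omap K d) (omap K c)"
      \<comment> \<open>For an arbitrary domain, the restrictions of \<open>h\<close> to the
        summands are lifted one by one and the lifts are copaired.\<close>
      have "\<exists>f. f \<in> Hom C (b i) c \<and> amap K f = h \<cdot>\<^bsub>D\<^esub> amap K (\<iota> i)" if i: "i \<in> I" for i
        using full1[OF bP[OF i] c D.Cmp_in_Hom[OF K.amap_in_Hom[OF ii[OF i]] h]] by blast
      then obtain f where f: "\<And>i. i \<in> I \<Longrightarrow> f i \<in> Hom C (b i) c"
        and Kf: "\<And>i. i \<in> I \<Longrightarrow> amap K (f i) = h \<cdot>\<^bsub>D\<^esub> amap K (\<iota> i)" by metis
      obtain u where u: "u \<in> Hom C d c" "\<And>i. i \<in> I \<Longrightarrow> u \<cdot>\<^bsub>C\<^esub> \<iota> i = f i"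
        using C.coproduct_copair[OF co c f] by blast
      have "amap K u = h"
      proof (rule D.coproduct_ext[OF Kco K.amap_in_Hom[OF u(1)] h])
        fix i assume i: "i \<in> I"
        show "amap K u \<cdot>\<^bsub>D\<^esub> amap K (\<iota> i) = h \<cdot>\<^bsub>D\<^esub> amap K (\<iota> i)"
          using K.amap_Cmp[OF ii[OF i] u(1)] u(2)[OF i] Kf[OF i] by simp
      qed
      then show "h \<in> amap K ` Hom C d c" using u(1) by blast
    qed (use K.amap_in_Hom in blast)
  qed
  moreover have "ess_surj C D K"
    unfolding ess_surj_def
  proof
    fix d assume d: "d \<in> Obj D"
    obtain I b \<iota> where I: "I \<in> U" and co: "is_coproduct D I b d \<iota>"
      and bconn: "\<And>i. i \<in> I \<Longrightarrow> connected_object U D (b i)"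
      using D.connected_decomposition[OF d] by blast
    have "\<exists>a v v'. a \<in> P \<and> v \<in> Hom D (omap K a) (b i) \<and> v' \<in> Hom D (b i) (omap K a)
      \<and> v' \<cdot>\<^bsub>D\<^esub> v = Idn D (omap K a) \<and> v \<cdot>\<^bsub>D\<^esub> v' = Idn D (b i)" if "i \<in> I" for i
      using es[OF bconn[OF that]] unfolding isomorphic_def by blast
    then obtain a v v' where a: "\<And>i. i \<in> I \<Longrightarrow> a i \<in> P"
      and v: "\<And>i. i \<in> I \<Longrightarrow> v i \<in> Hom D (omap K (a i)) (b i)"
      and v': "\<And>i. i \<in> I \<Longrightarrow> v' i \<in> Hom D (b i) (omap K (a i))"
      and v'v: "\<And>i. i \<in> I \<Longrightarrow> v' i \<cdot>\<^bsub>D\<^esub> v i = Idn D (omap K (a i))"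
      and vv': "\<And>i. i \<in> I \<Longrightarrow> v i \<cdot>\<^bsub>D\<^esub> v' i = Idn D (b i)"
      by metis
    \<comment> \<open>Replacing each connected summand of \<open>d\<close> by an isomorphic value of
      \<open>K\<close> presents \<open>d\<close> as a coproduct of the \<open>omap K (a i)\<close>.
      The image under \<open>K\<close> of a coproduct of the \<open>a i\<close> is another, so the
      two are isomorphic.\<close>
    note co' = D.coproduct_iso_components[OF co v v' v'v vv']
    obtain c \<kappa> where cco: "is_coproduct C I a c \<kappa>"
      using C.coproducts_exist[OF I, of a] PO[OF a] by blast
    obtain w w' where "w \<in> Hom D (omap K c) d" "w' \<in> Hom D d (omap K c)"
      "w' \<cdot>\<^bsub>D\<^esub> w = Idn D (omap K c)" "w \<cdot>\<^bsub>D\<^esub> w' = Idn D d"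
      using D.coproduct_unique[OF preserves_coproductsD[OF pres I cco] co'] by blast
    then show "\<exists>c\<in>Obj C. isomorphic D (omap K c) d"
      using C.coproduct_Obj[OF cco] unfolding isomorphic_def by blast
  qed
  ultimately show ?thesis by (rule K.equivalenceI)
qed

section \<open>Full subcategories\<close>

lemma Hom_full_subcategory:
  "Hom (full_subcategory C P) a b = {f \<in> Hom C a b. P a \<and> P b}"
  by (auto simp: Hom_def full_subcategory_def)

lemma full_subcategory_simps [simp]:
  "Obj (full_subcategory C P) = {a \<in> Obj C. P a}"
  "Dom (full_subcategory C P) = Dom C" "Cod (full_subcategory C P) = Cod C"
  "Idn (full_subcategory C P) = Idn C" "Cmp (full_subcategory C P) = Cmp C"
  by (simp_all add: full_subcategory_def)

lemma (in category) category_full_subcategory: "category (full_subcategory C P)"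
proof
  fix f assume "f \<in> Arr (full_subcategory C P)"
  then show "Dom (full_subcategory C P) f \<in> Obj (full_subcategory C P)"
    "Cod (full_subcategory C P) f \<in> Obj (full_subcategory C P)"
    using Dom_in_Obj Cod_in_Obj by (auto simp: full_subcategory_def)
qed (auto simp: Hom_full_subcategory intro: Idn_in_Hom Cmp_in_Hom Cmp_Idn_left Cmp_Idn_right Cmp_assoc)

lemma isomorphic_full_subcategory:
  "P a \<Longrightarrow> P b \<Longrightarrow> isomorphic (full_subcategory C P) a b \<longleftrightarrow> isomorphic C a b"
  by (simp add: isomorphic_def Hom_full_subcategory)

lemma (in is_functor) functor_to_full_subcategory:
  assumes "\<And>a. a \<in> Obj C \<Longrightarrow> P (omap F a)"
  shows "is_functor C (full_subcategory D P) F"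
proof -
  interpret S: category "full_subcategory D P" by (rule D.category_full_subcategory)
  show ?thesis
  proof
    fix f a b assume f: "f \<in> Hom C a b"
    then show "amap F f \<in> Hom (full_subcategory D P) (omap F a) (omap F b)"
      using amap_in_Hom[OF f] assms[OF C.Hom_Dom_Obj[OF f]] assms[OF C.Hom_Cod_Obj[OF f]]
      by (simp add: Hom_full_subcategory)
  qed (use assms amap_Cmp in auto)
qed

section \<open>Pullbacks from finite limits\<close>

text \<open>The shape \<open>0 -> 2 <- 1\<close>: arrows 0, 1, 2 are the identities, 3 goes from 0
  to 2 and 4 from 1 to 2, so \<open>min k 2\<close> is the codomain in every case. Of two composable
  arrows at least one is an identity, which the composition formula exploits.\<close>

definition cospan_category :: "(nat, nat) cat" where
  "cospan_category = \<lparr>Obj = {0, 1, 2}, Arr = {0, 1, 2, 3, 4},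
     Dom = (\<lambda>k. if k = 3 then 0 else if k = 4 then 1 else k), Cod = (\<lambda>k. min k 2),
     Idn = (\<lambda>k. k), Cmp = (\<lambda>k l. if k \<le> 2 then l else k)\<rparr>"

lemma category_cospan: "category cospan_category"
  by unfold_locales (auto simp: cospan_category_def Hom_def min_def split: if_splits)

context category
begin

lemma cospan_functor:
  assumes "f \<in> Arr C" "g \<in> Arr C" "Cod C f = Cod C g"
  defines "ob \<equiv> \<lambda>k :: nat. if k = 0 then Dom C f else if k = 1 then Dom C g else Cod C f"
  shows "is_functor cospan_category C \<lparr>omap = ob, amap = \<lambda>k. if k = 3 then f else if k = 4 then g else Idn C (ob k)\<rparr>"
    (is "is_functor _ _ ?F")
proof -
  interpret J: category cospan_category by (rule category_cospan)
  have ob: "ob k \<in> Obj C" for k using assms Dom_in_Obj Cod_in_Obj by (simp add: ob_def)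
  show ?thesis
  proof
    fix k a b assume "k \<in> Hom cospan_category a b"
    then have "k \<in> {0, 1, 2, 3, 4}" "a = (if k = 3 then 0 else if k = 4 then 1 else k)" "b = min k 2"
      by (auto simp: cospan_category_def Hom_def)
    then show "amap ?F k \<in> Hom C (omap ?F a) (omap ?F b)"
      using assms(1-3) ob by (auto simp: Hom_iff min_def) (auto simp: ob_def)
  next
    fix k l a b c assume "k \<in> Hom cospan_category a b" "l \<in> Hom cospan_category b c"
    then have "k \<in> {0, 1, 2, 3, 4}" "l \<in> {0, 1, 2, 3, 4}"
      "(if l = 3 then 0 else if l = 4 then 1 else l) = min k 2"
      by (auto simp: cospan_category_def Hom_def)
    then show "amap ?F (l \<cdot>\<^bsub>cospan_category\<^esub> k) = amap ?F l \<cdot> amap ?F k"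
      using assms(1-3) ob by (auto simp: cospan_category_def min_def split: if_splits) (auto simp: ob_def)
  qed (use ob in \<open>auto simp: cospan_category_def\<close>)
qed

lemma pullback_from_limits:
  assumes lim: "has_finite_limits C" and f: "f \<in> Arr C" and g: "g \<in> Arr C" and fg: "Cod C f = Cod C g"
  shows "\<exists>p q. is_pullback C f g p q"
proof -
  define ob where "ob = (\<lambda>k :: nat. if k = 0 then Dom C f else if k = 1 then Dom C g else Cod C f)"
  define D where "D = \<lparr>omap = ob, amap = \<lambda>k :: nat. if k = 3 then f else if k = 4 then g else Idn C (ob k)\<rparr>"
  have D: "is_functor cospan_category C D"
    unfolding D_def ob_def by (rule cospan_functor[OF f g fg])
  have "finite (Obj cospan_category)" "finite (Arr cospan_category)" by (simp_all add: cospan_category_def)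
  then obtain l \<pi> where l: "is_limit cospan_category C D l \<pi>"
    using lim D unfolding has_finite_limits_def by blast
  have cone_iff: "is_cone cospan_category C D x \<xi> \<longleftrightarrow> x \<in> Obj C \<and> \<xi> 0 \<in> Hom C x (Dom C f) \<and>
      \<xi> 1 \<in> Hom C x (Dom C g) \<and> \<xi> 2 \<in> Hom C x (Cod C f) \<and> f \<cdot> \<xi> 0 = \<xi> 2 \<and> g \<cdot> \<xi> 1 = \<xi> 2" for x \<xi>
    using f g fg by (auto simp: is_cone_def cospan_category_def D_def ob_def Hom_iff Dom_in_Obj Cod_in_Obj)
  have pi: "\<pi> 0 \<in> Hom C l (Dom C f)" "\<pi> 1 \<in> Hom C l (Dom C g)" "f \<cdot> \<pi> 0 = \<pi> 2" "g \<cdot> \<pi> 1 = \<pi> 2"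
    using l by (simp_all add: is_limit_def cone_iff)
  have univ: "\<exists>!u. u \<in> Hom C x l \<and> \<pi> 0 \<cdot> u = s \<and> \<pi> 1 \<cdot> u = t"
    if s: "s \<in> Hom C x (Dom C f)" and t: "t \<in> Hom C x (Dom C g)" and eq: "f \<cdot> s = g \<cdot> t" for x s t
  proof -
    \<comment> \<open>The leg at the corner is the common composite, so that a commuting pair
      \<open>s\<close>, \<open>t\<close> becomes a cone.\<close>
    define \<xi> where "\<xi> = (\<lambda>k :: nat. if k = 0 then s else if k = 1 then t else f \<cdot> s)"
    have "is_cone cospan_category C D x \<xi>"
      using s t eq f g fg Hom_Dom_Obj[OF s] by (simp add: cone_iff \<xi>_def Hom_iff)
    then have ex1: "\<exists>!u. u \<in> Hom C x l \<and> (\<forall>j\<in>Obj cospan_category. \<pi> j \<cdot> u = \<xi> j)"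
      using l by (simp add: is_limit_def)
    have "(u \<in> Hom C x l \<and> (\<forall>j\<in>Obj cospan_category. \<pi> j \<cdot> u = \<xi> j))
        \<longleftrightarrow> (u \<in> Hom C x l \<and> \<pi> 0 \<cdot> u = s \<and> \<pi> 1 \<cdot> u = t)" for u
    proof (cases "u \<in> Hom C x l")
      case True
      have "\<pi> 2 \<cdot> u = f \<cdot> (\<pi> 0 \<cdot> u)"
        using Cmp_assoc[OF True pi(1) Arr_Hom[OF f]] pi(3) by simp
      then show ?thesis by (auto simp: cospan_category_def \<xi>_def)
    qed simp
    then show ?thesis using ex1 by simp
  qed
  have "is_pullback C f g (\<pi> 0) (\<pi> 1)"
    unfolding is_pullback_def
  proof (intro conjI allI ballI impI)
    show "\<exists>!u. u \<in> Hom C x (Dom C (\<pi> 0)) \<and> \<pi> 0 \<cdot> u = s \<and> \<pi> 1 \<cdot> u = t"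
      if "s \<in> Hom C x (Dom C f)" "t \<in> Hom C x (Dom C g)" "f \<cdot> s = g \<cdot> t" for x s t
      using univ[OF that] pi(1) by (simp add: Hom_iff)
  qed (use pi f g fg in \<open>auto simp: Hom_iff\<close>)
  then show ?thesis by blast
qed

end

section \<open>The free coproduct completion\<close>

locale free_completion = universe U + V: category V
  for U :: "'i set set" and V :: "('o, 'a) cat"
begin

abbreviation \<F> where "\<F> \<equiv> Fam U V"

abbreviation Fam_Cmp (infixr "\<odot>" 70) where "t \<odot> s \<equiv> t \<cdot>\<^bsub>\<F>\<^esub> s"

definition idx :: "('i, 'o, 'a) fam_arr \<Rightarrow> 'i \<Rightarrow> 'i" where
  "idx t = fst (fst (snd t))"

definition cmp :: "('i, 'o, 'a) fam_arr \<Rightarrow> 'i \<Rightarrow> 'a" where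
  "cmp t = snd (fst (snd t))"

text \<open>Restricting both components to the index set keeps the arrow extensional, so
  \<open>f\<close> and \<open>\<phi>\<close> may be given by total functions.\<close>

definition mk_arr :: "('i, 'o) fam \<Rightarrow> ('i \<Rightarrow> 'i) \<Rightarrow> ('i \<Rightarrow> 'a) \<Rightarrow> ('i, 'o) fam \<Rightarrow> ('i, 'o, 'a) fam_arr" where
  "mk_arr A f \<phi> B = (A, (restrict f (fst A), restrict \<phi> (fst A)), B)"

lemma Obj_Fam: "A \<in> Obj \<F> \<longleftrightarrow> fst A \<in> U \<and> snd A \<in> fst A \<rightarrow>\<^sub>E Obj V"
  by (cases A) (simp add: Fam_def)

lemma Obj_FamD: "A \<in> Obj \<F> \<Longrightarrow> j \<in> fst A \<Longrightarrow> snd A j \<in> Obj V"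
  by (auto simp: Obj_Fam)

lemma Hom_Fam: "t \<in> Hom \<F> A B \<longleftrightarrow> fst t = A \<and> snd (snd t) = B \<and> A \<in> Obj \<F> \<and> B \<in> Obj \<F> \<and>
    idx t \<in> fst A \<rightarrow>\<^sub>E fst B \<and> cmp t \<in> (\<Pi>\<^sub>E j\<in>fst A. Hom V (snd A j) (snd B (idx t j)))"
  by (cases t; cases A; cases B) (auto simp: Hom_def Fam_def idx_def cmp_def)

lemma idx_in: "t \<in> Hom \<F> A B \<Longrightarrow> j \<in> fst A \<Longrightarrow> idx t j \<in> fst B"
  by (auto simp: Hom_Fam)

lemma cmp_in: "t \<in> Hom \<F> A B \<Longrightarrow> j \<in> fst A \<Longrightarrow> cmp t j \<in> Hom V (snd A j) (snd B (idx t j))"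
  by (auto simp: Hom_Fam)

text \<open>Both functions are extensional, so agreement on the index set suffices. The reindexing
  is settled first because the codomains of the components depend on it.\<close>

lemma Fam_ext:
  assumes s: "s \<in> Hom \<F> A B" and t: "t \<in> Hom \<F> A B"
    and "\<And>j. j \<in> fst A \<Longrightarrow> idx s j = idx t j" "\<And>j. j \<in> fst A \<Longrightarrow> cmp s j = cmp t j"
  shows "s = t"
proof -
  have "idx s = idx t"
    using s t assms(3) by (intro PiE_ext[of "idx s" "fst A" "\<lambda>_. fst B" "idx t"]) (auto simp: Hom_Fam)
  moreover have "cmp s = cmp t"
    using s t assms(4) calculation
    by (intro PiE_ext[of "cmp s" "fst A" "\<lambda>j. Hom V (snd A j) (snd B (idx t j))" "cmp t"]) (auto simp: Hom_Fam)
  ultimately show ?thesis using s t by (auto simp: Hom_Fam idx_def cmp_def prod_eq_iff)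
qed

lemma mk_arr_in:
  assumes "A \<in> Obj \<F>" "B \<in> Obj \<F>" "\<And>j. j \<in> fst A \<Longrightarrow> f j \<in> fst B"
    "\<And>j. j \<in> fst A \<Longrightarrow> \<phi> j \<in> Hom V (snd A j) (snd B (f j))"
  shows "mk_arr A f \<phi> B \<in> Hom \<F> A B"
  using assms by (auto simp: Hom_Fam mk_arr_def idx_def cmp_def)

lemma mk_arr_simps [simp]:
  "j \<in> fst A \<Longrightarrow> idx (mk_arr A f \<phi> B) j = f j" "j \<in> fst A \<Longrightarrow> cmp (mk_arr A f \<phi> B) j = \<phi> j"
  by (simp_all add: mk_arr_def idx_def cmp_def)

lemma Cmp_Fam:
  assumes "s \<in> Hom \<F> A B"
  shows "t \<odot> s = mk_arr A (\<lambda>j. idx t (idx s j)) (\<lambda>j. cmp t (idx s j) \<cdot>\<^bsub>V\<^esub> cmp s j) (snd (snd t))"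
  using assms by (cases s; cases t; cases A) (auto simp: Fam_def mk_arr_def idx_def cmp_def Hom_def)

lemma Cmp_Fam_in:
  assumes s: "s \<in> Hom \<F> A B" and t: "t \<in> Hom \<F> B C"
  shows "t \<odot> s \<in> Hom \<F> A C"
  unfolding Cmp_Fam[OF s]
proof -
  have "snd (snd t) = C" "A \<in> Obj \<F>" "C \<in> Obj \<F>" using s t by (auto simp: Hom_Fam)
  then show "mk_arr A (\<lambda>j. idx t (idx s j)) (\<lambda>j. cmp t (idx s j) \<cdot>\<^bsub>V\<^esub> cmp s j) (snd (snd t)) \<in> Hom \<F> A C"
    using idx_in[OF t idx_in[OF s]] V.Cmp_in_Hom[OF cmp_in[OF s] cmp_in[OF t idx_in[OF s]]]
    by (auto intro: mk_arr_in)
qed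

lemma idx_Cmp [simp]: "s \<in> Hom \<F> A B \<Longrightarrow> j \<in> fst A \<Longrightarrow> idx (t \<odot> s) j = idx t (idx s j)"
  by (simp add: Cmp_Fam)

lemma cmp_Cmp [simp]:
  "s \<in> Hom \<F> A B \<Longrightarrow> j \<in> fst A \<Longrightarrow> cmp (t \<odot> s) j = cmp t (idx s j) \<cdot>\<^bsub>V\<^esub> cmp s j"
  by (simp add: Cmp_Fam)

lemma Idn_Fam: "Idn \<F> A = mk_arr A (\<lambda>j. j) (\<lambda>j. Idn V (snd A j)) A"
  by (cases A) (simp add: Fam_def mk_arr_def)

lemma Idn_Fam_in: "A \<in> Obj \<F> \<Longrightarrow> Idn \<F> A \<in> Hom \<F> A A"
  unfolding Idn_Fam by (rule mk_arr_in) (auto intro: V.Idn_in_Hom Obj_FamD)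

lemma category_Fam: "category \<F>"
proof
  fix f assume "f \<in> Arr \<F>"
  then show "Dom \<F> f \<in> Obj \<F>" "Cod \<F> f \<in> Obj \<F>" by (auto simp: Fam_def)
next
  fix A assume "A \<in> Obj \<F>"
  then show "Idn \<F> A \<in> Hom \<F> A A" by (rule Idn_Fam_in)
next
  fix s A B t C assume "s \<in> Hom \<F> A B" "t \<in> Hom \<F> B C"
  then show "t \<odot> s \<in> Hom \<F> A C" by (rule Cmp_Fam_in)
next
  fix s A B assume s: "s \<in> Hom \<F> A B"
  then have o: "A \<in> Obj \<F>" "B \<in> Obj \<F>" by (auto simp: Hom_Fam)
  show "Idn \<F> B \<odot> s = s"
    by (rule Fam_ext[OF Cmp_Fam_in[OF s Idn_Fam_in[OF o(2)]] s])
       (use s idx_in[OF s] V.Cmp_Idn_left[OF cmp_in[OF s]] in \<open>auto simp: Idn_Fam\<close>)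
  show "s \<odot> Idn \<F> A = s"
    by (rule Fam_ext[OF Cmp_Fam_in[OF Idn_Fam_in[OF o(1)] s] s])
       (use Idn_Fam_in[OF o(1)] V.Cmp_Idn_right[OF cmp_in[OF s]] in \<open>simp_all add: idx_Cmp cmp_Cmp\<close>,
        simp_all add: Idn_Fam)
next
  fix s A B t C r D assume s: "s \<in> Hom \<F> A B" and t: "t \<in> Hom \<F> B C" and r: "r \<in> Hom \<F> C D"
  note ts = Cmp_Fam_in[OF s t] and rt = Cmp_Fam_in[OF t r]
  show "r \<odot> (t \<odot> s) = (r \<odot> t) \<odot> s"
  proof (rule Fam_ext[OF Cmp_Fam_in[OF ts r] Cmp_Fam_in[OF s rt]])
    fix j assume j: "j \<in> fst A"
    note sj = idx_in[OF s j]
    note tj = idx_in[OF t sj]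
    show "idx (r \<odot> (t \<odot> s)) j = idx ((r \<odot> t) \<odot> s) j"
      by (simp add: idx_Cmp[OF ts j] idx_Cmp[OF s j] idx_Cmp[OF t sj])
    show "cmp (r \<odot> (t \<odot> s)) j = cmp ((r \<odot> t) \<odot> s) j"
      using V.Cmp_assoc[OF cmp_in[OF s j] cmp_in[OF t sj] cmp_in[OF r tj]]
      by (simp add: cmp_Cmp[OF ts j] cmp_Cmp[OF s j] cmp_Cmp[OF t sj] idx_Cmp[OF s j])
  qed
qed

sublocale F: category \<F> by (rule category_Fam)

lemma single_Obj: "x \<in> Obj V \<Longrightarrow> single i0 x \<in> Obj \<F>"
  using singleton_in by (simp add: Obj_Fam single_def)

lemma single_simps [simp]: "fst (single i0 x) = {i0}" "snd (single i0 x) i0 = x"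
  by (simp_all add: single_def)

lemma mk_point_in:
  assumes "A \<in> Obj \<F>" "j \<in> fst A" "h \<in> Hom V x (snd A j)"
  shows "mk_arr (single i0 x) (\<lambda>_. j) (\<lambda>_. h) A \<in> Hom \<F> (single i0 x) A"
  by (rule mk_arr_in) (use assms V.Hom_Dom_Obj in \<open>auto intro: single_Obj\<close>)

text \<open>Member \<open>j\<close> is embedded at index \<open>j\<close> by an identity. A map out
  of \<open>A\<close> amounts to an index and a component for each \<open>j\<close>, which is the
  data of one map out of each one-member family.\<close>

lemma single_coproduct:
  assumes A: "A \<in> Obj \<F>"
  shows "is_coproduct \<F> (fst A) (\<lambda>j. single i0 (snd A j)) A
    (\<lambda>j. mk_arr (single i0 (snd A j)) (\<lambda>_. j) (\<lambda>_. Idn V (snd A j)) A)"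
    (is "is_coproduct _ _ _ _ ?\<iota>")
proof (rule F.coproductI[OF A])
  have i: "?\<iota> j \<in> Hom \<F> (single i0 (snd A j)) A" if "j \<in> fst A" for j
    by (rule mk_point_in[OF A that V.Idn_in_Hom[OF Obj_FamD[OF A that]]])
  then show "?\<iota> j \<in> Hom \<F> (single i0 (snd A j)) A" if "j \<in> fst A" for j using that .
  {
    fix B \<xi> assume B: "B \<in> Obj \<F>" and xi: "\<And>j. j \<in> fst A \<Longrightarrow> \<xi> j \<in> Hom \<F> (single i0 (snd A j)) B"
    let ?u = "mk_arr A (\<lambda>j. idx (\<xi> j) i0) (\<lambda>j. cmp (\<xi> j) i0) B"
    have u: "?u \<in> Hom \<F> A B"
      using idx_in[OF xi, of _ i0] cmp_in[OF xi, of _ i0] by (intro mk_arr_in A B) simp_all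
    have "?u \<odot> ?\<iota> j = \<xi> j" if j: "j \<in> fst A" for j
    proof (rule Fam_ext[OF Cmp_Fam_in[OF i[OF j] u] xi[OF j]])
      fix k assume k: "k \<in> fst (single i0 (snd A j))"
      then have k0: "k = i0" by simp
      show "idx (?u \<odot> ?\<iota> j) k = idx (\<xi> j) k"
        unfolding idx_Cmp[OF i[OF j] k] using j k0 by simp
      have "cmp (\<xi> j) i0 \<in> Hom V (snd A j) (snd B (idx (\<xi> j) i0))" using cmp_in[OF xi[OF j], of i0] by simp
      from V.Cmp_Idn_right[OF this] show "cmp (?u \<odot> ?\<iota> j) k = cmp (\<xi> j) k"
        unfolding cmp_Cmp[OF i[OF j] k] using j k0 by simp
    qed
    then show "\<exists>u\<in>Hom \<F> A B. \<forall>j\<in>fst A. u \<odot> ?\<iota> j = \<xi> j" using u by blast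
  }
  fix B u v assume u: "u \<in> Hom \<F> A B" and v: "v \<in> Hom \<F> A B"
    and eq: "\<And>j. j \<in> fst A \<Longrightarrow> u \<odot> ?\<iota> j = v \<odot> ?\<iota> j"
  have k: "idx (u \<odot> ?\<iota> j) i0 = idx u j \<and> cmp (u \<odot> ?\<iota> j) i0 = cmp u j"
    if "j \<in> fst A" "u \<in> Hom \<F> A B" for u j
    using V.Cmp_Idn_right[OF cmp_in[OF that(2,1)]]
    by (simp add: idx_Cmp[OF i[OF that(1)]] cmp_Cmp[OF i[OF that(1)]])
  show "u = v"
    by (rule Fam_ext[OF u v]) (metis k eq u v)+
qed

text \<open>The index set should be the disjoint union of the index sets of the \<open>b i\<close>,
  whose elements are pairs and not elements of \<open>'i\<close>; \<open>Sigma_in\<close> supplies a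
  copy \<open>S\<close> of it in \<open>U\<close>. The second conclusion is connectedness of
  one-member families, tested on this concrete coproduct.\<close>

lemma Fam_coproduct_exists:
  assumes I: "I \<in> U" and b: "\<And>i. i \<in> I \<Longrightarrow> b i \<in> Obj \<F>"
  obtains c \<iota> where "is_coproduct \<F> I b c \<iota>"
    "bij_betw (\<lambda>(i, g). \<iota> i \<odot> g) (SIGMA i:I. Hom \<F> (single i0 x) (b i)) (Hom \<F> (single i0 x) c)"
proof -
  have "\<exists>S \<in> U. \<exists>h. bij_betw h (Sigma I (\<lambda>i. fst (b i))) S"
    by (rule Sigma_in[OF I]) (use b in \<open>auto simp: Obj_Fam\<close>)
  then obtain S h where S: "S \<in> U" and h: "bij_betw h (Sigma I (\<lambda>i. fst (b i))) S" by blast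
  \<comment> \<open>\<open>k\<close> decodes an element of \<open>S\<close> into a summand and an
    index within that summand.\<close>
  define k where "k = inv_into (Sigma I (\<lambda>i. fst (b i))) h"
  have hk: "h (k s) = s" "fst (k s) \<in> I" "snd (k s) \<in> fst (b (fst (k s)))" if "s \<in> S" for s
  proof -
    have "s \<in> h ` Sigma I (\<lambda>i. fst (b i))" using h that by (simp add: bij_betw_def)
    from f_inv_into_f[OF this] inv_into_into[OF this]
    show "h (k s) = s" "fst (k s) \<in> I" "snd (k s) \<in> fst (b (fst (k s)))" by (auto simp: k_def)
  qed
  have kh: "k (h (i, j)) = (i, j)" "h (i, j) \<in> S" if "i \<in> I" "j \<in> fst (b i)" for i j
    using h that by (auto simp: k_def bij_betw_def inv_into_f_f)
  define c where "c = (S, \<lambda>s\<in>S. snd (b (fst (k s))) (snd (k s)))"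
  have c: "c \<in> Obj \<F>" using S hk Obj_FamD[OF b] by (auto simp: Obj_Fam c_def)
  have fc: "fst c = S" and sc: "\<And>s. s \<in> S \<Longrightarrow> snd c s = snd (b (fst (k s))) (snd (k s))"
    by (simp_all add: c_def)
  define \<iota> where "\<iota> i = mk_arr (b i) (\<lambda>j. h (i, j)) (\<lambda>j. Idn V (snd (b i) j)) c" for i
  have i: "\<iota> i \<in> Hom \<F> (b i) c" if "i \<in> I" for i
    unfolding \<iota>_def by (rule mk_arr_in[OF b[OF that] c])
      (use kh that V.Idn_in_Hom[OF Obj_FamD[OF b[OF that]]] in \<open>auto simp: fc sc\<close>)
  have ii: "idx (\<iota> i) j = h (i, j)" "cmp (\<iota> i) j = Idn V (snd (b i) j)" if "j \<in> fst (b i)" for i j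
    using that by (simp_all add: \<iota>_def)
  have Idn_cmp: "Idn V (snd (b l) (idx g j)) \<cdot>\<^bsub>V\<^esub> cmp g j = cmp g j"
    if "g \<in> Hom \<F> A (b l)" "j \<in> fst A" for g A l j
    by (rule V.Cmp_Idn_left[OF cmp_in[OF that]])
  show ?thesis
  proof (rule that)
    show "is_coproduct \<F> I b c \<iota>"
    proof (rule F.coproductI[OF c i])
      fix B \<xi> assume B: "B \<in> Obj \<F>" and xi: "\<And>i. i \<in> I \<Longrightarrow> \<xi> i \<in> Hom \<F> (b i) B"
      let ?u = "mk_arr c (\<lambda>s. idx (\<xi> (fst (k s))) (snd (k s))) (\<lambda>s. cmp (\<xi> (fst (k s))) (snd (k s))) B"
      have u: "?u \<in> Hom \<F> c B"
        using idx_in[OF xi[OF hk(2)] hk(3)] cmp_in[OF xi[OF hk(2)] hk(3)]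
        by (intro mk_arr_in[OF c B]) (simp_all add: fc sc)
      have "?u \<odot> \<iota> l = \<xi> l" if l: "l \<in> I" for l
      proof (rule Fam_ext[OF Cmp_Fam_in[OF i[OF l] u] xi[OF l]])
        fix j assume j: "j \<in> fst (b l)"
        show "idx (?u \<odot> \<iota> l) j = idx (\<xi> l) j"
          using kh[OF l j] by (simp add: idx_Cmp[OF i[OF l] j] ii[OF j] fc)
        show "cmp (?u \<odot> \<iota> l) j = cmp (\<xi> l) j"
          using kh[OF l j] V.Cmp_Idn_right[OF cmp_in[OF xi[OF l] j]]
          by (simp add: cmp_Cmp[OF i[OF l] j] ii[OF j] fc)
      qed
      then show "\<exists>u\<in>Hom \<F> c B. \<forall>i\<in>I. u \<odot> \<iota> i = \<xi> i" using u by blast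
    next
      fix B u v assume u: "u \<in> Hom \<F> c B" and v: "v \<in> Hom \<F> c B"
        and eq: "\<And>i. i \<in> I \<Longrightarrow> u \<odot> \<iota> i = v \<odot> \<iota> i"
      have kk: "idx (u \<odot> \<iota> (fst (k s))) (snd (k s)) = idx u s"
        "cmp (u \<odot> \<iota> (fst (k s))) (snd (k s)) = cmp u s"
        if s: "s \<in> S" and u: "u \<in> Hom \<F> c B" for u s
      proof -
        note l = hk(2)[OF s] and j = hk(3)[OF s]
        have "cmp u s \<in> Hom V (snd (b (fst (k s))) (snd (k s))) (snd B (idx u s))"
          using cmp_in[OF u, of s] s by (simp add: fc sc)
        from V.Cmp_Idn_right[OF this] hk(1)[OF s]
        show "idx (u \<odot> \<iota> (fst (k s))) (snd (k s)) = idx u s"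
          "cmp (u \<odot> \<iota> (fst (k s))) (snd (k s)) = cmp u s"
          by (simp_all add: idx_Cmp[OF i[OF l] j] cmp_Cmp[OF i[OF l] j] ii[OF j])
      qed
      show "u = v"
      proof (rule Fam_ext[OF u v])
        fix s assume "s \<in> fst c"
        then have s: "s \<in> S" by (simp add: fc)
        show "idx u s = idx v s" "cmp u s = cmp v s"
          using kk[OF s u] kk[OF s v] eq[OF hk(2)[OF s]] by simp_all
      qed
    qed
  next
    show "bij_betw (\<lambda>(i, g). \<iota> i \<odot> g) (SIGMA i:I. Hom \<F> (single i0 x) (b i)) (Hom \<F> (single i0 x) c)"
    proof (rule F.bij_coproductI[OF i])
      fix f assume f: "f \<in> Hom \<F> (single i0 x) c"
      define s where "s = idx f i0"
      have s: "s \<in> S" using idx_in[OF f, of i0] by (simp add: s_def fc)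
      have "cmp f i0 \<in> Hom V x (snd (b (fst (k s))) (snd (k s)))"
        using cmp_in[OF f, of i0] s by (simp add: s_def[symmetric] sc)
      note g = mk_point_in[OF b[OF hk(2)[OF s]] hk(3)[OF s] this, of i0]
      have "f = \<iota> (fst (k s)) \<odot> mk_arr (single i0 x) (\<lambda>_. snd (k s)) (\<lambda>_. cmp f i0) (b (fst (k s)))"
        (is "f = _ \<odot> ?g")
      proof (rule Fam_ext[OF f Cmp_Fam_in[OF g i[OF hk(2)[OF s]]]])
        fix j assume j: "j \<in> fst (single i0 x)"
        then have j0: "j = i0" by simp
        show "idx f j = idx (\<iota> (fst (k s)) \<odot> ?g) j"
          unfolding idx_Cmp[OF g j] using hk[OF s] j0 by (simp add: ii s_def)
        show "cmp f j = cmp (\<iota> (fst (k s)) \<odot> ?g) j"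
          unfolding cmp_Cmp[OF g j] using hk[OF s] j0 Idn_cmp[OF g j] by (simp add: ii)
      qed
      then show "\<exists>i\<in>I. \<exists>g\<in>Hom \<F> (single i0 x) (b i). f = \<iota> i \<odot> g" using g hk(2)[OF s] by blast
    next
      fix l j g g' assume l: "l \<in> I" and j: "j \<in> I" and g: "g \<in> Hom \<F> (single i0 x) (b l)"
        and g': "g' \<in> Hom \<F> (single i0 x) (b j)" and eq: "\<iota> l \<odot> g = \<iota> j \<odot> g'"
      have i0: "i0 \<in> fst (single i0 x)" by simp
      note gi = idx_in[OF g i0] and gi' = idx_in[OF g' i0]
      have "h (l, idx g i0) = h (j, idx g' i0)"
        using arg_cong[OF eq, of "\<lambda>t. idx t i0"] by (simp add: idx_Cmp[OF g i0] idx_Cmp[OF g' i0] ii gi gi')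
      then have "(l, idx g i0) = (j, idx g' i0)"
        using kh(1)[OF l gi] kh(1)[OF j gi'] by metis
      then have lj: "l = j" "idx g i0 = idx g' i0" by blast+
      have "cmp g i0 = cmp g' i0"
        using arg_cong[OF eq, of "\<lambda>t. cmp t i0"] Idn_cmp[OF g i0] Idn_cmp[OF g' i0]
        by (simp add: cmp_Cmp[OF g i0] cmp_Cmp[OF g' i0] ii gi gi')
      then have "g = g'" using lj by (intro Fam_ext[OF g]) (use g' in auto)
      then show "l = j \<and> g = g'" using lj by simp
    qed
  qed
qed

text \<open>A map out of a one-member family picks one index, hence one summand, of the concrete
  coproduct. An arbitrary coproduct of the same family is compared with it through the canonical
  isomorphism \<open>w\<close>, along which factorisations and their uniqueness are
  transported.\<close>

lemma single_connected:
  assumes x: "x \<in> Obj V"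
  shows "connected_object U \<F> (single i0 x)"
proof (rule F.connectedI[OF single_Obj[OF x]])
  fix I :: "'i set" and b c \<iota> assume I: "I \<in> U" and co: "is_coproduct \<F> I b c \<iota>"
  note i = F.coproduct_inj[OF co]
  obtain c' \<kappa> where co': "is_coproduct \<F> I b c' \<kappa>"
    and bij: "bij_betw (\<lambda>(i, g). \<kappa> i \<odot> g) (SIGMA i:I. Hom \<F> (single i0 x) (b i)) (Hom \<F> (single i0 x) c')"
    by (rule Fam_coproduct_exists[OF I F.coproduct_in[OF co], where x = x and ?i0.0 = i0])
  have fac: "\<exists>i\<in>I. \<exists>g\<in>Hom \<F> (single i0 x) (b i). f = \<kappa> i \<odot> g"
    if "f \<in> Hom \<F> (single i0 x) c'" for f
  proof -
    have "f \<in> (\<lambda>(i, g). \<kappa> i \<odot> g) ` (SIGMA i:I. Hom \<F> (single i0 x) (b i))"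
      using bij that by (simp add: bij_betw_def)
    then show ?thesis by auto
  qed
  have uni: "i = j \<and> g = h"
    if "i \<in> I" "j \<in> I" "g \<in> Hom \<F> (single i0 x) (b i)" "h \<in> Hom \<F> (single i0 x) (b j)"
       "\<kappa> i \<odot> g = \<kappa> j \<odot> h" for i j g h
    using inj_onD[OF bij_betw_imp_inj_on[OF bij], of "(i, g)" "(j, h)"] that by simp
  obtain w w' where w: "w \<in> Hom \<F> c c'" and w': "w' \<in> Hom \<F> c' c" and w'w: "w' \<odot> w = Idn \<F> c"
    and wi: "\<And>i. i \<in> I \<Longrightarrow> w \<odot> \<iota> i = \<kappa> i"
    using F.coproduct_unique[OF co co'] by blast
  {
    fix f assume f: "f \<in> Hom \<F> (single i0 x) c"
    obtain j g where j: "j \<in> I" and g: "g \<in> Hom \<F> (single i0 x) (b j)" and eq: "w \<odot> f = \<kappa> j \<odot> g"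
      using fac[OF F.Cmp_in_Hom[OF f w]] by blast
    have "w \<odot> f = w \<odot> (\<iota> j \<odot> g)"
      using F.Cmp_assoc[OF g i[OF j] w] eq wi[OF j] by simp
    then have "(w' \<odot> w) \<odot> f = (w' \<odot> w) \<odot> (\<iota> j \<odot> g)"
      using F.Cmp_assoc[OF f w w'] F.Cmp_assoc[OF F.Cmp_in_Hom[OF g i[OF j]] w w'] by simp
    then have "f = \<iota> j \<odot> g"
      using w'w F.Cmp_Idn_left[OF f] F.Cmp_Idn_left[OF F.Cmp_in_Hom[OF g i[OF j]]] by simp
    then show "\<exists>i\<in>I. \<exists>g\<in>Hom \<F> (single i0 x) (b i). f = \<iota> i \<odot> g" using j g by blast
  }
  fix j l g h assume j: "j \<in> I" and l: "l \<in> I" and g: "g \<in> Hom \<F> (single i0 x) (b j)"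
    and h: "h \<in> Hom \<F> (single i0 x) (b l)" and eq: "\<iota> j \<odot> g = \<iota> l \<odot> h"
  have "\<kappa> j \<odot> g = \<kappa> l \<odot> h"
    using F.Cmp_assoc[OF g i[OF j] w] F.Cmp_assoc[OF h i[OF l] w] wi[OF j] wi[OF l] eq by simp
  then show "j = l \<and> g = h" by (rule uni[OF j l g h])
qed

sublocale F: familial U \<F>
proof
  fix I :: "'i set" and b assume "I \<in> U" "\<And>i. i \<in> I \<Longrightarrow> b i \<in> Obj \<F>"
  then show "\<exists>c \<iota>. is_coproduct \<F> I b c \<iota>" using Fam_coproduct_exists[of I b] by blast
next
  fix A assume A: "A \<in> Obj \<F>"
  then have "fst A \<in> U" by (simp add: Obj_Fam)
  then show "\<exists>I\<in>U. \<exists>b \<iota>. is_coproduct \<F> I b A \<iota> \<and> (\<forall>i\<in>I. connected_object U \<F> (b i))"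
    using single_coproduct[OF A] single_connected[OF Obj_FamD[OF A]] by blast
qed

text \<open>Indices are pulled back as sets and components in \<open>V\<close>: over a pair of
  indices with the same image lies the pullback of the two components. As with coproducts, the set
  of pairs is replaced by a copy \<open>S\<close> inside \<open>'i\<close>, and \<open>k\<close>
  decodes it.\<close>

lemma Fam_pullbacks:
  assumes "has_finite_limits V" and f: "f \<in> Hom \<F> A C" and g: "g \<in> Hom \<F> B C"
  shows "\<exists>p q. is_pullback \<F> f g p q"
proof -
  interpret V: category_with_pullbacks V
    by unfold_locales (rule V.pullback_from_limits[OF assms(1)])
  have O: "A \<in> Obj \<F>" "B \<in> Obj \<F>" using f g by (auto simp: Hom_Fam)
  let ?K = "Sigma (fst A) (\<lambda>a. {b \<in> fst B. idx f a = idx g b})"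
  have "\<exists>S \<in> U. \<exists>h. bij_betw h ?K S"
  proof (rule Sigma_in)
    show "fst A \<in> U" using O by (simp add: Obj_Fam)
    show "{b \<in> fst B. idx f a = idx g b} \<in> U" for a
      by (rule subset_in[of "fst B"]) (use O in \<open>auto simp: Obj_Fam\<close>)
  qed
  then obtain S h where S: "S \<in> U" and h: "bij_betw h ?K S" by blast
  define k where "k = inv_into ?K h"
  have hk: "h (k s) = s" "fst (k s) \<in> fst A" "snd (k s) \<in> fst B" "idx f (fst (k s)) = idx g (snd (k s))"
    if "s \<in> S" for s
  proof -
    have "s \<in> h ` ?K" using h that by (simp add: bij_betw_def)
    from f_inv_into_f[OF this] inv_into_into[OF this]
    show "h (k s) = s" "fst (k s) \<in> fst A" "snd (k s) \<in> fst B" "idx f (fst (k s)) = idx g (snd (k s))"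
      by (auto simp: k_def)
  qed
  have kh: "k (h (a, b)) = (a, b)" "h (a, b) \<in> S" if "a \<in> fst A" "b \<in> fst B" "idx f a = idx g b" for a b
    using h that by (auto simp: k_def bij_betw_def inv_into_f_f)
  let ?f = "\<lambda>s. cmp f (fst (k s))" and ?g = "\<lambda>s. cmp g (snd (k s))"
  have fg: "?f s \<in> Arr V" "?g s \<in> Arr V" "Cod V (?f s) = Cod V (?g s)"
    "Dom V (?f s) = snd A (fst (k s))" "Dom V (?g s) = snd B (snd (k s))" if "s \<in> S" for s
    using cmp_in[OF f hk(2)[OF that]] cmp_in[OF g hk(3)[OF that]] hk(4)[OF that] by (auto simp: V.Hom_iff)
  define P where "P = (S, \<lambda>s\<in>S. Dom V (pb2 V (?f s) (?g s)))"
  have fP: "fst P = S" and sP: "\<And>s. s \<in> S \<Longrightarrow> snd P s = Dom V (pb2 V (?f s) (?g s))"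
    by (simp_all add: P_def)
  have P: "P \<in> Obj \<F>" using S fg by (auto simp: Obj_Fam P_def V.Dom_in_Obj)
  define p where "p = mk_arr P (\<lambda>s. fst (k s)) (\<lambda>s. pb1 V (?f s) (?g s)) A"
  define q where "q = mk_arr P (\<lambda>s. snd (k s)) (\<lambda>s. pb2 V (?f s) (?g s)) B"
  have p: "p \<in> Hom \<F> P A" unfolding p_def
    by (rule mk_arr_in[OF P O(1)]) (use hk fg in \<open>auto simp: fP sP V.Hom_iff\<close>)
  have q: "q \<in> Hom \<F> P B" unfolding q_def
    by (rule mk_arr_in[OF P O(2)]) (use hk fg in \<open>auto simp: fP sP V.Hom_iff\<close>)
  have pq: "idx p s = fst (k s)" "cmp p s = pb1 V (?f s) (?g s)" "idx q s = snd (k s)"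
    "cmp q s = pb2 V (?f s) (?g s)" if "s \<in> S" for s
    using that by (simp_all add: p_def q_def fP)
  have comm: "f \<odot> p = g \<odot> q"
  proof (rule Fam_ext[OF Cmp_Fam_in[OF p f] Cmp_Fam_in[OF q g]])
    fix s assume sP: "s \<in> fst P"
    then have s: "s \<in> S" by (simp add: fP)
    show "idx (f \<odot> p) s = idx (g \<odot> q) s"
      using hk(4)[OF s] by (simp add: idx_Cmp[OF p sP] idx_Cmp[OF q sP] pq[OF s])
    show "cmp (f \<odot> p) s = cmp (g \<odot> q) s"
      using V.pb_commute[OF fg(1-3)[OF s]] by (simp add: cmp_Cmp[OF p sP] cmp_Cmp[OF q sP] pq[OF s])
  qed
  have univ: "\<exists>!u. u \<in> Hom \<F> X P \<and> p \<odot> u = s \<and> q \<odot> u = t"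
    if s: "s \<in> Hom \<F> X A" and t: "t \<in> Hom \<F> X B" and eq: "f \<odot> s = g \<odot> t" for X s t
  proof -
    have X: "X \<in> Obj \<F>" using s by (simp add: Hom_Fam)
    let ?h = "\<lambda>x. h (idx s x, idx t x)"
    have ix: "idx f (idx s x) = idx g (idx t x)" if "x \<in> fst X" for x
      using arg_cong[OF eq, of "\<lambda>t. idx t x"] by (simp add: idx_Cmp[OF s that] idx_Cmp[OF t that])
    have cx: "cmp f (idx s x) \<cdot>\<^bsub>V\<^esub> cmp s x = cmp g (idx t x) \<cdot>\<^bsub>V\<^esub> cmp t x" if "x \<in> fst X" for x
      using arg_cong[OF eq, of "\<lambda>t. cmp t x"] by (simp add: cmp_Cmp[OF s that] cmp_Cmp[OF t that])
    have hx: "?h x \<in> S" "k (?h x) = (idx s x, idx t x)" if "x \<in> fst X" for x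
      using kh[OF idx_in[OF s that] idx_in[OF t that] ix[OF that]] by simp_all
    let ?l = "\<lambda>x. pb_lift V (cmp f (idx s x)) (cmp g (idx t x)) (cmp s x) (cmp t x)"
    have l: "?l x \<in> Hom V (snd X x) (Dom V (pb2 V (cmp f (idx s x)) (cmp g (idx t x))))"
      "pb1 V (cmp f (idx s x)) (cmp g (idx t x)) \<cdot>\<^bsub>V\<^esub> ?l x = cmp s x"
      "pb2 V (cmp f (idx s x)) (cmp g (idx t x)) \<cdot>\<^bsub>V\<^esub> ?l x = cmp t x" if x: "x \<in> fst X" for x
    proof -
      note F = fg[OF hx(1)[OF x], unfolded hx(2)[OF x] fst_conv snd_conv]
      note L = V.pb_lift[OF F(1-3) cmp_in[OF s x, folded F(4)] cmp_in[OF t x, folded F(5)] cx[OF x]]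
      show "?l x \<in> Hom V (snd X x) (Dom V (pb2 V (cmp f (idx s x)) (cmp g (idx t x))))"
        "pb1 V (cmp f (idx s x)) (cmp g (idx t x)) \<cdot>\<^bsub>V\<^esub> ?l x = cmp s x"
        "pb2 V (cmp f (idx s x)) (cmp g (idx t x)) \<cdot>\<^bsub>V\<^esub> ?l x = cmp t x" by (rule L)+
    qed
    let ?u = "mk_arr X ?h ?l P"
    have u: "?u \<in> Hom \<F> X P"
      by (rule mk_arr_in[OF X P]) (use hx l(1) in \<open>simp_all add: fP sP\<close>)
    have pu: "p \<odot> ?u = s"
    proof (rule Fam_ext[OF Cmp_Fam_in[OF u p] s])
      fix x assume x: "x \<in> fst X"
      show "idx (p \<odot> ?u) x = idx s x" "cmp (p \<odot> ?u) x = cmp s x"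
        using x hx[OF x] l(2)[OF x] by (simp_all add: idx_Cmp[OF u x] cmp_Cmp[OF u x] pq)
    qed
    have qu: "q \<odot> ?u = t"
    proof (rule Fam_ext[OF Cmp_Fam_in[OF u q] t])
      fix x assume x: "x \<in> fst X"
      show "idx (q \<odot> ?u) x = idx t x" "cmp (q \<odot> ?u) x = cmp t x"
        using x hx[OF x] l(3)[OF x] by (simp_all add: idx_Cmp[OF u x] cmp_Cmp[OF u x] pq)
    qed
    show ?thesis
    proof (rule ex1I[of _ ?u])
      show "?u \<in> Hom \<F> X P \<and> p \<odot> ?u = s \<and> q \<odot> ?u = t" using u pu qu by blast
      fix v assume v': "v \<in> Hom \<F> X P \<and> p \<odot> v = s \<and> q \<odot> v = t"
      then have v: "v \<in> Hom \<F> X P" by blast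
      have vi: "idx v x = ?h x" "cmp v x = ?l x" if x: "x \<in> fst X" for x
      proof -
        have vS: "idx v x \<in> S" using idx_in[OF v x] by (simp add: fP)
        have 1: "fst (k (idx v x)) = idx s x" "snd (k (idx v x)) = idx t x"
          using v' pq[OF vS] idx_Cmp[OF v x, of p] idx_Cmp[OF v x, of q] by auto
        \<comment> \<open>The projections recover both entries of the decoded pair, and the pair
          determines its code in \<open>S\<close>.\<close>
        then show ih: "idx v x = ?h x" using hk(1)[OF vS] by (metis prod.collapse)
        have 2: "pb1 V (cmp f (idx s x)) (cmp g (idx t x)) \<cdot>\<^bsub>V\<^esub> cmp v x = cmp s x"
          "pb2 V (cmp f (idx s x)) (cmp g (idx t x)) \<cdot>\<^bsub>V\<^esub> cmp v x = cmp t x"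
          using v' pq[OF vS] cmp_Cmp[OF v x, of p] cmp_Cmp[OF v x, of q] 1 by auto
        have 3: "cmp v x \<in> Hom V (snd X x) (Dom V (pb2 V (cmp f (idx s x)) (cmp g (idx t x))))"
          using cmp_in[OF v x] sP[OF vS] 1 by simp
        note F = fg[OF hx(1)[OF x], unfolded hx(2)[OF x] fst_conv snd_conv]
        show "cmp v x = ?l x"
          by (rule V.pb_ext[OF F(1-3) 3 l(1)[OF x]]) (simp_all add: 2 l[OF x])
      qed
      show "v = ?u" by (rule Fam_ext[OF v u]) (simp_all add: vi)
    qed
  qed
  have "is_pullback \<F> f g p q"
    unfolding is_pullback_def
  proof (intro conjI allI ballI impI)
    show "\<exists>!u. u \<in> Hom \<F> X (Dom \<F> p) \<and> p \<odot> u = s \<and> q \<odot> u = t"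
      if "s \<in> Hom \<F> X (Dom \<F> f)" "t \<in> Hom \<F> X (Dom \<F> g)" "f \<odot> s = g \<odot> t" for X s t
      using univ[of s X t] that f g p by (simp add: F.Hom_iff)
  qed (use p q f g comm in \<open>auto simp: F.Hom_iff\<close>)
  then show ?thesis by blast
qed

section \<open>The embedding of \<open>V\<close> as the one-member families\<close>

lemma single_functor: "is_functor V \<F> (single_functor i0 V)"
  and single_functor_ff: "fully_faithful V \<F> (single_functor i0 V)"
proof -
  let ?S = "single_functor i0 V"
  have S: "amap ?S f = mk_arr (single i0 a) (\<lambda>_. i0) (\<lambda>_. f) (single i0 b)" if "f \<in> Hom V a b" for f a b
    using that by (auto simp: single_functor_def mk_arr_def single_def V.Hom_iff)
  have So: "omap ?S = single i0" by (simp add: single_functor_def)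
  have Sin: "amap ?S f \<in> Hom \<F> (single i0 a) (single i0 b)" if "f \<in> Hom V a b" for f a b
    unfolding S[OF that] by (rule mk_point_in) (use that V.Hom_Cod_Obj[OF that] in \<open>auto intro: single_Obj\<close>)
  show "is_functor V \<F> ?S"
  proof
    fix a assume a: "a \<in> Obj V"
    show "omap ?S a \<in> Obj \<F>" using single_Obj[OF a] by (simp add: So)
    show "amap ?S (Idn V a) = Idn \<F> (omap ?S a)"
      unfolding So by (rule Fam_ext[OF Sin[OF V.Idn_in_Hom[OF a]] Idn_Fam_in[OF single_Obj[OF a]]])
        (auto simp: S[OF V.Idn_in_Hom[OF a]] Idn_Fam)
  next
    fix f a b assume "f \<in> Hom V a b"
    then show "amap ?S f \<in> Hom \<F> (omap ?S a) (omap ?S b)" using Sin by (simp add: So)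
  next
    fix f g a b c assume f: "f \<in> Hom V a b" and g: "g \<in> Hom V b c"
    note gf = V.Cmp_in_Hom[OF f g]
    show "amap ?S (g \<cdot>\<^bsub>V\<^esub> f) = amap ?S g \<odot> amap ?S f"
    proof (rule Fam_ext[OF Sin[OF gf] Cmp_Fam_in[OF Sin[OF f] Sin[OF g]]])
      fix j assume j: "j \<in> fst (single i0 a)"
      then have [simp]: "j = i0" by simp
      show "idx (amap ?S (g \<cdot>\<^bsub>V\<^esub> f)) j = idx (amap ?S g \<odot> amap ?S f) j"
        "cmp (amap ?S (g \<cdot>\<^bsub>V\<^esub> f)) j = cmp (amap ?S g \<odot> amap ?S f) j"
        unfolding idx_Cmp[OF Sin[OF f] j] cmp_Cmp[OF Sin[OF f] j] by (simp_all add: S[OF gf] S[OF f] S[OF g])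
    qed
  qed
  show "fully_faithful V \<F> ?S"
    unfolding fully_faithful_def bij_betw_def
  proof (intro ballI conjI)
    fix a b assume a: "a \<in> Obj V" and b: "b \<in> Obj V"
    show "inj_on (amap ?S) (Hom V a b)"
    proof (rule inj_onI)
      fix f g assume f: "f \<in> Hom V a b" and g: "g \<in> Hom V a b" and eq: "amap ?S f = amap ?S g"
      from arg_cong[OF eq, of "\<lambda>t. cmp t i0"] show "f = g" by (simp add: S[OF f] S[OF g])
    qed
    show "amap ?S ` Hom V a b = Hom \<F> (omap ?S a) (omap ?S b)"
    proof (intro equalityI subsetI)
      fix t assume "t \<in> Hom \<F> (omap ?S a) (omap ?S b)"
      then have t: "t \<in> Hom \<F> (single i0 a) (single i0 b)" by (simp add: So)
      have i: "idx t i0 = i0" using idx_in[OF t, of i0] by simp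
      have c: "cmp t i0 \<in> Hom V a b" using cmp_in[OF t, of i0] i by simp
      have "t = amap ?S (cmp t i0)"
        by (rule Fam_ext[OF t Sin[OF c]]) (auto simp: S[OF c] i)
      then show "t \<in> amap ?S ` Hom V a b" using c by blast
    qed (use Sin in \<open>auto simp: So\<close>)
  qed
qed

end

section \<open>Descent along covers\<close>

context is_functor
begin

lemma slice_functor: "is_functor (slice C Y) (slice D (omap F Y)) (slice_functor F)"
proof -
  interpret SC: category "slice C Y" by (rule C.category_slice)
  interpret SD: category "slice D (omap F Y)" by (rule D.category_slice)
  show ?thesis
  proof
    fix f assume "f \<in> Obj (slice C Y)"
    then have f: "f \<in> Arr C" "Cod C f = Y" by (auto simp: C.Obj_slice)
    then show "omap (slice_functor F) f \<in> Obj (slice D (omap F Y))"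
      by (simp add: slice_functor_def D.Obj_slice)
    show "amap (slice_functor F) (Idn (slice C Y) f) = Idn (slice D (omap F Y)) (omap (slice_functor F) f)"
      using f C.Dom_in_Obj by (simp add: slice_functor_def)
  next
    fix t f g assume "t \<in> Hom (slice C Y) f g"
    then obtain h where t: "t = (f, h, g)" and f: "f \<in> Arr C" "Cod C f = Y" and g: "g \<in> Arr C" "Cod C g = Y"
      and h: "h \<in> Hom C (Dom C f) (Dom C g)" "g \<cdot>\<^bsub>C\<^esub> h = f"
      by (auto simp: C.Hom_slice_iff)
    have "amap F g \<cdot>\<^bsub>D\<^esub> amap F h = amap F f"
      using amap_Cmp[OF h(1) C.Arr_Hom[OF g(1)]] h(2) by simp
    then show "amap (slice_functor F) t \<in> Hom (slice D (omap F Y)) (omap (slice_functor F) f) (omap (slice_functor F) g)"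
      using t f g amap_in_Hom[OF h(1)] by (simp add: slice_functor_def D.Hom_slice_iff)
  next
    fix s t f g h assume s: "s \<in> Hom (slice C Y) f g" and t: "t \<in> Hom (slice C Y) g h"
    obtain x where x: "s = (f, x, g)" "x \<in> Hom C (Dom C f) (Dom C g)"
      using s by (auto simp: C.Hom_slice_iff)
    obtain y where y: "t = (g, y, h)" "y \<in> Hom C (Dom C g) (Dom C h)"
      using t by (auto simp: C.Hom_slice_iff)
    show "amap (slice_functor F) (t \<cdot>\<^bsub>slice C Y\<^esub> s)
        = amap (slice_functor F) t \<cdot>\<^bsub>slice D (omap F Y)\<^esub> amap (slice_functor F) s"
      using x(1) y(1) amap_Cmp[OF x(2) y(2)] by (simp add: slice_functor_def)
  qed
qed

text \<open>An arrow between images in the slice has an underlying arrow that lifts by fullness of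
  \<open>F\<close>; faithfulness shows that the lift commutes with the maps to
  \<open>Y\<close>.\<close>

lemma slice_functor_ff:
  assumes ff: "fully_faithful C D F"
  shows "fully_faithful (slice C Y) (slice D (omap F Y)) (slice_functor F)"
  unfolding fully_faithful_def bij_betw_def
proof (intro ballI conjI)
  interpret S: is_functor "slice C Y" "slice D (omap F Y)" "slice_functor F" by (rule slice_functor)
  fix f g assume "f \<in> Obj (slice C Y)" "g \<in> Obj (slice C Y)"
  then have f: "f \<in> Arr C" "Cod C f = Y" and g: "g \<in> Arr C" "Cod C g = Y" by (auto simp: C.Obj_slice)
  note o = C.Dom_in_Obj[OF f(1)] C.Dom_in_Obj[OF g(1)]
  show "inj_on (amap (slice_functor F)) (Hom (slice C Y) f g)"
  proof (rule inj_onI)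
    fix s t assume "s \<in> Hom (slice C Y) f g" "t \<in> Hom (slice C Y) f g"
      and eq: "amap (slice_functor F) s = amap (slice_functor F) t"
    then obtain h k where st: "s = (f, h, g)" "t = (f, k, g)"
      and hk: "h \<in> Hom C (Dom C f) (Dom C g)" "k \<in> Hom C (Dom C f) (Dom C g)"
      by (auto simp: C.Hom_slice_iff)
    have "amap F h = amap F k" using eq st by (simp add: slice_functor_def)
    then have "h = k" by (rule fully_faithful_faithful[OF ff o hk])
    then show "s = t" using st by simp
  qed
  show "amap (slice_functor F) ` Hom (slice C Y) f g
      = Hom (slice D (omap F Y)) (omap (slice_functor F) f) (omap (slice_functor F) g)"
  proof (intro equalityI subsetI)
    fix t assume "t \<in> Hom (slice D (omap F Y)) (omap (slice_functor F) f) (omap (slice_functor F) g)"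
    then obtain h where t: "t = (amap F f, h, amap F g)"
      and h: "h \<in> Hom D (omap F (Dom C f)) (omap F (Dom C g))" "amap F g \<cdot>\<^bsub>D\<^esub> h = amap F f"
      using f g by (auto simp: slice_functor_def D.Hom_slice_iff)
    obtain k where k: "k \<in> Hom C (Dom C f) (Dom C g)" "amap F k = h"
      using fully_faithful_full[OF ff o h(1)] .
    have gH: "g \<in> Hom C (Dom C g) Y" and fH: "f \<in> Hom C (Dom C f) Y"
      using f g by (simp_all add: C.Hom_iff)
    have "g \<cdot>\<^bsub>C\<^esub> k = f"
      by (rule fully_faithful_faithful[OF ff o(1) C.Hom_Cod_Obj[OF fH] C.Cmp_in_Hom[OF k(1) gH] fH])
         (use amap_Cmp[OF k(1) gH] k(2) h(2) in simp)
    then have "(f, k, g) \<in> Hom (slice C Y) f g" using f g k by (simp add: C.Hom_slice_iff)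
    moreover have "amap (slice_functor F) (f, k, g) = t" using t k by (simp add: slice_functor_def)
    ultimately show "t \<in> amap (slice_functor F) ` Hom (slice C Y) f g" by force
  qed (use S.amap_in_Hom in blast)
qed

end

section \<open>The slice of \<open>Fam(V)\<close> over a one-member family, and the equivalence of
  the two conditions\<close>

context free_completion
begin

text \<open>Restricting \<open>f\<close> to the one-member summands of its domain gives arrows
  between one-member families, and these come from \<open>V\<close> because the embedding is
  full.\<close>

lemma slice_decomposition:
  assumes Y: "Y \<in> Obj V" and f: "f \<in> Obj (slice \<F> (single i0 Y))"
  shows "\<exists>I\<in>U. \<exists>b \<iota>. is_coproduct (slice \<F> (single i0 Y)) I b f \<iota> \<and>
    (\<forall>i\<in>I. b i \<in> omap (slice_functor (single_functor i0 V)) ` Obj (slice V Y))"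
proof -
  let ?S = "single_functor i0 V"
  interpret S: is_functor V \<F> ?S by (rule single_functor)
  have So: "omap ?S = single i0" by (simp add: single_functor_def)
  have f: "f \<in> Arr \<F>" "Cod \<F> f = single i0 Y" using f by (auto simp: F.Obj_slice)
  define A where "A = Dom \<F> f"
  have A: "A \<in> Obj \<F>" using f by (simp add: A_def F.Dom_in_Obj)
  have fH: "f \<in> Hom \<F> A (single i0 Y)" using f by (simp add: A_def F.Hom_iff)
  obtain \<iota> where co: "is_coproduct \<F> (fst A) (\<lambda>j. single i0 (snd A j)) A \<iota>"
    using single_coproduct[OF A] by blast
  note i = F.coproduct_inj[OF co]
  have fi: "f \<odot> \<iota> j \<in> Hom \<F> (single i0 (snd A j)) (single i0 Y)" if "j \<in> fst A" for j
    by (rule F.Cmp_in_Hom[OF i[OF that] fH])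
  have "is_coproduct (slice \<F> (single i0 Y)) (fst A) (\<lambda>j. f \<odot> \<iota> j) f (\<lambda>j. (f \<odot> \<iota> j, \<iota> j, f))"
  proof (rule F.slice_coproductI[OF f])
    show "(f \<odot> \<iota> j, \<iota> j, f) \<in> Hom (slice \<F> (single i0 Y)) (f \<odot> \<iota> j) f" if "j \<in> fst A" for j
      using i[OF that] fi[OF that] f by (simp add: F.Hom_slice_iff F.Hom_iff A_def)
    show "is_coproduct \<F> (fst A) (\<lambda>j. Dom \<F> (f \<odot> \<iota> j)) (Dom \<F> f) (\<lambda>j. fst (snd (f \<odot> \<iota> j, \<iota> j, f)))"
      unfolding A_def[symmetric] by (rule F.coproduct_cong[OF co]) (use fi in \<open>auto simp: F.Hom_iff\<close>)
  qed
  moreover have "f \<odot> \<iota> j \<in> omap (slice_functor ?S) ` Obj (slice V Y)" if j: "j \<in> fst A" for j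
  proof -
    obtain h where "h \<in> Hom V (snd A j) Y" "amap ?S h = f \<odot> \<iota> j"
      by (rule fully_faithful_full[OF single_functor_ff Obj_FamD[OF A j] Y, of "f \<odot> \<iota> j" i0])
         (use fi[OF j] in \<open>simp_all add: So\<close>)
    then show ?thesis by (force simp: slice_functor_def V.Obj_slice V.Hom_iff)
  qed
  moreover have "fst A \<in> U" using A by (simp add: Obj_Fam)
  ultimately show ?thesis by blast
qed

lemma slice_single_connected:
  assumes "f \<in> Obj (slice V Y)"
  shows "connected_object U (slice \<F> (single i0 Y)) (omap (slice_functor (single_functor i0 V)) f)"
proof -
  let ?S = "single_functor i0 V"
  interpret S: is_functor V \<F> ?S by (rule single_functor)
  have So: "omap ?S = single i0" by (simp add: single_functor_def)
  have f: "f \<in> Arr V" "Cod V f = Y" using assms by (auto simp: V.Obj_slice)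
  have "connected_object U \<F> (Dom \<F> (amap ?S f))"
    using single_connected[OF V.Dom_in_Obj[OF f(1)]] f by (simp add: So)
  then show ?thesis
    using F.slice_connected[of "amap ?S f" "single i0 Y"] f by (simp add: slice_functor_def So)
qed

text \<open>From (i), the comparison functor preserves connectedness, which makes the restricted
  functor well defined, and reflects it, which makes the restricted functor essentially surjective.
  From (ii), the image of \<open>V/Y\<close> generates \<open>Fam(V)/Y\<close> under coproducts, and
  the equivalence spreads from the generators.\<close>

lemma effective_descent_iff:
  assumes lim: "has_finite_limits V" and Y: "Y \<in> Obj V"
    and phi: "\<phi> \<in> Arr \<F>" "Cod \<F> \<phi> = single i0 Y"
  shows "effective_descent \<F> \<phi> \<longleftrightarrow>
    is_equivalence (slice V Y) (Desc_conn U \<F> \<phi>) (single_comparison U i0 V \<phi>)"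
proof -
  let ?S = "slice_functor (single_functor i0 V)" and ?C = "slice \<F> (single i0 Y)"
    and ?D = "Desc \<F> \<phi>" and ?K = "comparison \<F> \<phi>"
  let ?P = "omap ?S ` Obj (slice V Y)"
  interpret descent \<F> \<phi>
    by unfold_locales (use Fam_pullbacks[OF lim] F.Arr_Hom phi in \<open>auto simp: F.Hom_iff\<close>)
  interpret C: familial U ?C by (rule F.familial_slice[OF single_Obj[OF Y]])
  interpret D: familial U ?D by (rule familial_Desc[OF F.familial_axioms])
  interpret K: is_functor ?C ?D ?K using comparison_functor[OF F.familial_axioms] phi by simp
  have pres: "preserves_coproducts U ?C ?D ?K"
    using comparison_preserves[OF F.familial_axioms] phi by simp
  have So: "omap (single_functor i0 V) = single i0" by (simp add: single_functor_def)
  interpret S: is_functor "slice V Y" ?C ?S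
    using is_functor.slice_functor[OF single_functor, of Y i0] by (simp add: So)
  have S_ff: "fully_faithful (slice V Y) ?C ?S"
    using is_functor.slice_functor_ff[OF single_functor single_functor_ff, of Y i0] by (simp add: So)
  have Sconn: "connected_object U ?C (omap ?S f)" if "f \<in> Obj (slice V Y)" for f
    by (rule slice_single_connected[OF that])
  interpret KS: is_functor "slice V Y" ?D "?K \<circ>\<^sub>F ?S"
    by (rule comp_is_functor[OF S.is_functor_axioms K.is_functor_axioms])
  let ?DC = "full_subcategory ?D (connected_object U ?D)"
  have KS_simps: "omap (?K \<circ>\<^sub>F ?S) f = omap ?K (omap ?S f)" "amap (?K \<circ>\<^sub>F ?S) t = amap ?K (amap ?S t)" for f t
    by (simp_all add: comp_functor_def)
  \<comment> \<open>The embedding is bijective on hom-sets, so the composite is bijective on a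
    hom-set exactly when the comparison functor is bijective between the corresponding objects of
    \<open>Fam(V)/Y\<close>.\<close>
  have KS_bij: "bij_betw (amap (?K \<circ>\<^sub>F ?S)) (Hom (slice V Y) f g) (Hom ?D (omap (?K \<circ>\<^sub>F ?S) f) (omap (?K \<circ>\<^sub>F ?S) g))
      \<longleftrightarrow> bij_betw (amap ?K) (Hom ?C (omap ?S f) (omap ?S g)) (Hom ?D (omap ?K (omap ?S f)) (omap ?K (omap ?S g)))"
    if "f \<in> Obj (slice V Y)" "g \<in> Obj (slice V Y)" for f g
  proof -
    have "bij_betw (amap ?S) (Hom (slice V Y) f g) (Hom ?C (omap ?S f) (omap ?S g))"
      using S_ff that by (simp add: fully_faithful_def)
    from bij_betw_comp_iff[OF this, of "amap ?K"] show ?thesis by (simp add: comp_functor_def comp_def)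
  qed
  have "effective_descent \<F> \<phi> \<longleftrightarrow> is_equivalence ?C ?D ?K"
    using phi by (simp add: effective_descent_def)
  also have "\<dots> \<longleftrightarrow> is_equivalence (slice V Y) ?DC (?K \<circ>\<^sub>F ?S)"
  proof
    assume "is_equivalence ?C ?D ?K"
    then have ff: "fully_faithful ?C ?D ?K" and es: "ess_surj ?C ?D ?K"
      by (simp_all add: is_equivalence_iff)
    have KSconn: "connected_object U ?D (omap (?K \<circ>\<^sub>F ?S) f)" if "f \<in> Obj (slice V Y)" for f
      unfolding KS_simps by (rule K.equivalence_preserves_connected[OF ff es Sconn[OF that]])
    have "fully_faithful (slice V Y) ?DC (?K \<circ>\<^sub>F ?S)"
      unfolding fully_faithful_def Hom_full_subcategory
      using KS_bij ff KSconn S.omap_in_Obj by (simp add: fully_faithful_def)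
    moreover have "ess_surj (slice V Y) ?DC (?K \<circ>\<^sub>F ?S)"
      unfolding ess_surj_def
    proof
      fix d assume "d \<in> Obj ?DC"
      then have d: "d \<in> Obj ?D" "connected_object U ?D d" by simp_all
      \<comment> \<open>The object \<open>c\<close> inherits connectedness from \<open>d\<close> by
        reflection. A connected object is isomorphic to one of the summands in any decomposition of
        it, and the summands can be taken from \<open>V/Y\<close>.\<close>
      obtain c where c: "c \<in> Obj ?C" and cd: "isomorphic ?D (omap ?K c) d"
        using es d(1) unfolding ess_surj_def by blast
      have "connected_object U ?C c"
        by (rule K.reflects_connected[OF ff pres c D.connected_isomorphic[OF d(2) isomorphic_sym[OF cd]]])
      moreover obtain I b \<iota> where I: "I \<in> U" and co: "is_coproduct ?C I b c \<iota>" and b: "\<forall>i\<in>I. b i \<in> ?P"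
        using slice_decomposition[OF Y c] by blast
      ultimately obtain i where "i \<in> I" "isomorphic ?C (b i) c"
        using C.connected_isomorphic_summand[OF _ I co] by blast
      then obtain f where f: "f \<in> Obj (slice V Y)" and fc: "isomorphic ?C (omap ?S f) c" using b by auto
      have "isomorphic ?D (omap (?K \<circ>\<^sub>F ?S) f) d"
        unfolding KS_simps by (rule D.isomorphic_trans[OF K.isomorphic_omap[OF fc] cd])
      then show "\<exists>f\<in>Obj (slice V Y). isomorphic ?DC (omap (?K \<circ>\<^sub>F ?S) f) d"
        using f d KSconn by (auto simp: isomorphic_full_subcategory)
    qed
    ultimately show "is_equivalence (slice V Y) ?DC (?K \<circ>\<^sub>F ?S)"
      using KS.functor_to_full_subcategory[of "connected_object U ?D", OF KSconn] by (simp add: is_equivalence_iff)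
  next
    assume "is_equivalence (slice V Y) ?DC (?K \<circ>\<^sub>F ?S)"
    then have functor_DC: "is_functor (slice V Y) ?DC (?K \<circ>\<^sub>F ?S)"
      and ff: "fully_faithful (slice V Y) ?DC (?K \<circ>\<^sub>F ?S)" and es: "ess_surj (slice V Y) ?DC (?K \<circ>\<^sub>F ?S)"
      by (simp_all add: is_equivalence_iff)
    \<comment> \<open>That the composite is a functor into the full subcategory already says that
      its values are connected.\<close>
    have KSconn: "connected_object U ?D (omap ?K (omap ?S f))" if "f \<in> Obj (slice V Y)" for f
      using is_functor.omap_in_Obj[OF functor_DC that] by (simp add: KS_simps)
    have bij: "bij_betw (amap ?K) (Hom ?C a b) (Hom ?D (omap ?K a) (omap ?K b))" if "a \<in> ?P" "b \<in> ?P" for a b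
      using that ff KS_bij KSconn by (auto simp: fully_faithful_def Hom_full_subcategory KS_simps)
    show "is_equivalence ?C ?D ?K"
    proof (rule equivalence_from_generators[OF C.familial_axioms D.familial_axioms K.is_functor_axioms pres, where P = ?P])
      show "connected_object U ?C a" if "a \<in> ?P" for a using that Sconn by blast
      show "connected_object U ?D (omap ?K a)" if "a \<in> ?P" for a using that KSconn by blast
      show "\<exists>I\<in>U. \<exists>b \<iota>. is_coproduct ?C I b c \<iota> \<and> (\<forall>i\<in>I. b i \<in> ?P)" if "c \<in> Obj ?C" for c
        by (rule slice_decomposition[OF Y that])
      show "\<exists>f\<in>Hom ?C a b. amap ?K f = h" if "a \<in> ?P" "b \<in> ?P" "h \<in> Hom ?D (omap ?K a) (omap ?K b)" for a b h
      proof -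
        have "h \<in> amap ?K ` Hom ?C a b" using bij_betw_imp_surj_on[OF bij[OF that(1,2)]] that(3) by simp
        then show ?thesis by auto
      qed
      show "f = g" if "a \<in> ?P" "b \<in> ?P" "f \<in> Hom ?C a b" "g \<in> Hom ?C a b" "amap ?K f = amap ?K g" for a b f g
        using inj_onD[OF bij_betw_imp_inj_on[OF bij[OF that(1,2)]] that(5,3,4)] .
      show "\<exists>a\<in>?P. isomorphic ?D (omap ?K a) d" if d: "connected_object U ?D d" for d
      proof -
        have "d \<in> Obj ?DC" using d D.connected_Obj by simp
        then obtain f where f: "f \<in> Obj (slice V Y)" and i: "isomorphic ?DC (omap (?K \<circ>\<^sub>F ?S) f) d"
          using es unfolding ess_surj_def by blast
        then have "isomorphic ?D (omap ?K (omap ?S f)) d"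
          using KSconn[OF f] d by (simp add: KS_simps isomorphic_full_subcategory)
        then show ?thesis using f by blast
      qed
    qed
  qed
  finally show ?thesis by (simp add: Desc_conn_def single_comparison_def)
qed

end

theorem theorem3p3p5:
  fixes U :: "'i set set" and V :: "('o, 'a) cat"
    and Y :: 'o and i0 :: 'i and \<phi> :: "('i, 'o, 'a) fam_arr"
  assumes "universe U"
    and "category V"
    and "has_finite_limits V"
    and "Y \<in> Obj V"
    and "\<phi> \<in> Arr (Fam U V)"
    and "Cod (Fam U V) \<phi> = single i0 Y"
  shows "effective_descent (Fam U V) \<phi> \<longleftrightarrow>
         is_equivalence (slice V Y) (Desc_conn U (Fam U V) \<phi>) (single_comparison U i0 V \<phi>)"
  by (rule free_completion.effective_descent_iff[OF free_completion.intro[OF assms(1,2)] assms(3-6)])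

end
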